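(* Let $n\ge 2$, let $T\subset\mathbb{R}^n$ be a nondegenerate $n$-simplex with Alfeld split $T^z$, and let $r\ge 0$ and $1\le k\le n$ be integers. Suppose that $\omega\in\mathring{V}_{d,r}^k(T^z)$ and $d\omega=0$. Then there exists $\rho\in\mathring{M}_{r+1}^{k-1}(T^z)$ such that $d\rho=\omega$.
   Context: Let $T=[x_0,\dots,x_n]$ be a nondegenerate $n$-simplex in $\mathbb{R}^n$ and let $z=\frac1{n+1}\sum_{i=0}^n x_i$ be its barycenter. The Alfeld split is $T^z=\{T_0,\dots,T_n\}$, where $T_i$ is the $n$-simplex with vertices $z$ and all $x_j$, $j\ne i$. $\Delta_{s}(T)$ denotes the set of $s$-dimensional subsimplices of $T$. For an $n$-simplex $S$, $\mathcal{P}_r\Lambda^k(S)$ is the space of differential $k$-forms on $S$ whose coefficients are polynomials of total degree at most $r$ (it is $\{0\}$ if $r<0$). $L^2\Lambda^k(T)$ and $C^0\Lambda^k(T)$ are the $k$-forms on $T$ with $L^2$ coefficients, respectively with coefficients continuous on the closed simplex. $d$ is the exterior derivative (in the weak sense), and $\operatorname{tr}_F\omega$ is the trace of a form on a face $F$, i.e. its pullback under the inclusion of $F$; by contrast $\omega|_{\partial T}=0$ means that all coefficients of $\omega$ vanish on $\partial T$. Spaces: $V_r^k(T^z)=\{\omega\in L^2\Lambda^k(T):\omega|_{T_i}\in\mathcal{P}_r\Lambda^k(T_i),\ 0\le i\le n\}$; $V_{d,r}^k(T^z)=\{\omega\in V_r^k(T^z): d\omega\in L^2\Lambda^{k+1}(T)\}$;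 $M_r^k(T^z)=\{\omega\in C^0\Lambda^k(T):\omega|_{T_i}\in\mathcal{P}_r\Lambda^k(T_i),\ 0\le i\le n\}$. For $k\le n-1$: $\mathring{V}_{d,r}^k(T^z)=\{\omega\in V_{d,r}^k(T^z):\operatorname{tr}_F\omega=0\ \forall F\in\Delta_{n-1}(T)\}$ and $\mathring{M}_r^k(T^z)=\{\omega\in M_r^k(T^z):\omega|_{\partial T}=0\}$. For $k=n$: $\mathring{V}_{d,r}^n(T^z)=\{\omega\in V_{d,r}^n(T^z):\int_T\omega=0\}$. *)

theory Defs
  imports "HOL-Analysis.Analysis"
begin

section \<open>Simplices and the Alfeld split\<close>

text \<open>A simplex is given by its (affinely independent) vertex set \<open>V\<close>; as a point set it is
  \<open>convex hull V\<close>.\<close>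

definition subsimplices :: "nat \<Rightarrow> 'a::real_vector set \<Rightarrow> 'a set set" where
  "subsimplices s V = {convex hull W | W. W \<subseteq> V \<and> card W = Suc s}"

definition barycenter :: "'a::real_vector set \<Rightarrow> 'a" where
  "barycenter V = (1 / real (card V)) *\<^sub>R (\<Sum>x\<in>V. x)"

definition alfeld_split :: "'a::real_vector set \<Rightarrow> 'a set set" where
  "alfeld_split V = {convex hull (insert (barycenter V) (V - {x})) | x. x \<in> V}"


section \<open>Differential forms\<close>

text \<open>An alternating \<open>k\<close>-linear form is a function of sequences of vectors that depends on the
  entries \<open>0, \<dots>, k - 1\<close> only; for \<open>k = 0\<close> it is a constant, i.e. a real number.
  A \<open>k\<close>-form \<open>\<omega>\<close> assigns to a point \<open>x\<close> such a form \<open>\<omega> x\<close>.  Its coefficients are the functions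
  \<open>\<lambda>x. \<omega> x v\<close> where \<open>v\<close> is a sequence of standard basis vectors, \<open>v \<in> {..<k} \<rightarrow> Basis\<close>.  (For such
  \<open>v\<close> that are not increasing with respect to a chosen order of the coordinates this is, up to sign,
  another coefficient, or \<open>0\<close>.)\<close>

type_synonym 'n form = "real ^ 'n \<Rightarrow> (nat \<Rightarrow> real ^ 'n) \<Rightarrow> real"

definition alternating :: "nat \<Rightarrow> ((nat \<Rightarrow> 'a::real_vector) \<Rightarrow> real) \<Rightarrow> bool" where
  "alternating k \<alpha> \<longleftrightarrow>
     (\<forall>v w. (\<forall>i<k. v i = w i) \<longrightarrow> \<alpha> v = \<alpha> w) \<and>
     (\<forall>v. \<forall>i<k. linear (\<lambda>y. \<alpha> (v(i := y)))) \<and>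
     (\<forall>v. \<forall>i<k. \<forall>j<k. i \<noteq> j \<and> v i = v j \<longrightarrow> \<alpha> v = 0)"

definition zero_form :: "'n::finite form" where
  "zero_form = (\<lambda>x v. 0)"

definition poly_deg_le :: "nat \<Rightarrow> (real ^ 'n \<Rightarrow> real) \<Rightarrow> bool" where
  "poly_deg_le r f \<longleftrightarrow>
     (\<exists>c :: ('n \<Rightarrow> nat) \<Rightarrow> real.
        \<forall>x. f x = (\<Sum>a | (\<Sum>i\<in>UNIV. a i) \<le> r. c a * (\<Prod>i\<in>UNIV. (x $ i) ^ a i)))"

text \<open>Polynomial forms are defined on the whole space; a polynomial form on an \<open>n\<close>-simplex \<open>S\<close> is the
  restriction of a unique one of these to \<open>S\<close>.\<close>

definition poly_forms :: "nat \<Rightarrow> nat \<Rightarrow> 'n::finite form set" where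
  "poly_forms r k =
     {p. (\<forall>x. alternating k (p x)) \<and> (\<forall>v \<in> {..<k} \<rightarrow> Basis. poly_deg_le r (\<lambda>x. p x v))}"

text \<open>Elements of \<open>L\<^sup>2\<close> are represented by functions; equality of such elements is equality almost
  everywhere.  Values outside \<open>T\<close> play no role.\<close>

definition L2_forms :: "nat \<Rightarrow> (real ^ 'n) set \<Rightarrow> 'n::finite form set" where
  "L2_forms k T =
     {\<omega>. (\<forall>x\<in>T. alternating k (\<omega> x)) \<and>
         (\<forall>v \<in> {..<k} \<rightarrow> Basis. (\<lambda>x. \<omega> x v) \<in> borel_measurable (lebesgue_on T) \<and>
            integrable (lebesgue_on T) (\<lambda>x. (\<omega> x v)\<^sup>2))}"

definition C0_forms :: "nat \<Rightarrow> (real ^ 'n) set \<Rightarrow> 'n::finite form set" where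
  "C0_forms k T =
     {\<omega>. (\<forall>x\<in>T. alternating k (\<omega> x)) \<and>
         (\<forall>v \<in> {..<k} \<rightarrow> Basis. continuous_on T (\<lambda>x. \<omega> x v))}"


section \<open>The weak exterior derivative\<close>

primrec Ck_function :: "nat \<Rightarrow> ('a::euclidean_space \<Rightarrow> real) \<Rightarrow> bool" where
  "Ck_function 0 f \<longleftrightarrow> continuous_on UNIV f"
| "Ck_function (Suc m) f \<longleftrightarrow>
     (\<exists>f'. (\<forall>x. (f has_derivative f' x) (at x)) \<and> (\<forall>u. Ck_function m (\<lambda>x. f' x u)))"

definition test_functions :: "'a::euclidean_space set \<Rightarrow> ('a \<Rightarrow> real) set" where
  "test_functions U =
     {\<phi>. (\<forall>m. Ck_function m \<phi>) \<and> (\<exists>K. compact K \<and> K \<subseteq> U \<and> (\<forall>x. x \<notin> K \<longrightarrow> \<phi> x = 0))}"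

definition omit :: "nat \<Rightarrow> (nat \<Rightarrow> 'a) \<Rightarrow> nat \<Rightarrow> 'a" where
  "omit i v = (\<lambda>j. if j < i then v j else v (Suc j))"

text \<open>For a smooth \<open>k\<close>-form and constant vectors \<open>v\<^sub>0, \<dots>, v\<^sub>k\<close>, \<open>d\<omega> (v\<^sub>0, \<dots>, v\<^sub>k)\<close> is the sum over \<open>i\<close>
  of \<open>(-1)\<^sup>i\<close> times the derivative of \<open>\<omega> (v\<^sub>0, \<dots>, v\<^sub>k)\<close>, with \<open>v\<^sub>i\<close> omitted, in direction \<open>v\<^sub>i\<close>.
  In the weak sense these derivatives are moved to a test function on the interior of \<open>T\<close>.
  \<open>weak_ext_deriv k T \<omega> \<eta>\<close> says that \<open>d\<omega> = \<eta>\<close>; it is meant for \<open>\<omega> \<in> L2_forms k T\<close> and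
  \<open>\<eta> \<in> L2_forms (Suc k) T\<close>, for which all the integrands are integrable.\<close>

definition weak_ext_deriv ::
    "nat \<Rightarrow> (real ^ 'n) set \<Rightarrow> 'n::finite form \<Rightarrow> 'n form \<Rightarrow> bool" where
  "weak_ext_deriv k T \<omega> \<eta> \<longleftrightarrow>
     (\<forall>\<phi> \<in> test_functions (interior T). \<forall>v \<in> {..<Suc k} \<rightarrow> Basis.
        (LINT x|lebesgue_on T. \<eta> x v * \<phi> x) =
        - (\<Sum>i\<le>k. (-1) ^ i *
             (LINT x|lebesgue_on T. \<omega> x (omit i v) * frechet_derivative \<phi> (at x) (v i))))"


section \<open>Traces and integrals of forms\<close>

definition tangent_space :: "'a::real_vector set \<Rightarrow> 'a set" where
  "tangent_space F = span {y - x | x y. x \<in> F \<and> y \<in> F}"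

text \<open>The pullback to \<open>F\<close>, extended by \<open>0\<close> to points outside \<open>F\<close> and to vectors not tangent to \<open>F\<close>.\<close>

definition tr :: "nat \<Rightarrow> (real ^ 'n) set \<Rightarrow> 'n::finite form \<Rightarrow> 'n form" where
  "tr k F \<omega> = (\<lambda>x v. if x \<in> F \<and> v \<in> {..<k} \<rightarrow> tangent_space F then \<omega> x v else 0)"

text \<open>The integral of an \<open>n\<close>-form \<open>f dx\<^sub>1 \<and> \<dots> \<and> dx\<^sub>n\<close> is the integral of its coefficient
  \<open>f x = \<omega> x (e\<^sub>1, \<dots>, e\<^sub>n)\<close>.  Since the index type carries no order, an enumeration of the standard
  basis is chosen; another choice changes the integral at most by a sign.\<close>

definition std_frame :: "nat \<Rightarrow> real ^ 'n::finite" where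
  "std_frame = (SOME e. bij_betw e {..<CARD('n)} Basis)"

definition form_integral :: "(real ^ 'n) set \<Rightarrow> 'n::finite form \<Rightarrow> real" where
  "form_integral T \<omega> = (LINT x|lebesgue_on T. \<omega> x std_frame)"


section \<open>Piecewise polynomial forms on the Alfeld split\<close>

definition V_space :: "nat \<Rightarrow> nat \<Rightarrow> (real ^ 'n) set \<Rightarrow> 'n::finite form set" where
  "V_space r k V =
     {\<omega> \<in> L2_forms k (convex hull V).
        \<forall>S \<in> alfeld_split V. \<exists>p \<in> poly_forms r k. AE x in lebesgue_on S. \<omega> x = p x}"

definition Vd_space :: "nat \<Rightarrow> nat \<Rightarrow> (real ^ 'n) set \<Rightarrow> 'n::finite form set" where
  "Vd_space r k V =
     {\<omega> \<in> V_space r k V.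
        \<exists>\<eta> \<in> L2_forms (Suc k) (convex hull V). weak_ext_deriv k (convex hull V) \<omega> \<eta>}"

text \<open>The trace on \<open>F\<close> of an \<open>L\<^sup>2\<close> form that is piecewise polynomial is the trace of the polynomial
  form that represents it on the cell \<open>S\<close> having \<open>F\<close> as a face.\<close>

definition Vd0_space :: "nat \<Rightarrow> nat \<Rightarrow> (real ^ 'n) set \<Rightarrow> 'n::finite form set" where
  "Vd0_space r k V =
     (if k < CARD('n)
      then {\<omega> \<in> Vd_space r k V.
              \<forall>F \<in> subsimplices (CARD('n) - 1) V. \<forall>S \<in> alfeld_split V. F \<subseteq> S \<longrightarrow>
                (\<forall>p \<in> poly_forms r k. (AE x in lebesgue_on S. \<omega> x = p x) \<longrightarrow> tr k F p = zero_form)}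
      else {\<omega> \<in> Vd_space r k V. form_integral (convex hull V) \<omega> = 0})"

definition M_space :: "nat \<Rightarrow> nat \<Rightarrow> (real ^ 'n) set \<Rightarrow> 'n::finite form set" where
  "M_space r k V =
     {\<omega> \<in> C0_forms k (convex hull V).
        \<forall>S \<in> alfeld_split V. \<exists>p \<in> poly_forms r k. \<forall>x\<in>S. \<omega> x = p x}"

text \<open>Used for \<open>k \<le> n - 1\<close> only.\<close>

definition M0_space :: "nat \<Rightarrow> nat \<Rightarrow> (real ^ 'n) set \<Rightarrow> 'n::finite form set" where
  "M0_space r k V =
     {\<omega> \<in> M_space r k V.
        \<forall>x \<in> frontier (convex hull V). \<forall>v \<in> {..<k} \<rightarrow> Basis. \<omega> x v = 0}"

end

theory Submission
  imports Defs
begin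

text \<open>Why the theorem holds.  Let \<open>\<lambda>\<^sub>j\<close>, for \<open>j\<close> in a set of \<open>n + 1\<close> indices, be the barycentric coordinates
  of the simplex.  The cells of the Alfeld split are the domains of linearity of the height
  \<open>m = min\<^sub>j \<lambda>\<^sub>j\<close>, which vanishes on the boundary of the simplex.  The map \<open>x \<mapsto> (\<lambda>\<^sub>j x - m x)\<^sub>j\<close> lifts the
  simplex to \<open>\<real>\<^sup>n\<^sup>+\<^sup>1\<close>, as the part of the boundary of the positive orthant with \<open>\<Sum>\<^sub>j y\<^sub>j \<le> 1\<close>: the cell
  opposite to the vertex \<open>i\<close> goes to the hyperplane \<open>y\<^sub>i = 0\<close>, and the boundary of the simplex to the
  hyperplane \<open>\<Sum>\<^sub>j y\<^sub>j = 1\<close>, the floor.  The difference of two lifts of a point, with respect to different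
  cells, is a multiple of \<open>e = (1, \<dots>, 1)\<close>, the vertical direction.

  A weakly closed piecewise polynomial form has closed pieces whose traces agree on the common faces
  (\<open>pieces_closed\<close>, \<open>pieces_traces_agree\<close>).  For coordinate hyperplanes forms with matching traces
  are easily glued: the lifted pieces are the traces of one closed polynomial form \<open>\<Omega>\<close> on \<open>\<real>\<^sup>n\<^sup>+\<^sup>1\<close>,
  of the same degree (\<open>glue_on_coord_planes\<close>).

  Suppose that the trace of \<open>\<Omega>\<close> on the floor is zero.  Integrating \<open>\<Omega>\<close> vertically from the floor gives
  \<open>R\<close> with \<open>dR = \<Omega>\<close>, with no component in the direction \<open>e\<close>, and vanishing on the floor
  (\<open>vertical_primitive\<close>).  Its pullback \<open>\<rho>\<close> to the simplex is what is wanted: it is polynomial of one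
  degree more on each cell, its coefficients are continuous because \<open>R\<close> does not see the jumps of the
  derivative of the lift, which are vertical, and they vanish on the boundary.

  The boundary condition only says that the trace of \<open>\<Omega>\<close> on the floor vanishes on the boundary of the
  face of the standard simplex that lies there.  So \<open>\<Omega>\<close> has to be corrected by a closed form with the
  same trace on the floor and zero traces on the coordinate hyperplanes.  Such a form exists by the
  exactness of polynomial forms with vanishing boundary traces on a simplex, except that in top degree
  the integral is an obstruction (\<open>closed_extension_from_simplex\<close>, which rests on the extension lemma
  \<open>extend_from_simplex\<close>).  For \<open>k = n\<close> the form can therefore be made exact up to a multiple of the
  volume form, and this multiple is zero because exact forms and the given one have integral zero.

  Both the exactness of the polynomial forms and the vertical integration come from one homotopy
  operator (\<open>ext_d_homotopy_op\<close>).  All integrations by parts, for the pieces as well as for the weak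
  derivative of \<open>\<rho>\<close>, come from the fact that the integral of a directional derivative of a Lipschitz
  function with bounded support is zero (\<open>integral_dir_deriv_eq_0\<close>).\<close>

section \<open>Polynomial functions of bounded degree\<close>

text \<open>Generated by multiplication with linear functions rather than by monomials: bounds on the degree
  are then proved by induction, without coordinates, and survive composition with affine maps.\<close>

inductive deg_le :: "nat \<Rightarrow> ('a::real_vector \<Rightarrow> real) \<Rightarrow> bool" where
  const: "deg_le r (\<lambda>x. c)"
| add: "deg_le r f \<Longrightarrow> deg_le r g \<Longrightarrow> deg_le r (\<lambda>x. f x + g x)"
| mult: "linear l \<Longrightarrow> deg_le r f \<Longrightarrow> deg_le (Suc r) (\<lambda>x. l x * f x)"

lemma deg_le_Suc: "deg_le r f \<Longrightarrow> deg_le (Suc r) f"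
  by (induction rule: deg_le.induct) (auto intro: deg_le.intros)

lemma deg_le_mono: "deg_le r f \<Longrightarrow> r \<le> s \<Longrightarrow> deg_le s f"
  by (induction s rule: nat_induct) (auto simp: le_Suc_eq intro: deg_le_Suc)

lemma deg_le_cmult: "deg_le r f \<Longrightarrow> deg_le r (\<lambda>x. c * f x)"
proof (induction rule: deg_le.induct)
  case (add r f g)
  then show ?case using deg_le.add[OF add.IH] by (simp add: distrib_left)
next
  case (mult l r f)
  then show ?case using deg_le.mult[OF mult.hyps(1) mult.IH] by (simp add: mult.left_commute)
qed (rule deg_le.const)

lemma deg_le_diff: "deg_le r f \<Longrightarrow> deg_le r g \<Longrightarrow> deg_le r (\<lambda>x. f x - g x)"
  using deg_le.add[of r f "\<lambda>x. (-1) * g x"] deg_le_cmult[of r g "-1"] by simp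

lemma deg_le_sum: "(\<And>i. i \<in> I \<Longrightarrow> deg_le r (f i)) \<Longrightarrow> deg_le r (\<lambda>x. \<Sum>i\<in>I. f i x)"
  by (induction I rule: infinite_finite_induct) (auto intro: deg_le.intros)

lemma deg_le_linear: "linear l \<Longrightarrow> deg_le (Suc 0) l"
  using deg_le.mult[OF _ deg_le.const[of 0 1]] by simp

lemma deg_le_affine_mult:
  assumes "linear l" "deg_le r f"
  shows "deg_le (Suc r) (\<lambda>x. (l x + c) * f x)"
  using deg_le.add[OF deg_le.mult[OF assms] deg_le_Suc[OF deg_le_cmult[OF assms(2), of c]]]
  by (simp add: distrib_right)

lemma deg_le_mult:
  assumes "deg_le r f" "deg_le s g"
  shows "deg_le (r + s) (\<lambda>x. f x * g x)"
  using assms(1)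
proof (induction rule: deg_le.induct)
  case (const r c)
  show ?case by (rule deg_le_mono[OF deg_le_cmult[OF assms(2)]]) simp
next
  case (add r f g)
  then show ?case using deg_le.add[OF add.IH] by (simp add: distrib_right)
next
  case (mult l r f)
  then show ?case using deg_le.mult[OF mult.hyps(1) mult.IH] by (simp add: mult.assoc)
qed

lemma deg_le_power: "deg_le r f \<Longrightarrow> deg_le (r * n) (\<lambda>x. f x ^ n)"
  by (induction n) (auto intro: deg_le.const deg_le_mult)

lemma deg_le_prod:
  assumes "\<And>i. i \<in> I \<Longrightarrow> deg_le (d i) (f i)"
  shows "deg_le (sum d I) (\<lambda>x. \<Prod>i\<in>I. f i x)"
  using assms
  by (induction I rule: infinite_finite_induct) (auto intro: deg_le.const deg_le_mult)

lemma finite_multi_indices: "finite {a :: 'n::finite \<Rightarrow> nat. sum a UNIV \<le> r}"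
proof (rule finite_subset)
  show "{a :: 'n \<Rightarrow> nat. sum a UNIV \<le> r} \<subseteq> PiE UNIV (\<lambda>_. {..r})"
  proof
    fix a :: "'n \<Rightarrow> nat" assume "a \<in> {a. sum a UNIV \<le> r}"
    then have "a i \<le> r" for i using member_le_sum[of i UNIV a] by simp
    then show "a \<in> PiE UNIV (\<lambda>_. {..r})" by (simp add: PiE_UNIV_domain)
  qed
qed (simp add: finite_PiE)

lemma deg_le_if_poly_deg_le:
  fixes f :: "real ^ 'n::finite \<Rightarrow> real"
  assumes "poly_deg_le r f"
  shows "deg_le r f"
proof -
  obtain c where c: "\<And>x. f x = (\<Sum>a | (\<Sum>i\<in>UNIV. a i) \<le> r. c a * (\<Prod>i\<in>UNIV. (x $ i) ^ a i))"
    using assms unfolding poly_deg_le_def by blast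
  have "deg_le (sum a UNIV) (\<lambda>x::real^'n. \<Prod>i\<in>UNIV. (x $ i) ^ a i)" for a :: "'n \<Rightarrow> nat"
  proof (rule deg_le_prod)
    fix i :: 'n
    have "linear (\<lambda>x::real^'n. x $ i)" by (simp add: linear_iff)
    from deg_le_power[OF deg_le_linear[OF this], of "a i"]
    show "deg_le (a i) (\<lambda>x::real^'n. (x $ i) ^ a i)" by simp
  qed
  then have "deg_le r (\<lambda>x::real^'n. \<Sum>a | (\<Sum>i\<in>UNIV. a i) \<le> r. c a * (\<Prod>i\<in>UNIV. (x $ i) ^ a i))"
    by (intro deg_le_sum deg_le_cmult) (auto intro: deg_le_mono)
  then show ?thesis using c by (metis (no_types, lifting) ext)
qed

lemma poly_deg_le_add:
  assumes "poly_deg_le r f" "poly_deg_le r g"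
  shows "poly_deg_le r (\<lambda>x. f x + g x)"
proof -
  obtain c d where
    "\<And>x. f x = (\<Sum>a | (\<Sum>i\<in>UNIV. a i) \<le> r. c a * (\<Prod>i\<in>UNIV. (x $ i) ^ a i))"
    "\<And>x. g x = (\<Sum>a | (\<Sum>i\<in>UNIV. a i) \<le> r. d a * (\<Prod>i\<in>UNIV. (x $ i) ^ a i))"
    using assms unfolding poly_deg_le_def by blast
  then show ?thesis unfolding poly_deg_le_def
    by (intro exI[of _ "\<lambda>a. c a + d a"]) (simp add: distrib_right sum.distrib)
qed

lemma poly_deg_le_const: "poly_deg_le r (\<lambda>x :: real ^ 'n::finite. b)"
  unfolding poly_deg_le_def
proof (intro exI[of _ "\<lambda>a. if a = (\<lambda>_. 0) then b else 0"] allI)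
  fix x :: "real ^ 'n"
  have "(\<Sum>a | sum a UNIV \<le> r. (if a = (\<lambda>_. 0) then b else 0) * (\<Prod>i\<in>UNIV. (x $ i) ^ a i)) =
    (\<Sum>a | sum a UNIV \<le> r. if a = (\<lambda>_::'n. 0) then b else 0)"
    by (intro sum.cong) auto
  also have "\<dots> = b" by (subst sum.delta) (auto simp: finite_multi_indices)
  finally show "b = (\<Sum>a | sum a UNIV \<le> r. (if a = (\<lambda>_. 0) then b else 0) * (\<Prod>i\<in>UNIV. (x $ i) ^ a i))"
    by simp
qed

lemma poly_deg_le_cmult:
  assumes "poly_deg_le r f"
  shows "poly_deg_le r (\<lambda>x. b * f x)"
proof -
  obtain c where
    "\<And>x. f x = (\<Sum>a | (\<Sum>i\<in>UNIV. a i) \<le> r. c a * (\<Prod>i\<in>UNIV. (x $ i) ^ a i))"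
    using assms unfolding poly_deg_le_def by blast
  then show ?thesis unfolding poly_deg_le_def
    by (intro exI[of _ "\<lambda>a. b * c a"]) (simp add: sum_distrib_left mult.assoc)
qed

lemma poly_deg_le_coord_mult:
  fixes f :: "real ^ 'n::finite \<Rightarrow> real"
  assumes "poly_deg_le r f"
  shows "poly_deg_le (Suc r) (\<lambda>x. x $ j * f x)"
proof -
  obtain c where c:
    "\<And>x. f x = (\<Sum>a | (\<Sum>i\<in>UNIV. a i) \<le> r. c a * (\<Prod>i\<in>UNIV. (x $ i) ^ a i))"
    using assms unfolding poly_deg_le_def by blast
  define up where "up a = a(j := Suc (a j))" for a :: "'n \<Rightarrow> nat"
  define down where "down a = a(j := a j - 1)" for a :: "'n \<Rightarrow> nat"
  have down_up: "down (up a) = a" for a by (auto simp: up_def down_def)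
  have inj: "inj_on up A" for A by (rule inj_on_inverseI[of _ down]) (simp add: down_up)
  have sum_up: "sum (up a) UNIV = Suc (sum a UNIV)" for a
  proof -
    have "sum (up a) UNIV = Suc (a j) + sum a (UNIV - {j})"
      by (subst sum.remove[of _ j]) (auto simp: up_def intro!: sum.cong)
    also have "\<dots> = Suc (sum a UNIV)" by (subst sum.remove[of UNIV j a]) auto
    finally show ?thesis .
  qed
  show ?thesis unfolding poly_deg_le_def
  proof (intro exI[of _ "\<lambda>a. if a j > 0 then c (down a) else 0"] allI)
    fix x :: "real ^ 'n"
    have prod_up: "(\<Prod>i\<in>UNIV. (x $ i) ^ up a i) = x $ j * (\<Prod>i\<in>UNIV. (x $ i) ^ a i)" for a
    proof -
      have "(\<Prod>i\<in>UNIV. (x $ i) ^ up a i) = (x $ j) ^ Suc (a j) * (\<Prod>i\<in>UNIV - {j}. (x $ i) ^ a i)"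
        by (subst prod.remove[of _ j]) (auto simp: up_def intro!: prod.cong)
      also have "\<dots> = x $ j * (\<Prod>i\<in>UNIV. (x $ i) ^ a i)"
        by (subst prod.remove[of UNIV j "\<lambda>i. (x $ i) ^ a i"]) auto
      finally show ?thesis .
    qed
    have image: "up ` {a. sum a UNIV \<le> r} = {a. sum a UNIV \<le> Suc r \<and> a j > 0}"
    proof (intro set_eqI iffI)
      fix a assume a: "a \<in> {a. sum a UNIV \<le> Suc r \<and> a j > 0}"
      then have "a = up (down a)" by (auto simp: up_def down_def)
      moreover have "down a \<in> {a. sum a UNIV \<le> r}"
        using a sum_up[of "down a"] \<open>a = up (down a)\<close> by auto
      ultimately show "a \<in> up ` {a. sum a UNIV \<le> r}" by blast
    qed (auto simp: sum_up, simp add: up_def)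
    have "(\<Sum>a | sum a UNIV \<le> Suc r. (if a j > 0 then c (down a) else 0) * (\<Prod>i\<in>UNIV. (x $ i) ^ a i))
      = (\<Sum>a | sum a UNIV \<le> Suc r \<and> a j > 0. c (down a) * (\<Prod>i\<in>UNIV. (x $ i) ^ a i))"
      by (rule sum.mono_neutral_cong_right) (auto simp: finite_multi_indices)
    also have "\<dots> = (\<Sum>a | sum a UNIV \<le> r. c a * (\<Prod>i\<in>UNIV. (x $ i) ^ up a i))"
      unfolding image[symmetric] by (subst sum.reindex[OF inj]) (simp add: down_up)
    also have "\<dots> = x $ j * f x"
      by (simp add: c prod_up sum_distrib_left mult.left_commute)
    finally show "x $ j * f x = (\<Sum>a | sum a UNIV \<le> Suc r.
        (if a j > 0 then c (down a) else 0) * (\<Prod>i\<in>UNIV. (x $ i) ^ a i))" ..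
  qed
qed

lemma poly_deg_le_if_deg_le:
  fixes f :: "real ^ 'n::finite \<Rightarrow> real"
  assumes "deg_le r f"
  shows "poly_deg_le r f"
  using assms
proof (induction rule: deg_le.induct)
  case (mult l r f)
  have sum: "finite I \<Longrightarrow> (\<And>i. i \<in> I \<Longrightarrow> poly_deg_le s (g i)) \<Longrightarrow>
      poly_deg_le s (\<lambda>x. \<Sum>i\<in>I. g i x)"
    for s :: nat and I :: "'n set" and g :: "'n \<Rightarrow> real ^ 'n \<Rightarrow> real"
    by (induction I rule: finite_induct) (auto intro: poly_deg_le_const poly_deg_le_add)
  have l: "l x = (\<Sum>i\<in>UNIV. l (axis i 1) * (x $ i))" for x
  proof -
    have "l x = l (\<Sum>i\<in>UNIV. (x $ i) *\<^sub>R axis i 1)"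
      by (simp add: basis_expansion flip: scalar_mult_eq_scaleR)
    also have "\<dots> = (\<Sum>i\<in>UNIV. l (axis i 1) * (x $ i))"
      using mult.hyps by (simp add: linear_sum linear_scale mult.commute)
    finally show ?thesis .
  qed
  have "poly_deg_le (Suc r) (\<lambda>x. \<Sum>i\<in>UNIV. l (axis i 1) * (x $ i * f x))"
    by (intro sum poly_deg_le_cmult poly_deg_le_coord_mult mult.IH) simp
  then show ?case by (subst l) (simp add: sum_distrib_right mult.assoc)
qed (auto intro: poly_deg_le_const poly_deg_le_add)

definition affine_map :: "('a::real_vector \<Rightarrow> 'b::real_vector) \<Rightarrow> bool" where
  "affine_map f \<longleftrightarrow> linear (\<lambda>x. f x - f 0)"

lemma affine_map_linear: "linear f \<Longrightarrow> affine_map f"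
  by (simp add: affine_map_def linear_0)

lemma affine_map_linear_plus: "linear f \<Longrightarrow> affine_map (\<lambda>x. f x + c)"
  by (simp add: affine_map_def linear_0)

lemma affine_map_linear_comp: "affine_map f \<Longrightarrow> linear l \<Longrightarrow> affine_map (\<lambda>x. l (f x))"
  unfolding affine_map_def using linear_compose[of "\<lambda>x. f x - f 0" l]
  by (simp add: o_def linear_diff)

lemma affine_map_comp: "affine_map f \<Longrightarrow> affine_map g \<Longrightarrow> affine_map (\<lambda>x. g (f x))"
  unfolding affine_map_def using linear_compose[of "\<lambda>x. f x - f 0" "\<lambda>x. g x - g 0"]
proof -
  assume f: "linear (\<lambda>x. f x - f 0)" and g: "linear (\<lambda>x. g x - g 0)"
  have "g (f x) - g (f 0) = (g (f x - f 0) - g 0)" for x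
    using linear_diff[OF g, of "f x" "f 0"] by simp
  then show "linear (\<lambda>x. g (f x) - g (f 0))"
    using linear_compose[OF f g] by (simp add: o_def)
qed

lemma affine_map_add: "affine_map f \<Longrightarrow> affine_map g \<Longrightarrow> affine_map (\<lambda>x. f x + g x)"
  unfolding affine_map_def using linear_compose_add[of "\<lambda>x. f x - f 0" "\<lambda>x. g x - g 0"]
  by (simp add: algebra_simps)

lemma affine_map_diff: "affine_map f \<Longrightarrow> affine_map g \<Longrightarrow> affine_map (\<lambda>x. f x - g x)"
  unfolding affine_map_def using linear_compose_sub[of "\<lambda>x. f x - f 0" "\<lambda>x. g x - g 0"]
  by (simp add: algebra_simps)

lemma affine_map_id: "affine_map (\<lambda>x. x)"
  by (simp add: affine_map_def linear_ident)

lemma affine_map_const: "affine_map (\<lambda>x. c)"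
  by (simp add: affine_map_def linear_zero)

lemma affine_map_plus: "affine_map f \<Longrightarrow> f (x + v) = f x + (f v - f 0)"
  unfolding affine_map_def using linear_add[of "\<lambda>x. f x - f 0" x v] by (simp add: algebra_simps)

lemma deg_le_affine: "affine_map f \<Longrightarrow> deg_le r g \<Longrightarrow> deg_le (Suc r) (\<lambda>x. f x * g x)"
  using deg_le_affine_mult[of "\<lambda>x. f x - f 0" r g "f 0"] by (simp add: affine_map_def)

lemma deg_le_comp_affine:
  assumes "deg_le r f" "affine_map g"
  shows "deg_le r (\<lambda>x. f (g x))"
  using assms(1)
  by (induction rule: deg_le.induct)
    (auto intro: deg_le.intros deg_le_affine affine_map_linear_comp[OF assms(2)])

lemma deg_le_0_const: "deg_le 0 f \<Longrightarrow> \<exists>c. f = (\<lambda>x. c)"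
  by (induction "0::nat" f rule: deg_le.induct) auto

lemma deg_le_has_derivative:
  fixes f :: "'a::euclidean_space \<Rightarrow> real"
  assumes "deg_le r f"
  shows "\<exists>f'. (\<forall>x. (f has_derivative f' x) (at x)) \<and> (\<forall>u. deg_le (r - 1) (\<lambda>x. f' x u))"
  using assms
proof (induction rule: deg_le.induct)
  case (const r c)
  then show ?case by (intro exI[of _ "\<lambda>_ _. 0"]) (auto intro: deg_le.const)
next
  case (add r f g)
  then obtain f' g' where "\<forall>x. (f has_derivative f' x) (at x)" "\<forall>u. deg_le (r - 1) (\<lambda>x. f' x u)"
    "\<forall>x. (g has_derivative g' x) (at x)" "\<forall>u. deg_le (r - 1) (\<lambda>x. g' x u)" by blast
  then show ?case
    by (intro exI[of _ "\<lambda>x u. f' x u + g' x u"]) (auto intro: deg_le.add has_derivative_add)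
next
  case (mult l r f)
  then obtain f' where f': "\<forall>x. (f has_derivative f' x) (at x)" "\<forall>u. deg_le (r - 1) (\<lambda>x. f' x u)"
    by blast
  have l: "(l has_derivative l) (at x)" for x
    using mult.hyps(1) by (simp add: linear_imp_has_derivative)
  have "deg_le r (\<lambda>x. l x * f' x u)" for u
  proof (cases r)
    case 0
    then obtain c where "f = (\<lambda>x. c)" using mult.hyps(2) deg_le_0_const by blast
    then have "f' x = (\<lambda>_. 0)" for x
      using f'(1) has_derivative_unique[of f "f' x" x "\<lambda>_. 0"] by simp
    then show ?thesis by (auto intro: deg_le.const)
  next
    case (Suc s)
    then show ?thesis using deg_le.mult[OF mult.hyps(1), of s] f'(2) by simp
  qed
  then show ?case using f' l mult.hyps(2)
    by (intro exI[of _ "\<lambda>x u. l x * f' x u + l u * f x"])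
      (auto intro: deg_le.add deg_le_cmult has_derivative_mult)
qed

abbreviation dir_deriv :: "('a::real_normed_vector \<Rightarrow> real) \<Rightarrow> 'a \<Rightarrow> 'a \<Rightarrow> real" where
  "dir_deriv f x \<equiv> frechet_derivative f (at x)"

lemma deg_le_differentiable:
  fixes f :: "'a::euclidean_space \<Rightarrow> real"
  shows "deg_le r f \<Longrightarrow> f differentiable (at x)"
  using deg_le_has_derivative unfolding differentiable_def by blast

lemma deg_le_frechet:
  fixes f :: "'a::euclidean_space \<Rightarrow> real"
  shows "deg_le r f \<Longrightarrow> (f has_derivative dir_deriv f x) (at x)"
  using deg_le_differentiable frechet_derivative_works by blast

lemma deg_le_dir_deriv:
  fixes f :: "'a::euclidean_space \<Rightarrow> real"
  assumes "deg_le r f"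
  shows "deg_le (r - 1) (\<lambda>x. dir_deriv f x u)"
proof -
  obtain f' where f': "\<And>x. (f has_derivative f' x) (at x)" "\<And>u. deg_le (r - 1) (\<lambda>x. f' x u)"
    using deg_le_has_derivative[OF assms] by blast
  have "dir_deriv f x = f' x" for x using frechet_derivative_at[OF f'(1)] by simp
  then show ?thesis using f'(2) by simp
qed

lemma linear_dir_deriv:
  fixes f :: "'a::euclidean_space \<Rightarrow> real"
  shows "deg_le r f \<Longrightarrow> linear (dir_deriv f x)"
  using deg_le_frechet has_derivative_linear by blast

lemma deg_le_continuous:
  fixes f :: "'a::euclidean_space \<Rightarrow> real"
  shows "deg_le r f \<Longrightarrow> continuous_on A f"
  by (meson continuous_at_imp_continuous_on deg_le_frechet has_derivative_continuous)

lemma dir_deriv_eqI: "(f has_derivative f') (at x) \<Longrightarrow> dir_deriv f x u = f' u"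
  using frechet_derivative_at by metis

lemma dir_deriv_sum:
  fixes f :: "'i \<Rightarrow> 'a::euclidean_space \<Rightarrow> real"
  assumes "\<And>i. i \<in> I \<Longrightarrow> deg_le r (f i)"
  shows "dir_deriv (\<lambda>x. \<Sum>i\<in>I. c i * f i x) x u = (\<Sum>i\<in>I. c i * dir_deriv (f i) x u)"
  using assms by (intro dir_deriv_eqI) (auto intro!: derivative_eq_intros deg_le_frechet)

lemma dir_deriv_add:
  fixes f g :: "'a::euclidean_space \<Rightarrow> real"
  assumes "deg_le r f" "deg_le s g"
  shows "dir_deriv (\<lambda>x. f x + g x) x u = dir_deriv f x u + dir_deriv g x u"
  using assms by (intro dir_deriv_eqI) (auto intro!: derivative_eq_intros deg_le_frechet)

lemma dir_deriv_diff:
  fixes f g :: "'a::euclidean_space \<Rightarrow> real"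
  assumes "deg_le r f" "deg_le s g"
  shows "dir_deriv (\<lambda>x. f x - g x) x u = dir_deriv f x u - dir_deriv g x u"
  using assms by (intro dir_deriv_eqI) (auto intro!: derivative_eq_intros deg_le_frechet)

lemma dir_deriv_cmult:
  fixes f :: "'a::euclidean_space \<Rightarrow> real"
  assumes "deg_le r f"
  shows "dir_deriv (\<lambda>x. c * f x) x u = c * dir_deriv f x u"
  using assms by (intro dir_deriv_eqI) (auto intro!: derivative_eq_intros deg_le_frechet)

lemma dir_deriv_const: "dir_deriv (\<lambda>x. c) x u = 0"
  by (intro dir_deriv_eqI) auto

lemma dir_deriv_mult:
  fixes f g :: "'a::euclidean_space \<Rightarrow> real"
  assumes "deg_le r f" "deg_le s g"
  shows "dir_deriv (\<lambda>x. f x * g x) x u = f x * dir_deriv g x u + dir_deriv f x u * g x"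
  using assms by (intro dir_deriv_eqI) (auto intro!: derivative_eq_intros deg_le_frechet)

lemma affine_map_has_derivative:
  fixes g :: "'a::euclidean_space \<Rightarrow> 'b::real_normed_vector"
  assumes "affine_map g"
  shows "(g has_derivative (\<lambda>v. g v - g 0)) (at x)"
proof -
  have "((\<lambda>x. g x - g 0) has_derivative (\<lambda>v. g v - g 0)) (at x)"
    using assms unfolding affine_map_def
    by (simp add: linear_conv_bounded_linear bounded_linear_imp_has_derivative)
  from has_derivative_add[OF this has_derivative_const[of "g 0"]] show ?thesis by simp
qed

lemma dir_deriv_comp_affine:
  fixes f :: "'b::euclidean_space \<Rightarrow> real" and g :: "'a::euclidean_space \<Rightarrow> 'b"
  assumes "deg_le r f" "affine_map g"
  shows "dir_deriv (\<lambda>x. f (g x)) x u = dir_deriv f (g x) (g u - g 0)"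
  using has_derivative_compose[OF affine_map_has_derivative[OF assms(2)] deg_le_frechet[OF assms(1)]]
  by (intro dir_deriv_eqI)

lemma dir_deriv_linear:
  fixes l :: "'a::euclidean_space \<Rightarrow> real"
  shows "linear l \<Longrightarrow> dir_deriv l x u = l u"
  by (rule dir_deriv_eqI) (simp add: linear_imp_has_derivative)

text \<open>For a product \<open>l f\<close> both sides are \<open>l\<close> times a second derivative of \<open>f\<close> plus two terms that are
  interchanged with \<open>u\<close> and \<open>w\<close>.\<close>

lemma dir_deriv_commute:
  fixes f :: "'a::euclidean_space \<Rightarrow> real"
  assumes "deg_le r f"
  shows "dir_deriv (\<lambda>y. dir_deriv f y u) x w = dir_deriv (\<lambda>y. dir_deriv f y w) x u"
  using assms
proof (induction arbitrary: x rule: deg_le.induct)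
  case (const r c)
  then show ?case by (simp add: dir_deriv_const)
next
  case (add r f g)
  note d = deg_le_dir_deriv[OF add.hyps(1)] deg_le_dir_deriv[OF add.hyps(2)]
  show ?case by (simp add: dir_deriv_add[OF add.hyps] dir_deriv_add[OF d] add.IH)
next
  case (mult l r f)
  note l = deg_le_linear[OF mult.hyps(1)]
  note d = deg_le_dir_deriv[OF mult.hyps(2)]
  have *: "dir_deriv (\<lambda>y. l y * f y) y u = l y * dir_deriv f y u + l u * f y" for y u
    by (simp add: dir_deriv_mult[OF l mult.hyps(2)] dir_deriv_linear mult.hyps)
  have "dir_deriv (\<lambda>y. dir_deriv (\<lambda>y. l y * f y) y u) x w =
      (l x * dir_deriv (\<lambda>y. dir_deriv f y u) x w + l w * dir_deriv f x u) + l u * dir_deriv f x w" for u w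
    unfolding *
    by (subst dir_deriv_add[OF deg_le_mult[OF l d] deg_le_cmult[OF mult.hyps(2)]])
      (simp add: dir_deriv_mult[OF l d] dir_deriv_cmult[OF mult.hyps(2)] dir_deriv_linear mult.hyps)
  then show ?case by (simp add: mult.IH)
qed

lemma deg_le_bounded_lipschitz:
  fixes f :: "'a::euclidean_space \<Rightarrow> real"
  assumes "deg_le r f"
  shows "\<exists>M L. \<forall>x\<in>cball 0 B. \<forall>y\<in>cball 0 B. \<bar>f x\<bar> \<le> M \<and> \<bar>f x - f y\<bar> \<le> L * norm (x - y)"
  using assms
proof (induction rule: deg_le.induct)
  case (const r c)
  show ?case by (rule exI[of _ "\<bar>c\<bar>"], rule exI[of _ 0]) auto
next
  case (add r f g)
  then obtain M L M' L' where
    f: "\<And>x y. x \<in> cball 0 B \<Longrightarrow> y \<in> cball 0 B \<Longrightarrow> \<bar>f x\<bar> \<le> M \<and> \<bar>f x - f y\<bar> \<le> L * norm (x - y)" and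
    g: "\<And>x y. x \<in> cball 0 B \<Longrightarrow> y \<in> cball 0 B \<Longrightarrow> \<bar>g x\<bar> \<le> M' \<and> \<bar>g x - g y\<bar> \<le> L' * norm (x - y)"
    by blast
  show ?case
  proof (rule exI[of _ "M + M'"], rule exI[of _ "L + L'"], intro ballI)
    fix x y :: 'a assume xy: "x \<in> cball 0 B" "y \<in> cball 0 B"
    show "\<bar>f x + g x\<bar> \<le> M + M' \<and> \<bar>f x + g x - (f y + g y)\<bar> \<le> (L + L') * norm (x - y)"
      unfolding distrib_right using f[OF xy] g[OF xy] by linarith
  qed
next
  case (mult l r f)
  then obtain M L where
    f: "\<And>x y. x \<in> cball 0 B \<Longrightarrow> y \<in> cball 0 B \<Longrightarrow> \<bar>f x\<bar> \<le> M \<and> \<bar>f x - f y\<bar> \<le> L * norm (x - y)" by blast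
  obtain K where K: "K > 0" "\<And>x. \<bar>l x\<bar> \<le> K * norm x"
    using linear_bounded_pos[OF mult.hyps(1)] by auto
  show ?case
  proof (rule exI[of _ "K * B * M"], rule exI[of _ "K * M + K * B * L"], intro ballI conjI)
    fix x y :: 'a assume xy: "x \<in> cball 0 B" "y \<in> cball 0 B"
    have lx: "\<bar>l x\<bar> \<le> K * B" using K(2)[of x] xy(1) K(1)
      by (smt (verit) mem_cball_0 mult_left_mono)
    show "\<bar>l x * f x\<bar> \<le> K * B * M"
      unfolding abs_mult using f[OF xy] lx by (intro mult_mono) auto
    have "\<bar>l x * f x - l y * f y\<bar> = \<bar>l x * (f x - f y) + l (x - y) * f y\<bar>"
      using mult.hyps(1) by (simp add: linear_diff algebra_simps)
    also have "\<dots> \<le> \<bar>l x\<bar> * \<bar>f x - f y\<bar> + \<bar>l (x - y)\<bar> * \<bar>f y\<bar>"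
      by (metis abs_mult abs_triangle_ineq)
    also have "\<dots> \<le> (K * B) * (L * norm (x - y)) + (K * norm (x - y)) * M"
      using f[OF xy] f[OF xy(2,1)] lx K(2)[of "x - y"] by (intro add_mono mult_mono) auto
    finally show "\<bar>l x * f x - l y * f y\<bar> \<le> (K * M + K * B * L) * norm (x - y)"
      by (simp add: algebra_simps)
  qed
qed

lemma deg_le_real_poly:
  fixes f :: "real \<Rightarrow> real"
  assumes "deg_le r f"
  shows "\<exists>p. \<forall>t. f t = poly p t"
  using assms
proof (induction rule: deg_le.induct)
  case (const r c)
  show ?case by (intro exI[of _ "[:c:]"]) simp
next
  case (add r f g)
  then show ?case by (metis poly_add)
next
  case (mult l r f)
  then obtain p where p: "\<And>t. f t = poly p t" by blast
  show ?case
  proof (intro exI[of _ "[:0, l 1:] * p"] allI)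
    fix t
    have "l t = t * l 1" using linear_scale[OF mult.hyps(1), of t 1] by simp
    then show "l t * f t = poly ([:0, l 1:] * p) t" by (simp only: p) simp
  qed
qed

text \<open>This carries identities from an open piece of an affine subspace to all of it, along the lines
  through one of its points.\<close>

lemma deg_le_zero_on_line:
  fixes f :: "'a::real_vector \<Rightarrow> real"
  assumes f: "deg_le r f" and e: "e > 0"
    and zero: "\<And>t. 0 < t \<Longrightarrow> t < e \<Longrightarrow> f (c + t *\<^sub>R w) = 0"
  shows "f (c + t *\<^sub>R w) = 0"
proof -
  have "affine_map (\<lambda>t. c + t *\<^sub>R w)"
    using affine_map_linear_plus[OF linear_scaleR_left, of w c] by (simp add: add.commute)
  from deg_le_comp_affine[OF f this] obtain p where p: "\<And>t. f (c + t *\<^sub>R w) = poly p t"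
    using deg_le_real_poly by blast
  have "{0<..<e} \<subseteq> {t. poly p t = 0}" using zero by (auto simp flip: p)
  then have "infinite {t. poly p t = 0}" using infinite_Ioo[OF e] infinite_super by blast
  then have "p = 0" using poly_roots_finite by blast
  then show ?thesis by (simp add: p)
qed

text \<open>By induction on \<open>f\<close>.  Let \<open>y = x - g x *\<^sub>R u\<close>, the projection of \<open>x\<close> to the zero set of \<open>g\<close> in the case
  that is used.  A product is treated with \<open>l x f x - l y f y = l x (f x - f y) + (l x - l y) f y\<close>, where
  \<open>l x - l y\<close> is a multiple of \<open>g x\<close>.\<close>

lemma deg_le_affine_remainder:
  assumes "deg_le (Suc r) f" and g: "affine_map g"
  shows "\<exists>q. deg_le r q \<and> (\<forall>x. f x = f (x - g x *\<^sub>R u) + g x * q x)"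
proof -
  have gu: "affine_map (\<lambda>x. x - g x *\<^sub>R u)"
    by (intro affine_map_diff affine_map_id affine_map_linear_comp[OF g, of "\<lambda>t. t *\<^sub>R u"]
        linear_scaleR_left)
  have "\<exists>q. deg_le (s - 1) q \<and> (\<forall>x. f x = f (x - g x *\<^sub>R u) + g x * q x) \<and> (s = 0 \<longrightarrow> q = (\<lambda>_. 0))"
    if "deg_le s f" for s using that
  proof (induction rule: deg_le.induct)
    case (const r c)
    show ?case by (intro exI[of _ "\<lambda>x. 0"]) (simp add: deg_le.const)
  next
    case (add r f h)
    then obtain q q' where q: "deg_le (r - 1) q" "\<And>x. f x = f (x - g x *\<^sub>R u) + g x * q x"
      "r = 0 \<longrightarrow> q = (\<lambda>_. 0)" and q': "deg_le (r - 1) q'"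
      "\<And>x. h x = h (x - g x *\<^sub>R u) + g x * q' x" "r = 0 \<longrightarrow> q' = (\<lambda>_. 0)" by blast
    show ?case
    proof (rule exI, intro conjI allI)
      show "deg_le (r - 1) (\<lambda>x. q x + q' x)" using q(1) q'(1) by (rule deg_le.add)
      show "f x + h x = f (x - g x *\<^sub>R u) + h (x - g x *\<^sub>R u) + g x * (q x + q' x)" for x
        using q(2)[of x] q'(2)[of x] by (simp add: distrib_left)
      show "r = 0 \<longrightarrow> (\<lambda>x. q x + q' x) = (\<lambda>_. 0)" using q(3) q'(3) by auto
    qed
  next
    case (mult l r f)
    then obtain q where q: "deg_le (r - 1) q" "\<And>x. f x = f (x - g x *\<^sub>R u) + g x * q x"
      "r = 0 \<longrightarrow> q = (\<lambda>_. 0)" by blast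
    have lq: "deg_le r (\<lambda>x. l x * q x)"
      using deg_le.mult[OF mult.hyps(1) q(1)] q(3) by (cases r) (auto intro: deg_le.const)
    have lf: "deg_le r (\<lambda>x. l u * f (x - g x *\<^sub>R u))"
      by (intro deg_le_cmult deg_le_comp_affine[OF mult.hyps(2)] gu)
    show ?case
    proof (rule exI, intro conjI allI)
      show "deg_le (Suc r - 1) (\<lambda>x. l x * q x + l u * f (x - g x *\<^sub>R u))"
        using deg_le.add[OF lq lf] by simp
      fix x
      have "l (x - g x *\<^sub>R u) = l x - g x * l u"
        using mult.hyps(1) by (simp add: linear_diff linear_scale)
      then show "l x * f x = l (x - g x *\<^sub>R u) * f (x - g x *\<^sub>R u) +
          g x * (l x * q x + l u * f (x - g x *\<^sub>R u))" using q(2)[of x] by algebra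
    qed simp
  qed
  from this[OF assms(1)] show ?thesis by (metis diff_Suc_1)
qed

lemma deg_le_divide_affine:
  assumes "deg_le (Suc r) f" and g: "affine_map g" and u: "g u - g 0 = 1"
    and zero: "\<And>x. g x = 0 \<Longrightarrow> f x = 0"
  shows "\<exists>q. deg_le r q \<and> (\<forall>x. f x = g x * q x)"
proof -
  have lin: "linear (\<lambda>x. g x - g 0)" using g by (simp add: affine_map_def)
  have "g (x - g x *\<^sub>R u) = 0" for x
    using linear_diff[OF lin, of x "g x *\<^sub>R u"] linear_scale[OF lin, of "g x" u] u by simp
  moreover obtain q where "deg_le r q" "\<And>x. f x = f (x - g x *\<^sub>R u) + g x * q x"
    using deg_le_affine_remainder[OF assms(1) g, of u] by blast
  ultimately show ?thesis using zero by (metis add_0)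
qed

section \<open>Alternating forms\<close>

lemma alternating_cong:
  "alternating k \<alpha> \<Longrightarrow> (\<And>i. i < k \<Longrightarrow> v i = w i) \<Longrightarrow> \<alpha> v = \<alpha> w"
  unfolding alternating_def by blast

lemma alternating_linear: "alternating k \<alpha> \<Longrightarrow> i < k \<Longrightarrow> linear (\<lambda>y. \<alpha> (v(i := y)))"
  unfolding alternating_def by blast

lemma alternating_eq_0:
  "alternating k \<alpha> \<Longrightarrow> i < k \<Longrightarrow> j < k \<Longrightarrow> i \<noteq> j \<Longrightarrow> v i = v j \<Longrightarrow> \<alpha> v = 0"
  unfolding alternating_def by blast

lemma alternatingI:
  assumes "\<And>v w. (\<And>i. i < k \<Longrightarrow> v i = w i) \<Longrightarrow> \<alpha> v = \<alpha> w"
    and "\<And>v i. i < k \<Longrightarrow> linear (\<lambda>y. \<alpha> (v(i := y)))"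
    and "\<And>v i j. i < j \<Longrightarrow> j < k \<Longrightarrow> v i = v j \<Longrightarrow> \<alpha> v = 0"
  shows "alternating k \<alpha>"
  unfolding alternating_def using assms by (metis nat_neq_iff)

lemma alternating_upd_add:
  "alternating k \<alpha> \<Longrightarrow> i < k \<Longrightarrow> \<alpha> (v(i := x + y)) = \<alpha> (v(i := x)) + \<alpha> (v(i := y))"
  by (rule linear_add[OF alternating_linear])

lemma alternating_upd_diff:
  "alternating k \<alpha> \<Longrightarrow> i < k \<Longrightarrow> \<alpha> (v(i := x - y)) = \<alpha> (v(i := x)) - \<alpha> (v(i := y))"
  by (rule linear_diff[OF alternating_linear])

lemma alternating_upd_scaleR:
  "alternating k \<alpha> \<Longrightarrow> i < k \<Longrightarrow> \<alpha> (v(i := c *\<^sub>R x)) = c * \<alpha> (v(i := x))"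
  using linear_scale[OF alternating_linear, of k \<alpha> i v c x] by simp

lemma alternating_upd_sum:
  "alternating k \<alpha> \<Longrightarrow> i < k \<Longrightarrow>
    \<alpha> (v(i := \<Sum>b\<in>B. c b *\<^sub>R b)) = (\<Sum>b\<in>B. c b * \<alpha> (v(i := b)))"
  using linear_sum[OF alternating_linear, of k \<alpha> i v "\<lambda>b. c b *\<^sub>R b" B]
  by (simp add: alternating_upd_scaleR)

lemma alternating_swap:
  assumes \<alpha>: "alternating k \<alpha>" and ij: "i < k" "j < k" "i \<noteq> j"
  shows "\<alpha> (v(i := x, j := y)) = - \<alpha> (v(i := y, j := x))"
proof -
  have *: "\<alpha> (v(i := a, j := a)) = 0" for a
    using alternating_eq_0[OF \<alpha> ij] ij(3) by simp
  have tw: "v(i := a, j := b) = v(j := b, i := a)" for a b using ij(3) by (simp add: fun_upd_twist)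
  have "0 = \<alpha> (v(i := x + y, j := x + y))" by (simp add: *)
  also have "\<dots> = \<alpha> (v(i := x + y, j := x)) + \<alpha> (v(i := x + y, j := y))"
    using alternating_upd_add[OF \<alpha> ij(2)] .
  also have "\<dots> = \<alpha> (v(i := x, j := x)) + \<alpha> (v(i := y, j := x)) +
      (\<alpha> (v(i := x, j := y)) + \<alpha> (v(i := y, j := y)))"
    unfolding tw alternating_upd_add[OF \<alpha> ij(1)] ..
  finally show ?thesis by (simp add: *)
qed

definition vcons :: "'a \<Rightarrow> (nat \<Rightarrow> 'a) \<Rightarrow> nat \<Rightarrow> 'a" where
  "vcons u v = (\<lambda>i. case i of 0 \<Rightarrow> u | Suc j \<Rightarrow> v j)"

lemma vcons_simps [simp]: "vcons u v 0 = u" "vcons u v (Suc i) = v i"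
  by (simp_all add: vcons_def)

lemma vcons_eq: "vcons u v = (\<lambda>i. if i = 0 then u else v (i - 1))"
  by (auto simp: vcons_def split: nat.split)

lemma omit_vcons: "omit 0 (vcons u v) = v" "omit (Suc i) (vcons u v) = vcons u (omit i v)"
  by (auto simp: omit_def vcons_def split: nat.split)

lemma vcons_upd_0: "(vcons u v)(0 := w) = vcons w v"
  by (auto simp: vcons_def split: nat.split)

lemma vcons_upd_Suc: "(vcons u v)(Suc i := w) = vcons u (v(i := w))"
  by (auto simp: vcons_def split: nat.split)

lemma omit_comp: "omit i (\<lambda>j. f (v j)) = (\<lambda>j. f (omit i v j))"
  by (auto simp: omit_def)

lemma omit_upd_same: "omit i (v(i := y)) = omit i v"
  by (auto simp: omit_def)

lemma omit_upd:
  assumes "i \<noteq> j"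
  shows "omit i (v(j := y)) = (omit i v)(if j < i then j else j - 1 := y)"
  by (rule ext) (use assms in \<open>auto simp: omit_def\<close>)

lemma omit_omit: "j < i \<Longrightarrow> omit (i - 1) (omit j v) = omit j (omit i v)"
  by (rule ext) (auto simp: omit_def)

text \<open>Moving the gap by one place is a transposition.\<close>

lemma alternating_move_first:
  assumes "alternating k \<alpha>" "i < k"
  shows "\<alpha> (vcons u (omit i v)) = (-1) ^ i * \<alpha> (v(i := u))"
  using assms(2)
proof (induction i arbitrary: v)
  case 0
  have "vcons u (omit 0 v) = v(0 := u)" by (auto simp: vcons_def omit_def split: nat.split)
  then show ?case by simp
next
  case (Suc i)
  have "vcons u (omit (Suc i) v) = vcons u (omit i (v(Suc i := v i)))"
    by (rule arg_cong[of _ _ "vcons u"]) (auto simp: omit_def less_Suc_eq)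
  then have "\<alpha> (vcons u (omit (Suc i) v)) = (-1) ^ i * \<alpha> (v(Suc i := v i, i := u))"
    using Suc.IH[OF Suc_lessD[OF Suc.prems], of "v(Suc i := v i)"] by (simp only:)
  also have "v(Suc i := v i, i := u) = v(i := u, Suc i := v i)" by (simp add: fun_upd_twist)
  also have "\<alpha> (v(i := u, Suc i := v i)) = - \<alpha> (v(i := v i, Suc i := u))"
    by (rule alternating_swap[OF assms(1)]) (use Suc.prems in auto)
  finally show ?case by (simp only: fun_upd_triv power_Suc mult_minus1 mult_minus_left mult_minus_right)
qed

lemma linear_compose_fun: "linear f \<Longrightarrow> linear g \<Longrightarrow> linear (\<lambda>x. g (f x))"
  using linear_compose[of f g] by (simp add: o_def)

lemma linear_cmult_real:
  fixes f :: "'a::real_vector \<Rightarrow> real"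
  shows "linear f \<Longrightarrow> linear (\<lambda>x. c * f x)"
  using linear_compose_scale_right[of f c] by simp

text \<open>The form of the exterior derivative (\<open>B\<close> a directional derivative) and of the product with a
  one-form.  If two entries of \<open>v\<close> agree, only the two terms that omit one of them survive, and moving the
  remaining one of the equal entries to the front shows that these two cancel.\<close>

lemma alternating_alternating_sum:
  fixes B :: "'a::real_vector \<Rightarrow> (nat \<Rightarrow> 'a) \<Rightarrow> real"
  assumes alt: "\<And>u. alternating k (B u)" and lin: "\<And>v. linear (\<lambda>u. B u v)"
  shows "alternating (Suc k) (\<lambda>v. \<Sum>i\<le>k. (-1) ^ i * B (v i) (omit i v))"
proof (rule alternatingI)
  fix v w :: "nat \<Rightarrow> 'a" assume "\<And>i. i < Suc k \<Longrightarrow> v i = w i"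
  then have "B (v i) (omit i v) = B (w i) (omit i w)" if "i \<le> k" for i
    using that alternating_cong[OF alt, of "omit i v" "omit i w"] by (auto simp: omit_def)
  then show "(\<Sum>i\<le>k. (-1) ^ i * B (v i) (omit i v)) = (\<Sum>i\<le>k. (-1) ^ i * B (w i) (omit i w))"
    by simp
next
  fix v :: "nat \<Rightarrow> 'a" and j assume j: "j < Suc k"
  have "linear (\<lambda>y. B ((v(j := y)) i) (omit i (v(j := y))))" if i: "i \<le> k" for i
  proof (cases "i = j")
    case True then show ?thesis by (simp add: omit_upd_same lin)
  next
    case False
    then have "(if j < i then j else j - 1) < k" using i j by auto
    from alternating_linear[OF alt this] show ?thesis using False by (simp add: omit_upd)
  qed
  then show "linear (\<lambda>y. \<Sum>i\<le>k. (-1) ^ i * B ((v(j := y)) i) (omit i (v(j := y))))"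
    by (intro linear_compose_sum ballI linear_cmult_real) (simp only: atMost_iff)
next
  fix v :: "nat \<Rightarrow> 'a" and p q assume pq: "p < q" "q < Suc k" "v p = v q"
  have "B (v i) (omit i v) = 0" if "i \<le> k" "i \<noteq> p" "i \<noteq> q" for i
    by (rule alternating_eq_0[OF alt, of "if p < i then p else p - 1" "if q < i then q else q - 1"])
      (use that pq in \<open>auto simp: omit_def\<close>)
  then have "(\<Sum>i\<le>k. (-1) ^ i * B (v i) (omit i v)) = (\<Sum>i\<in>{p, q}. (-1) ^ i * B (v i) (omit i v))"
    using pq by (intro sum.mono_neutral_right) auto
  also have "\<dots> = (-1) ^ p * B (v p) (omit p v) + (-1) ^ q * B (v q) (omit q v)"
    using pq by simp
  also have "\<dots> = 0"
  proof -
    let ?u = "v p"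
    have "(omit p v)(q - 1 := ?u) = omit p v" "(omit q v)(p := ?u) = omit q v"
      by (rule ext, use pq in \<open>auto simp: omit_def\<close>)+
    then have "B ?u (vcons ?u (omit (q - 1) (omit p v))) = (-1) ^ (q - 1) * B ?u (omit p v)"
      "B ?u (vcons ?u (omit p (omit q v))) = (-1) ^ p * B ?u (omit q v)"
      using alternating_move_first[OF alt, of "q - 1" ?u ?u "omit p v"]
        alternating_move_first[OF alt, of p ?u ?u "omit q v"] pq by (simp_all del: fun_upd_apply)
    then have "(-1) ^ (q - 1) * B ?u (omit p v) = (-1) ^ p * B ?u (omit q v)"
      by (simp only: omit_omit[OF pq(1)])
    moreover obtain q' where "q = Suc q'" using pq(1) by (cases q) auto
    ultimately show ?thesis using pq(3) by (cases "even q'"; cases "even p") auto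
  qed
  finally show "(\<Sum>i\<le>k. (-1) ^ i * B (v i) (omit i v)) = 0" .
qed

lemma alternating_zero: "alternating k (\<lambda>v. 0)"
  by (simp add: alternating_def linear_zero)

lemma alternating_add:
  assumes "alternating k \<alpha>" "alternating k \<beta>"
  shows "alternating k (\<lambda>v. \<alpha> v + \<beta> v)"
proof (rule alternatingI)
  show "\<alpha> v + \<beta> v = \<alpha> w + \<beta> w" if "\<And>i. i < k \<Longrightarrow> v i = w i" for v w
    using alternating_cong[OF assms(1) that] alternating_cong[OF assms(2) that] by simp
  show "linear (\<lambda>y. \<alpha> (v(i := y)) + \<beta> (v(i := y)))" if "i < k" for v i
    using assms that by (intro linear_compose_add alternating_linear)
  show "\<alpha> v + \<beta> v = 0" if "i < j" "j < k" "v i = v j" for v i j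
    using alternating_eq_0[OF assms(1), of i j v] alternating_eq_0[OF assms(2), of i j v] that by simp
qed

lemma alternating_cmult:
  assumes "alternating k \<alpha>"
  shows "alternating k (\<lambda>v. c * \<alpha> v)"
proof (rule alternatingI)
  show "c * \<alpha> v = c * \<alpha> w" if "\<And>i. i < k \<Longrightarrow> v i = w i" for v w
    using alternating_cong[OF assms that] by simp
  show "linear (\<lambda>y. c * \<alpha> (v(i := y)))" if "i < k" for v i
    using assms that by (intro linear_cmult_real alternating_linear)
  show "c * \<alpha> v = 0" if "i < j" "j < k" "v i = v j" for v i j
    using alternating_eq_0[OF assms, of i j v] that by simp
qed

lemma alternating_diff:
  "alternating k \<alpha> \<Longrightarrow> alternating k \<beta> \<Longrightarrow> alternating k (\<lambda>v. \<alpha> v - \<beta> v)"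
  using alternating_add[of k \<alpha> "\<lambda>v. (-1) * \<beta> v"] alternating_cmult[of k \<beta> "-1"] by simp

lemma alternating_contract:
  assumes "alternating (Suc k) \<alpha>"
  shows "alternating k (\<lambda>v. \<alpha> (vcons u v))"
proof (rule alternatingI)
  show "\<alpha> (vcons u v) = \<alpha> (vcons u w)" if "\<And>i. i < k \<Longrightarrow> v i = w i" for v w
    by (rule alternating_cong[OF assms]) (use that in \<open>auto simp: vcons_def split: nat.split\<close>)
  show "linear (\<lambda>y. \<alpha> (vcons u (v(i := y))))" if "i < k" for v i
    using alternating_linear[OF assms, of "Suc i" "vcons u v"] that by (simp add: vcons_upd_Suc)
  show "\<alpha> (vcons u v) = 0" if "i < j" "j < k" "v i = v j" for v i j
    by (rule alternating_eq_0[OF assms, of "Suc i" "Suc j"]) (use that in auto)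
qed

lemma alternating_comp_linear:
  assumes "alternating k \<alpha>" "linear L"
  shows "alternating k (\<lambda>v. \<alpha> (\<lambda>i. L (v i)))"
proof (rule alternatingI)
  show "\<alpha> (\<lambda>i. L (v i)) = \<alpha> (\<lambda>i. L (w i))" if "\<And>i. i < k \<Longrightarrow> v i = w i" for v w
    by (rule alternating_cong[OF assms(1)]) (use that in auto)
  show "linear (\<lambda>y. \<alpha> (\<lambda>j. L ((v(i := y)) j)))" if "i < k" for v i
  proof -
    have "(\<lambda>j. L ((v(i := y)) j)) = (\<lambda>j. L (v j))(i := L y)" for y by auto
    then show ?thesis
      using linear_compose_fun[OF assms(2) alternating_linear[OF assms(1) that, of "\<lambda>j. L (v j)"]]
      by simp
  qed
  show "\<alpha> (\<lambda>i. L (v i)) = 0" if "i < j" "j < k" "v i = v j" for v i j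
    by (rule alternating_eq_0[OF assms(1), of i j]) (use that in auto)
qed

lemma alternating_span_zero:
  assumes \<alpha>: "alternating k \<alpha>"
    and zero: "\<And>w. (\<And>i. i < k \<Longrightarrow> w i \<in> B) \<Longrightarrow> \<alpha> w = 0"
    and v: "\<And>i. i < k \<Longrightarrow> v i \<in> span B"
  shows "\<alpha> v = 0"
proof -
  have "\<alpha> v = 0" if "N \<le> k" "\<And>i. i < N \<Longrightarrow> v i \<in> span B" "\<And>i. N \<le> i \<Longrightarrow> i < k \<Longrightarrow> v i \<in> B" for N v
    using that
  proof (induction N arbitrary: v)
    case 0
    then show ?case using zero by simp
  next
    case (Suc N)
    have "\<alpha> (v(N := b)) = 0" if "b \<in> B" for b
      using that Suc.prems by (intro Suc.IH) (auto simp: less_Suc_eq)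
    then have "\<alpha> (v(N := b)) = 0" if "b \<in> span B" for b
      using linear_eq_0_on_span[OF alternating_linear[OF \<alpha>, of N v] _ that] Suc.prems(1) by simp
    from this[of "v N"] show ?case using Suc.prems(2) by simp
  qed
  from this[of k] show ?thesis using v by simp
qed

text \<open>The hyperplane and \<open>u\<close> span the space, and a tuple that contains \<open>u\<close> twice does not count.\<close>

lemma alternating_zero_if_hyperplane:
  fixes \<alpha> :: "(nat \<Rightarrow> 'a::real_vector) \<Rightarrow> real"
  assumes \<alpha>: "alternating (Suc k) \<alpha>" and l: "linear l" "l u = 1"
    and tang: "\<And>v. (\<And>i. i < Suc k \<Longrightarrow> l (v i) = 0) \<Longrightarrow> \<alpha> v = 0"
    and contr: "\<And>v. (\<And>i. i < k \<Longrightarrow> l (v i) = (0::real)) \<Longrightarrow> \<alpha> (vcons u v) = 0"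
  shows "\<alpha> v = 0"
proof (rule alternating_span_zero[OF \<alpha>, of "insert u {v. l v = 0}"])
  fix w assume w: "\<And>i. i < Suc k \<Longrightarrow> w i \<in> insert u {v. l v = 0}"
  show "\<alpha> w = 0"
  proof (cases "\<exists>i<Suc k. w i = u")
    case False
    then show ?thesis using w tang by blast
  next
    case True
    then obtain i where i: "i < Suc k" "w i = u" by blast
    show ?thesis
    proof (cases "\<exists>j<Suc k. j \<noteq> i \<and> w j = u")
      case True
      then show ?thesis using alternating_eq_0[OF \<alpha>] i by metis
    next
      case False
      then have "l (w j) = 0" if "j < Suc k" "j \<noteq> i" for j using w[OF that(1)] that by blast
      then have "\<alpha> (vcons u (omit i w)) = 0"
        using i by (intro contr) (auto simp: omit_def)
      moreover have "w(i := u) = w" using i(2) by auto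
      ultimately show ?thesis using alternating_move_first[OF \<alpha> i(1), of u w]
        by (simp del: fun_upd_apply)
    qed
  qed
next
  fix i
  have "v i = (v i - l (v i) *\<^sub>R u) + l (v i) *\<^sub>R u" by simp
  moreover have "v i - l (v i) *\<^sub>R u \<in> {v. l v = 0}" using l by (simp add: linear_diff linear_scale)
  ultimately show "v i \<in> span (insert u {v. l v = 0})"
    by (metis insertCI insertI1 span_add span_base span_scale)
qed

text \<open>By the pigeonhole principle, \<open>k\<close> elements of the spanning set are not distinct.\<close>

lemma alternating_zero_if_small_span:
  assumes \<alpha>: "alternating k \<alpha>" and B: "finite B" "card B < k"
    and v: "\<And>i. i < k \<Longrightarrow> v i \<in> span B"
  shows "\<alpha> v = 0"
proof (rule alternating_span_zero[OF \<alpha> _ v])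
  fix w assume w: "\<And>i. i < k \<Longrightarrow> w i \<in> B"
  have "\<not> inj_on w {..<k}"
    using card_inj_on_le[of w "{..<k}" B] w B by auto
  then show "\<alpha> w = 0" using alternating_eq_0[OF \<alpha>] unfolding inj_on_def by blast
qed


section \<open>Polynomial differential forms\<close>

type_synonym 'a dform = "'a \<Rightarrow> (nat \<Rightarrow> 'a) \<Rightarrow> real"

definition form_deg_le :: "nat \<Rightarrow> nat \<Rightarrow> 'a::real_vector dform \<Rightarrow> bool" where
  "form_deg_le r k a \<longleftrightarrow> (\<forall>x. alternating k (a x)) \<and> (\<forall>v. deg_le r (\<lambda>x. a x v))"

lemma form_deg_leD:
  "form_deg_le r k a \<Longrightarrow> alternating k (a x)"
  "form_deg_le r k a \<Longrightarrow> deg_le r (\<lambda>x. a x v)"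
  by (simp_all add: form_deg_le_def)

lemma form_deg_le_mono: "form_deg_le r k a \<Longrightarrow> r \<le> s \<Longrightarrow> form_deg_le s k a"
  unfolding form_deg_le_def using deg_le_mono by blast

lemma form_deg_le_zero: "form_deg_le r k (\<lambda>x v. 0)"
  by (simp add: form_deg_le_def alternating_zero deg_le.const)

lemma form_deg_le_add:
  "form_deg_le r k a \<Longrightarrow> form_deg_le r k b \<Longrightarrow> form_deg_le r k (\<lambda>x v. a x v + b x v)"
  by (simp add: form_deg_le_def alternating_add deg_le.add)

lemma form_deg_le_diff:
  "form_deg_le r k a \<Longrightarrow> form_deg_le r k b \<Longrightarrow> form_deg_le r k (\<lambda>x v. a x v - b x v)"
  by (simp add: form_deg_le_def alternating_diff deg_le_diff)

lemma form_deg_le_cmult: "form_deg_le r k a \<Longrightarrow> form_deg_le r k (\<lambda>x v. c * a x v)"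
  by (simp add: form_deg_le_def alternating_cmult deg_le_cmult)

lemma form_deg_le_contract:
  "form_deg_le r (Suc k) a \<Longrightarrow> form_deg_le r k (\<lambda>x v. a x (vcons u v))"
  by (simp add: form_deg_le_def alternating_contract)

text \<open>Here all values of the form are polynomials, not only its coefficients; the arguments are expanded
  in the basis one at a time.\<close>

lemma poly_forms_iff_form_deg_le: "p \<in> poly_forms r k \<longleftrightarrow> form_deg_le r k p"
proof
  assume "form_deg_le r k p"
  then show "p \<in> poly_forms r k"
    by (auto simp: poly_forms_def form_deg_le_def intro: poly_deg_le_if_deg_le)
next
  assume p: "p \<in> poly_forms r k"
  then have alt: "alternating k (p x)" for x by (simp add: poly_forms_def)
  have "deg_le r (\<lambda>x. p x v)" if "N \<le> k" "\<And>i. N \<le> i \<Longrightarrow> i < k \<Longrightarrow> v i \<in> Basis" for N v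
    using that
  proof (induction N arbitrary: v)
    case 0
    then have "v \<in> {..<k} \<rightarrow> Basis" by auto
    then show ?case using p by (auto simp: poly_forms_def intro: deg_le_if_poly_deg_le)
  next
    case (Suc N)
    have "p x v = (\<Sum>b\<in>Basis. (v N \<bullet> b) * p x (v(N := b)))" for x
      using alternating_upd_sum[OF alt, where i = N and v = v and c = "\<lambda>b. v N \<bullet> b" and B = Basis] Suc.prems(1)
      by (simp add: euclidean_representation)
    moreover have "deg_le r (\<lambda>x. \<Sum>b\<in>Basis. (v N \<bullet> b) * p x (v(N := b)))"
      using Suc.prems by (intro deg_le_sum deg_le_cmult Suc.IH) auto
    ultimately show ?case by simp
  qed
  from this[of k] show "form_deg_le r k p" by (simp add: form_deg_le_def alt)
qed

definition ext_d :: "nat \<Rightarrow> 'a::real_normed_vector dform \<Rightarrow> 'a dform" where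
  "ext_d k a = (\<lambda>x v. \<Sum>i\<le>k. (-1) ^ i * dir_deriv (\<lambda>y. a y (omit i v)) x (v i))"

lemma alternating_dir_deriv:
  fixes a :: "'a::euclidean_space dform"
  assumes a: "form_deg_le r k a"
  shows "alternating k (\<lambda>v. dir_deriv (\<lambda>y. a y v) x u)"
proof (rule alternatingI)
  show "dir_deriv (\<lambda>y. a y v) x u = dir_deriv (\<lambda>y. a y w) x u" if "\<And>i. i < k \<Longrightarrow> v i = w i" for v w
    using alternating_cong[OF form_deg_leD(1)[OF a], of v w] that by simp
  show "linear (\<lambda>z. dir_deriv (\<lambda>y. a y (v(i := z))) x u)" if "i < k" for v i
    unfolding linear_iff
    by (simp add: alternating_upd_add[OF form_deg_leD(1)[OF a] that]
        alternating_upd_scaleR[OF form_deg_leD(1)[OF a] that]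
        dir_deriv_add[OF form_deg_leD(2)[OF a] form_deg_leD(2)[OF a]]
        dir_deriv_cmult[OF form_deg_leD(2)[OF a]])
  show "dir_deriv (\<lambda>y. a y v) x u = 0" if "i < j" "j < k" "v i = v j" for v i j
    using alternating_eq_0[OF form_deg_leD(1)[OF a], of i j v] that by (simp add: dir_deriv_const)
qed

lemma form_deg_le_ext_d:
  fixes a :: "'a::euclidean_space dform"
  assumes "form_deg_le r k a"
  shows "form_deg_le (r - 1) (Suc k) (ext_d k a)"
  unfolding form_deg_le_def ext_d_def
proof (intro conjI allI)
  fix x
  show "alternating (Suc k) (\<lambda>v. \<Sum>i\<le>k. (-1) ^ i * dir_deriv (\<lambda>y. a y (omit i v)) x (v i))"
    by (rule alternating_alternating_sum[of k "\<lambda>u v. dir_deriv (\<lambda>y. a y v) x u"])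
      (use assms in \<open>auto intro: alternating_dir_deriv linear_dir_deriv form_deg_leD\<close>)
next
  fix v
  show "deg_le (r - 1) (\<lambda>x. \<Sum>i\<le>k. (-1) ^ i * dir_deriv (\<lambda>y. a y (omit i v)) x (v i))"
    by (intro deg_le_sum deg_le_cmult deg_le_dir_deriv form_deg_leD[OF assms])
qed

lemma ext_d_lincomb:
  fixes a b :: "'a::euclidean_space dform"
  assumes "form_deg_le r k a" "form_deg_le s k b"
  shows "ext_d k (\<lambda>x v. c * a x v + c' * b x v) = (\<lambda>x v. c * ext_d k a x v + c' * ext_d k b x v)"
  unfolding ext_d_def
  by (simp add: dir_deriv_add[OF deg_le_cmult[OF form_deg_leD(2)[OF assms(1)]]
        deg_le_cmult[OF form_deg_leD(2)[OF assms(2)]]]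
      dir_deriv_cmult[OF form_deg_leD(2)[OF assms(1)]] dir_deriv_cmult[OF form_deg_leD(2)[OF assms(2)]]
      sum.distrib sum_distrib_left distrib_left mult.left_commute)

lemma ext_d_diff:
  fixes a b :: "'a::euclidean_space dform"
  assumes "form_deg_le r k a" "form_deg_le s k b"
  shows "ext_d k (\<lambda>x v. a x v - b x v) = (\<lambda>x v. ext_d k a x v - ext_d k b x v)"
  using ext_d_lincomb[OF assms, of 1 "-1"] by simp

text \<open>The term of \<open>(i, j)\<close> with \<open>i \<le> j\<close> cancels that of \<open>(Suc j, i)\<close>.\<close>

lemma alternating_double_sum_zero:
  fixes h :: "nat \<Rightarrow> nat \<Rightarrow> real"
  assumes "\<And>i j. i \<le> j \<Longrightarrow> j \<le> k \<Longrightarrow> h i j = h (Suc j) i"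
  shows "(\<Sum>i\<le>Suc k. \<Sum>j\<le>k. (-1) ^ (i + j) * h i j) = 0"
proof -
  let ?f = "\<lambda>(i, j). (-1) ^ (i + j) * h i j"
  let ?A = "{(i, j). i \<le> j \<and> j \<le> k}" and ?B = "{(i, j). j < i \<and> i \<le> Suc k}"
  have fin: "finite ?A" "finite ?B"
    by (auto intro: finite_subset[of _ "{..Suc k} \<times> {..Suc k}"])
  have "(\<Sum>i\<le>Suc k. \<Sum>j\<le>k. (-1) ^ (i + j) * h i j) = sum ?f ({..Suc k} \<times> {..k})"
    by (simp add: sum.cartesian_product)
  also have "{..Suc k} \<times> {..k} = ?A \<union> ?B" by auto
  also have "sum ?f (?A \<union> ?B) = sum ?f ?A + sum ?f ?B"
    by (rule sum.union_disjoint) (use fin in auto)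
  also have "sum ?f ?B = (\<Sum>(i, j)\<in>?A. (-1) ^ (Suc j + i) * h (Suc j) i)"
    by (rule sum.reindex_bij_witness[of _ "\<lambda>(i, j). (Suc j, i)" "\<lambda>(i, j). (j, i - 1)"])
      (auto simp: less_iff_Suc_add dest: le_Suc_ex)
  also have "\<dots> = (\<Sum>(i, j)\<in>?A. - ((-1) ^ (i + j) * h i j))"
    by (intro sum.cong) (auto simp: assms add.commute)
  also have "\<dots> = - sum ?f ?A" by (simp add: sum_negf case_prod_unfold)
  finally show ?thesis by simp
qed

lemma ext_d_ext_d:
  fixes a :: "'a::euclidean_space dform"
  assumes a: "form_deg_le r k a"
  shows "ext_d (Suc k) (ext_d k a) = (\<lambda>x v. 0)"
proof (intro ext)
  fix x v
  note deg = form_deg_leD(2)[OF a]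
  let ?h = "\<lambda>i j. dir_deriv (\<lambda>y. dir_deriv (\<lambda>z. a z (omit j (omit i v))) y (omit i v j)) x (v i)"
  have "ext_d (Suc k) (ext_d k a) x v = (\<Sum>i\<le>Suc k. \<Sum>j\<le>k. (-1) ^ (i + j) * ?h i j)"
    unfolding ext_d_def
    by (subst dir_deriv_sum[OF deg_le_dir_deriv[OF deg]])
      (simp add: sum_distrib_left power_add mult.assoc del: sum.atMost_Suc)
  also have "\<dots> = 0"
  proof (rule alternating_double_sum_zero)
    fix i j assume ij: "i \<le> j" "j \<le> k"
    have "omit j (omit i v) = omit i (omit (Suc j) v)"
      using omit_omit[of i "Suc j" v] ij by simp
    moreover have "omit i v j = v (Suc j)" "omit (Suc j) v i = v i" using ij by (auto simp: omit_def)
    ultimately show "?h i j = ?h (Suc j) i"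
      by (simp add: dir_deriv_commute[OF deg, of "omit i (omit (Suc j) v)" "v (Suc j)" x "v i"])
  qed
  finally show "ext_d (Suc k) (ext_d k a) x v = 0" .
qed

text \<open>Meant for affine \<open>f\<close>, whose derivative is \<open>v \<mapsto> f v - f 0\<close>.\<close>

definition pull :: "('a::real_vector \<Rightarrow> 'b::real_vector) \<Rightarrow> 'b dform \<Rightarrow> 'a dform" where
  "pull f a = (\<lambda>x v. a (f x) (\<lambda>i. f (v i) - f 0))"

lemma form_deg_le_pull:
  assumes "form_deg_le r k a" "affine_map f"
  shows "form_deg_le r k (pull f a)"
  unfolding form_deg_le_def pull_def
  using alternating_comp_linear[OF form_deg_leD(1)[OF assms(1)], of "\<lambda>x. f x - f 0"]
    deg_le_comp_affine[OF form_deg_leD(2)[OF assms(1)] assms(2)] assms(2)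
  by (simp add: affine_map_def)

lemma ext_d_pull:
  fixes a :: "'b::euclidean_space dform" and f :: "'a::euclidean_space \<Rightarrow> 'b"
  assumes "form_deg_le r k a" "affine_map f"
  shows "ext_d k (pull f a) = pull f (ext_d k a)"
  unfolding ext_d_def pull_def
  by (simp add: dir_deriv_comp_affine[OF form_deg_leD(2)[OF assms(1)] assms(2)]
      omit_comp[of _ "\<lambda>y. f y - f 0"])

lemma affine_map_diff_diff: "affine_map f \<Longrightarrow> f (x - y) - f 0 = f x - f y"
  using affine_map_plus[of f y "x - y"] by simp

lemma pull_pull: "affine_map g \<Longrightarrow> pull f (pull g a) = pull (\<lambda>x. g (f x)) a"
  by (simp add: pull_def affine_map_diff_diff)

section \<open>Traces on affine subspaces\<close>

text \<open>For an affine subspace \<open>A\<close> through \<open>x\<close>, the vectors \<open>v\<close> with \<open>x + v \<in> A\<close> are the tangent ones.\<close>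

definition trace0 :: "nat \<Rightarrow> 'a::real_vector set \<Rightarrow> 'a dform \<Rightarrow> bool" where
  "trace0 k A a \<longleftrightarrow> (\<forall>x\<in>A. \<forall>v. (\<forall>i<k. x + v i \<in> A) \<longrightarrow> a x v = 0)"

lemma trace0I:
  "(\<And>x v. x \<in> A \<Longrightarrow> (\<And>i. i < k \<Longrightarrow> x + v i \<in> A) \<Longrightarrow> a x v = 0) \<Longrightarrow> trace0 k A a"
  by (auto simp: trace0_def)

lemma trace0D:
  "trace0 k A a \<Longrightarrow> x \<in> A \<Longrightarrow> (\<And>i. i < k \<Longrightarrow> x + v i \<in> A) \<Longrightarrow> a x v = 0"
  by (auto simp: trace0_def)

lemma trace0_mono: "trace0 k B a \<Longrightarrow> A \<subseteq> B \<Longrightarrow> trace0 k A a"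
  by (auto simp: trace0_def)

lemma trace0_pull:
  assumes "trace0 k B a" "affine_map f" "\<And>x. x \<in> A \<Longrightarrow> f x \<in> B"
  shows "trace0 k A (pull f a)"
  unfolding pull_def
  using assms(3) trace0D[OF assms(1)] affine_map_plus[OF assms(2)] by (intro trace0I) metis

text \<open>The derivative of a retraction onto \<open>A\<close> fixes the vectors tangent to \<open>A\<close>.\<close>

lemma trace0_pull_diff:
  assumes a: "form_deg_le r k a" and f: "affine_map f" and fixed: "\<And>x. x \<in> A \<Longrightarrow> f x = x"
  shows "trace0 k A (\<lambda>x v. pull f a x v - a x v)"
proof (rule trace0I)
  fix x v assume x: "x \<in> A" and v: "\<And>i. i < k \<Longrightarrow> x + v i \<in> A"
  have "f (v i) - f 0 = v i" if "i < k" for i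
    using fixed[OF v[OF that]] fixed[OF x] affine_map_plus[OF f, of x "v i"] by simp
  then have "a x (\<lambda>i. f (v i) - f 0) = a x v"
    by (intro alternating_cong[OF form_deg_leD(1)[OF a]]) simp
  then show "pull f a x v - a x v = 0" by (simp add: pull_def fixed[OF x])
qed

lemma trace0_lincomb:
  "trace0 k A a \<Longrightarrow> trace0 k A b \<Longrightarrow> trace0 k A (\<lambda>x v. c * a x v + c' * b x v)"
  by (auto simp: trace0_def)

lemma trace0_add: "trace0 k A a \<Longrightarrow> trace0 k A b \<Longrightarrow> trace0 k A (\<lambda>x v. a x v + b x v)"
  using trace0_lincomb[of k A a b 1 1] by simp

lemma trace0_diff: "trace0 k A a \<Longrightarrow> trace0 k A b \<Longrightarrow> trace0 k A (\<lambda>x v. a x v - b x v)"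
  using trace0_lincomb[of k A a b 1 "-1"] by simp

text \<open>Only derivatives along \<open>A\<close> enter.\<close>

lemma trace0_ext_d:
  fixes a :: "'a::euclidean_space dform"
  assumes a: "form_deg_le r k a" and A: "affine A" and tr: "trace0 k A a"
  shows "trace0 (Suc k) A (ext_d k a)"
proof (rule trace0I)
  fix x v assume x: "x \<in> A" and v: "\<And>i. i < Suc k \<Longrightarrow> x + v i \<in> A"
  have "dir_deriv (\<lambda>y. a y (omit i v)) x (v i) = 0" if i: "i \<le> k" for i
  proof -
    have on_line: "x + t *\<^sub>R v i \<in> A" for t
      using A x v[of i] i mem_affine[OF A x v[of i], of "1 - t" t] by (simp add: algebra_simps)
    have zero: "a (x + t *\<^sub>R v i) (omit i v) = 0" for t
    proof (rule trace0D[OF tr on_line])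
      fix j assume "j < k"
      then have "x + omit i v j \<in> A" using v by (auto simp: omit_def)
      from mem_affine_3[OF A x on_line[of t] this, of "-1" 1 1]
      show "x + t *\<^sub>R v i + omit i v j \<in> A" by (simp add: algebra_simps)
    qed
    let ?g = "\<lambda>t::real. x + t *\<^sub>R v i"
    have "affine_map ?g"
      using affine_map_linear_plus[OF linear_scaleR_left, of "v i" x] by (simp add: add.commute)
    from dir_deriv_comp_affine[OF form_deg_leD(2)[OF a] this, of "omit i v" 0 1]
    show ?thesis by (simp add: zero dir_deriv_const)
  qed
  then show "ext_d k a x v = 0" by (simp add: ext_d_def)
qed

section \<open>The affine homotopy operator\<close>

text \<open>Functions of \<open>x\<close> and a time \<open>t\<close> that are polynomial in \<open>t\<close>, with coefficients of degree at most
  \<open>r\<close> in \<open>x\<close>: integration over the time interval keeps the degree in \<open>x\<close>.\<close>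

inductive poly_family :: "nat \<Rightarrow> ('a::euclidean_space \<Rightarrow> real \<Rightarrow> real) \<Rightarrow> bool" for r where
  monom: "deg_le r g \<Longrightarrow> poly_family r (\<lambda>x t. t ^ m * g x)"
| add: "poly_family r f \<Longrightarrow> poly_family r g \<Longrightarrow> poly_family r (\<lambda>x t. f x t + g x t)"

lemma poly_family_const: "deg_le r g \<Longrightarrow> poly_family r (\<lambda>x t. g x)"
  using poly_family.monom[of r g 0] by simp

lemma poly_family_mult:
  assumes "poly_family r f" "deg_le s g"
  shows "poly_family (s + r) (\<lambda>x t. g x * f x t)"
  using assms(1)
proof (induction rule: poly_family.induct)
  case (monom h m)
  from poly_family.monom[OF deg_le_mult[OF assms(2) monom], of m]
  show ?case by (simp add: mult.left_commute)
next
  case (add f g)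
  from poly_family.add[OF add.IH] show ?case by (simp add: distrib_left)
qed

lemma poly_family_times_t: "poly_family r f \<Longrightarrow> poly_family r (\<lambda>x t. t * f x t)"
proof (induction rule: poly_family.induct)
  case (monom h m)
  from poly_family.monom[OF monom, of "Suc m"] show ?case by (simp add: mult.assoc)
next
  case (add f g)
  from poly_family.add[OF add.IH] show ?case by (simp add: distrib_left)
qed

lemma poly_family_sum:
  "(\<And>i. i \<in> I \<Longrightarrow> poly_family r (f i)) \<Longrightarrow> poly_family r (\<lambda>x t. \<Sum>i\<in>I. f i x t)"
  by (induction I rule: infinite_finite_induct)
    (auto intro: poly_family.add poly_family_const deg_le.const)

lemma poly_family_continuous: "poly_family r f \<Longrightarrow> continuous_on A (f x)"
  by (induction rule: poly_family.induct) (auto intro!: continuous_intros)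

lemma poly_family_integrable: "poly_family r f \<Longrightarrow> f x integrable_on {0..1}"
  by (intro integrable_continuous_interval poly_family_continuous)

lemma poly_family_deg_le: "poly_family r f \<Longrightarrow> deg_le r (\<lambda>x. f x t)"
  by (induction rule: poly_family.induct) (auto intro: deg_le_cmult deg_le.add)

lemma integral_time_monom: "integral {0..1} (\<lambda>t::real. t ^ m * c) = integral {0..1} (\<lambda>t. t ^ m) * (c::real)"
  by (rule integral_mult_left)

lemma poly_family_deg_le_integral:
  "poly_family r f \<Longrightarrow> deg_le r (\<lambda>x. integral {0..1} (f x))"
proof (induction rule: poly_family.induct)
  case (monom g m)
  then show ?case by (simp add: integral_time_monom deg_le_cmult)
next
  case (add f g)
  then show ?case
    using integral_add[OF poly_family_integrable[OF add.hyps(1)] poly_family_integrable[OF add.hyps(2)]]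
    by (simp add: deg_le.add)
qed

lemma poly_family_dir_deriv: "poly_family r f \<Longrightarrow> poly_family (r - 1) (\<lambda>x t. dir_deriv (\<lambda>y. f y t) x u)"
proof (induction rule: poly_family.induct)
  case (monom g m)
  then show ?case
    using poly_family.monom[OF deg_le_dir_deriv[OF monom], of m u] by (simp add: dir_deriv_cmult)
next
  case (add f g)
  then show ?case
    using poly_family.add[OF add.IH]
    by (simp add: dir_deriv_add[OF poly_family_deg_le[OF add.hyps(1)] poly_family_deg_le[OF add.hyps(2)]])
qed

lemma poly_family_dir_deriv_integral:
  "poly_family r f \<Longrightarrow>
    dir_deriv (\<lambda>x. integral {0..1} (f x)) x u = integral {0..1} (\<lambda>t. dir_deriv (\<lambda>y. f y t) x u)"
proof (induction rule: poly_family.induct)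
  case (monom g m)
  then show ?case by (simp add: integral_time_monom dir_deriv_cmult)
next
  case (add f g)
  note int = poly_family_integrable[OF add.hyps(1)] poly_family_integrable[OF add.hyps(2)]
  note dint = poly_family_integrable[OF poly_family_dir_deriv[OF add.hyps(1)]]
    poly_family_integrable[OF poly_family_dir_deriv[OF add.hyps(2)]]
  have "dir_deriv (\<lambda>x. integral {0..1} (\<lambda>t. f x t + g x t)) x u =
      dir_deriv (\<lambda>x. integral {0..1} (f x) + integral {0..1} (g x)) x u"
    by (simp add: integral_add[OF int])
  also have "\<dots> = integral {0..1} (\<lambda>t. dir_deriv (\<lambda>y. f y t) x u) + integral {0..1} (\<lambda>t. dir_deriv (\<lambda>y. g y t) x u)"
    using add.IH
    by (simp add: dir_deriv_add[OF poly_family_deg_le_integral[OF add.hyps(1)]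
          poly_family_deg_le_integral[OF add.hyps(2)]])
  also have "\<dots> = integral {0..1} (\<lambda>t. dir_deriv (\<lambda>y. f y t + g y t) x u)"
    by (simp add: integral_add[OF dint]
        dir_deriv_add[OF poly_family_deg_le[OF add.hyps(1)] poly_family_deg_le[OF add.hyps(2)]])
  finally show ?case .
qed

lemma poly_family_comp:
  assumes "deg_le r f" "affine_map A" "affine_map B"
  shows "poly_family r (\<lambda>x t. f (A x + t *\<^sub>R B x))"
  using assms(1)
proof (induction rule: deg_le.induct)
  case (const r c)
  show ?case by (rule poly_family_const[OF deg_le.const])
next
  case (add r f g)
  from poly_family.add[OF add.IH] show ?case .
next
  case (mult l r f)
  have l: "deg_le 1 (\<lambda>x. l (A x))" "deg_le 1 (\<lambda>x. l (B x))"
    using deg_le_comp_affine[OF deg_le_linear[OF mult.hyps(1)]] assms(2,3) by auto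
  have "poly_family (1 + r) (\<lambda>x t. l (A x) * f (A x + t *\<^sub>R B x) + t * (l (B x) * f (A x + t *\<^sub>R B x)))"
    by (intro poly_family.add poly_family_times_t poly_family_mult mult.IH l)
  then show ?case using mult.hyps(1) by (simp add: linear_add linear_scale algebra_simps)
qed

lemma fun_upd_below:
  "(\<lambda>i. if i < Suc N then f i else e i) = (\<lambda>i. if i < N then f i else e i)(N := f N)"
  "(\<lambda>i. if i < N then f i else e i)(N := y) = (\<lambda>i. if i < N then f i else (e(N := y)) i)"
  by (auto simp: less_Suc_eq)

text \<open>Both the point and the vectors depend on time; the vectors are made time dependent one after the
  other.\<close>

lemma poly_family_form:
  fixes a :: "'a::euclidean_space dform"
  assumes a: "form_deg_le r k a" and AB: "affine_map A" "affine_map B"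
  shows "poly_family r (\<lambda>x t. a (A x + t *\<^sub>R B x) (\<lambda>i. c i + t *\<^sub>R d i))"
proof -
  have "poly_family r (\<lambda>x t. a (A x + t *\<^sub>R B x) (\<lambda>i. if i < N then c i + t *\<^sub>R d i else e i))"
    if "N \<le> k" for N e using that
  proof (induction N arbitrary: e)
    case 0
    then show ?case using poly_family_comp[OF form_deg_leD(2)[OF a] AB] by simp
  next
    case (Suc N)
    have N: "N < k" using Suc.prems by simp
    note IH = Suc.IH[OF less_imp_le[OF N]]
    show ?case
      unfolding fun_upd_below(1)
      unfolding alternating_upd_add[OF form_deg_leD(1)[OF a] N]
        alternating_upd_scaleR[OF form_deg_leD(1)[OF a] N]
      unfolding fun_upd_below(2)
      by (intro poly_family.add poly_family_times_t IH)
  qed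
  from this[of k "\<lambda>_. 0"]
  have "poly_family r (\<lambda>x t. a (A x + t *\<^sub>R B x) (\<lambda>i. if i < k then c i + t *\<^sub>R d i else 0))" by simp
  moreover have "a (A x + t *\<^sub>R B x) (\<lambda>i. if i < k then c i + t *\<^sub>R d i else 0) =
      a (A x + t *\<^sub>R B x) (\<lambda>i. c i + t *\<^sub>R d i)" for x t
    by (rule alternating_cong[OF form_deg_leD(1)[OF a]]) simp
  ultimately show ?thesis by (simp only:)
qed

text \<open>The product rule for the point and the vectors, again adding one moving vector at a time.\<close>

lemma has_derivative_form_along:
  fixes a :: "'a::euclidean_space dform" and x y :: 'a and c d :: "nat \<Rightarrow> 'a"
  assumes a: "form_deg_le r k a"
  defines "H \<equiv> \<lambda>t. x + t *\<^sub>R y" and "w \<equiv> \<lambda>t i. c i + t *\<^sub>R d i"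
  shows "((\<lambda>t. a (H t) (w t)) has_real_derivative
    dir_deriv (\<lambda>z. a z (w t)) (H t) y + (\<Sum>i<k. a (H t) ((w t)(i := d i)))) (at t)"
proof -
  define s where "s = (\<lambda>N e t i. if i < N then w t i else e i)"
  have s_Suc: "s (Suc N) e t = (s N e t)(N := c N + t *\<^sub>R d N)" for N e t
    unfolding s_def w_def by (rule fun_upd_below(1))
  have s_upd: "(s N e t)(N := z) = s N (e(N := z)) t" for N e t z
    unfolding s_def by (rule fun_upd_below(2))
  note alt = form_deg_leD(1)[OF a] and altd = alternating_dir_deriv[OF a]
  have "((\<lambda>t. a (H t) (s N e t)) has_real_derivative
      dir_deriv (\<lambda>z. a z (s N e t)) (H t) y + (\<Sum>i<N. a (H t) ((s N e t)(i := d i)))) (at t)"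
    if "N \<le> k" for N e using that
  proof (induction N arbitrary: e)
    case 0
    have "(H has_derivative (\<lambda>h. h *\<^sub>R y)) (at t)"
      unfolding H_def by (auto intro!: derivative_eq_intros)
    from has_derivative_compose[OF this deg_le_frechet[OF form_deg_leD(2)[OF a, of e]]]
    have "((\<lambda>t. a (H t) e) has_derivative (\<lambda>h. dir_deriv (\<lambda>z. a z e) (H t) (h *\<^sub>R y))) (at t)" .
    moreover have "(\<lambda>h. dir_deriv (\<lambda>z. a z e) (H t) (h *\<^sub>R y)) = (*) (dir_deriv (\<lambda>z. a z e) (H t) y)"
      by (simp add: fun_eq_iff linear_scale[OF linear_dir_deriv[OF form_deg_leD(2)[OF a]]] mult.commute)
    ultimately show ?case by (simp add: s_def has_field_derivative_def)
  next
    case (Suc N)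
    have N: "N < k" using Suc.prems by simp
    note IH = Suc.IH[OF less_imp_le[OF N]]
    let ?S = "s N e"
    have split: "a z ((?S t)(N := c N + t *\<^sub>R d N)) = a z ((?S t)(N := c N)) + t * a z ((?S t)(N := d N))"
      for z t
      by (simp only: alternating_upd_add[OF alt N] alternating_upd_scaleR[OF alt N])
    have dsplit: "dir_deriv (\<lambda>z. a z ((?S t)(N := c N + t *\<^sub>R d N))) z' y =
       dir_deriv (\<lambda>z. a z ((?S t)(N := c N))) z' y + t * dir_deriv (\<lambda>z. a z ((?S t)(N := d N))) z' y" for z'
      by (simp only: alternating_upd_add[OF altd N] alternating_upd_scaleR[OF altd N])
    have twist: "((?S t)(N := z))(i := d i) = ((?S t)(i := d i))(N := z)" if "i < N" for i z
      using that by (simp add: fun_upd_twist)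
    have isplit: "a z (((?S t)(N := c N + t *\<^sub>R d N))(i := d i)) =
       a z (((?S t)(N := c N))(i := d i)) + t * a z (((?S t)(N := d N))(i := d i))" if "i < N" for z i
      by (simp only: twist[OF that] alternating_upd_add[OF alt N] alternating_upd_scaleR[OF alt N])
    have "((\<lambda>t. a (H t) ((?S t)(N := c N)) + t * a (H t) ((?S t)(N := d N))) has_real_derivative
       (dir_deriv (\<lambda>z. a z ((?S t)(N := c N))) (H t) y + (\<Sum>i<N. a (H t) (((?S t)(N := c N))(i := d i)))) +
       (1 * a (H t) ((?S t)(N := d N)) +
        (dir_deriv (\<lambda>z. a z ((?S t)(N := d N))) (H t) y + (\<Sum>i<N. a (H t) (((?S t)(N := d N))(i := d i)))) * t)) (at t)"
      unfolding s_upd by (intro DERIV_add DERIV_mult DERIV_ident IH)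
    also have "(dir_deriv (\<lambda>z. a z ((?S t)(N := c N))) (H t) y + (\<Sum>i<N. a (H t) (((?S t)(N := c N))(i := d i)))) +
       (1 * a (H t) ((?S t)(N := d N)) +
        (dir_deriv (\<lambda>z. a z ((?S t)(N := d N))) (H t) y + (\<Sum>i<N. a (H t) (((?S t)(N := d N))(i := d i)))) * t) =
      dir_deriv (\<lambda>z. a z (s (Suc N) e t)) (H t) y + (\<Sum>i<Suc N. a (H t) ((s (Suc N) e t)(i := d i)))"
      unfolding s_Suc dsplit sum.lessThan_Suc
      by (simp add: isplit sum.distrib sum_distrib_left algebra_simps del: fun_upd_apply)
    finally show ?case unfolding s_Suc split .
  qed
  from this[of k "w 0"] have *: "((\<lambda>t. a (H t) (s k (w 0) t)) has_real_derivative
      dir_deriv (\<lambda>z. a z (s k (w 0) t)) (H t) y + (\<Sum>i<k. a (H t) ((s k (w 0) t)(i := d i)))) (at t)"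
    by simp
  have "a z (s k (w 0) t) = a z (w t)" for z t
    by (rule alternating_cong[OF alt]) (simp add: s_def)
  moreover have "a z ((s k (w 0) t)(i := d i)) = a z ((w t)(i := d i))" for z i
    by (rule alternating_cong[OF alt]) (simp add: s_def)
  ultimately show ?thesis using * by (simp del: fun_upd_apply)
qed

text \<open>For an affine map \<open>p\<close>, the maps \<open>x \<mapsto> p x + t (x - p x)\<close> join \<open>p\<close> to the identity.  The operator
  integrates the contraction of the pulled back form with the velocity \<open>x - p x\<close>.  With \<open>p = 0\<close> it is
  the radial (Poincare) operator; with \<open>p\<close> a projection it integrates along the fibres.\<close>

definition moved :: "('a::real_vector \<Rightarrow> 'a) \<Rightarrow> (nat \<Rightarrow> 'a) \<Rightarrow> real \<Rightarrow> nat \<Rightarrow> 'a" where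
  "moved p v t = (\<lambda>i. (p (v i) - p 0) + t *\<^sub>R (v i - (p (v i) - p 0)))"

definition homotopy_integrand ::
    "('a::real_vector \<Rightarrow> 'a) \<Rightarrow> 'a dform \<Rightarrow> 'a \<Rightarrow> (nat \<Rightarrow> 'a) \<Rightarrow> real \<Rightarrow> real" where
  "homotopy_integrand p a x v t = a (p x + t *\<^sub>R (x - p x)) (vcons (x - p x) (moved p v t))"

definition homotopy_op :: "('a::real_vector \<Rightarrow> 'a) \<Rightarrow> 'a dform \<Rightarrow> 'a dform" where
  "homotopy_op p a = (\<lambda>x v. integral {0..1} (homotopy_integrand p a x v))"

lemma omit_moved: "moved p (omit i v) t = omit i (moved p v t)"
  by (auto simp: moved_def omit_def)

lemma vcons_affine:
  "vcons b (moved p v t) = (\<lambda>i. vcons b (moved p v 0) i + t *\<^sub>R vcons 0 (\<lambda>i. v i - (p (v i) - p 0)) i)"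
  by (auto simp: vcons_def moved_def split: nat.split)

lemma form_first_expand:
  fixes a :: "'a::euclidean_space dform"
  assumes "form_deg_le r (Suc k) a"
  shows "a z (vcons u v) = (\<Sum>b\<in>Basis. (u \<bullet> b) * a z (vcons b v))"
  using alternating_upd_sum[OF form_deg_leD(1)[OF assms], where i = 0 and v = "vcons u v" and
      c = "\<lambda>b. u \<bullet> b" and B = Basis]
  by (simp add: euclidean_representation vcons_upd_0 del: fun_upd_apply)

lemma deg_le_affine_inner: "affine_map g \<Longrightarrow> deg_le 1 (\<lambda>x. g x \<bullet> b)"
  using deg_le_comp_affine[OF deg_le_linear[OF bounded_linear.linear[OF bounded_linear_inner_left]], of g b]
  by simp

lemma poly_family_homotopy_integrand:
  fixes a :: "'a::euclidean_space dform"
  assumes a: "form_deg_le r (Suc k) a" and p: "affine_map p"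
  shows "poly_family (Suc r) (\<lambda>x. homotopy_integrand p a x v)"
proof -
  note X = affine_map_diff[OF affine_map_id p]
  have "poly_family r (\<lambda>x t. a (p x + t *\<^sub>R (x - p x)) (vcons b (moved p v t)))" for b
    using poly_family_form[OF a p X, of "vcons b (moved p v 0)" "vcons 0 (\<lambda>i. v i - (p (v i) - p 0))"]
    by (simp only: vcons_affine[of b p v, symmetric])
  then have "poly_family (1 + r) (\<lambda>x t. \<Sum>b\<in>Basis. ((x - p x) \<bullet> b) *
      a (p x + t *\<^sub>R (x - p x)) (vcons b (moved p v t)))"
    by (intro poly_family_sum poly_family_mult deg_le_affine_inner X)
  then show ?thesis unfolding homotopy_integrand_def
    by (simp add: form_first_expand[OF a, symmetric])
qed

lemma alternating_homotopy_integrand: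
  fixes a :: "'a::euclidean_space dform"
  assumes a: "form_deg_le r (Suc k) a" and p: "affine_map p"
  shows "alternating k (\<lambda>v. homotopy_integrand p a x v t)"
proof -
  have l: "linear (\<lambda>v. p v - p 0)" using p by (simp add: affine_map_def)
  have "linear (\<lambda>v. (p v - p 0) + t *\<^sub>R (v - (p v - p 0)))"
    by (intro linear_compose_add l linear_compose_scale_right linear_compose_sub linear_ident)
  from alternating_comp_linear[OF alternating_contract[OF form_deg_leD(1)[OF a]] this]
  show ?thesis by (simp add: homotopy_integrand_def moved_def)
qed

lemma form_deg_le_homotopy_op:
  fixes a :: "'a::euclidean_space dform"
  assumes a: "form_deg_le r (Suc k) a" and p: "affine_map p"
  shows "form_deg_le (Suc r) k (homotopy_op p a)"
  unfolding form_deg_le_def homotopy_op_def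
proof (intro conjI allI)
  fix x
  note alt = alternating_homotopy_integrand[OF a p, of x]
  note int = poly_family_integrable[OF poly_family_homotopy_integrand[OF a p], of x]
  show "alternating k (\<lambda>v. integral {0..1} (homotopy_integrand p a x v))"
  proof (rule alternatingI)
    show "integral {0..1} (homotopy_integrand p a x v) = integral {0..1} (homotopy_integrand p a x w)"
      if "\<And>i. i < k \<Longrightarrow> v i = w i" for v w
      by (rule arg_cong[of _ _ "integral {0..1}"], rule ext, rule alternating_cong[OF alt that])
    show "linear (\<lambda>y. integral {0..1} (homotopy_integrand p a x (v(i := y))))" if "i < k" for v i
    proof (rule linearI)
      fix y z and c :: real
      have "homotopy_integrand p a x (v(i := y + z)) =
          (\<lambda>t. homotopy_integrand p a x (v(i := y)) t + homotopy_integrand p a x (v(i := z)) t)"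
        using alternating_upd_add[OF alt that] by blast
      then show "integral {0..1} (homotopy_integrand p a x (v(i := y + z))) =
          integral {0..1} (homotopy_integrand p a x (v(i := y))) +
          integral {0..1} (homotopy_integrand p a x (v(i := z)))"
        by (simp add: integral_add[OF int int] del: fun_upd_apply)
      have "homotopy_integrand p a x (v(i := c *\<^sub>R y)) = (\<lambda>t. c * homotopy_integrand p a x (v(i := y)) t)"
        using alternating_upd_scaleR[OF alt that] by blast
      then show "integral {0..1} (homotopy_integrand p a x (v(i := c *\<^sub>R y))) =
          c *\<^sub>R integral {0..1} (homotopy_integrand p a x (v(i := y)))"
        by (simp del: fun_upd_apply)
    qed
    show "integral {0..1} (homotopy_integrand p a x v) = 0" if "i < j" "j < k" "v i = v j" for v i j
    proof -
      have "homotopy_integrand p a x v = (\<lambda>t. 0)"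
        by (rule ext, rule alternating_eq_0[OF alt, of i j]) (use that in auto)
      then show ?thesis by simp
    qed
  qed
next
  fix v
  show "deg_le (Suc r) (\<lambda>x. integral {0..1} (homotopy_integrand p a x v))"
    by (rule poly_family_deg_le_integral[OF poly_family_homotopy_integrand[OF a p]])
qed

lemma dir_deriv_homotopy_integrand:
  fixes a :: "'a::euclidean_space dform"
  assumes a: "form_deg_le r (Suc k) a" and p: "affine_map p"
  shows "dir_deriv (\<lambda>x. homotopy_integrand p a x v t) x (u) =
    dir_deriv (\<lambda>z. a z (vcons (x - p x) (moved p v t))) (p x + t *\<^sub>R (x - p x))
        ((p u - p 0) + t *\<^sub>R (u - (p u - p 0))) +
    a (p x + t *\<^sub>R (x - p x)) (vcons (u - (p u - p 0)) (moved p v t))"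
proof -
  let ?H = "\<lambda>x. p x + t *\<^sub>R (x - p x)" and ?w = "moved p v t"
  let ?h = "(p u - p 0) + t *\<^sub>R (u - (p u - p 0))"
  have X: "affine_map (\<lambda>x. x - p x)" by (intro affine_map_diff affine_map_id p)
  have H: "affine_map ?H"
    by (intro affine_map_add p affine_map_linear_comp[OF X, of "\<lambda>z. t *\<^sub>R z"] linear_scale_self)
  have Hd: "?H u - ?H 0 = ?h" by (simp add: algebra_simps)
  have deg: "deg_le r (\<lambda>z. a z w)" for w by (rule form_deg_leD(2)[OF a])
  have db: "dir_deriv (\<lambda>x. (x - p x) \<bullet> b) x u = (u - (p u - p 0)) \<bullet> b" for b
    using dir_deriv_comp_affine[OF deg_le_linear[OF bounded_linear.linear[OF bounded_linear_inner_left]] X, of b x u]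
      dir_deriv_linear[OF bounded_linear.linear[OF bounded_linear_inner_left], of b]
    by (simp add: algebra_simps)
  have dH: "dir_deriv (\<lambda>x. a (?H x) w) x u = dir_deriv (\<lambda>z. a z w) (?H x) ?h" for w
    using dir_deriv_comp_affine[OF deg H, of w x u] unfolding Hd .
  have alt: "alternating (Suc k) (\<lambda>w. dir_deriv (\<lambda>z. a z w) (?H x) ?h)"
    by (rule alternating_dir_deriv[OF a])
  have "dir_deriv (\<lambda>x. homotopy_integrand p a x v t) x u =
      dir_deriv (\<lambda>x. \<Sum>b\<in>Basis. ((x - p x) \<bullet> b) * a (?H x) (vcons b ?w)) x u"
    unfolding homotopy_integrand_def by (simp add: form_first_expand[OF a, symmetric])
  also have "\<dots> = (\<Sum>b\<in>Basis. dir_deriv (\<lambda>x. ((x - p x) \<bullet> b) * a (?H x) (vcons b ?w)) x u)"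
    using dir_deriv_sum[of Basis "Suc r" "\<lambda>b x. ((x - p x) \<bullet> b) * a (?H x) (vcons b ?w)" "\<lambda>_. 1" x u]
      deg_le_mult[OF deg_le_affine_inner[OF X] deg_le_comp_affine[OF deg H]] by simp
  also have "\<dots> = (\<Sum>b\<in>Basis. ((x - p x) \<bullet> b) * dir_deriv (\<lambda>z. a z (vcons b ?w)) (?H x) ?h +
      ((u - (p u - p 0)) \<bullet> b) * a (?H x) (vcons b ?w))"
    by (intro sum.cong refl, subst dir_deriv_mult[OF deg_le_affine_inner[OF X] deg_le_comp_affine[OF deg H]])
      (simp add: dH db)
  also have "\<dots> = dir_deriv (\<lambda>z. a z (vcons (x - p x) ?w)) (?H x) ?h +
      a (?H x) (vcons (u - (p u - p 0)) ?w)"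
    using alternating_upd_sum[OF alt, where i = 0 and v = "vcons 0 ?w" and c = "\<lambda>b. (x - p x) \<bullet> b" and B = Basis]
    by (simp add: sum.distrib form_first_expand[OF a, symmetric] euclidean_representation vcons_upd_0
        del: fun_upd_apply)
  finally show ?thesis .
qed

text \<open>Cartan's formula: up to the terms that contain \<open>d a = 0\<close>, the derivative of the operator is the
  integral of the time derivative of the pulled back form.\<close>

theorem ext_d_homotopy_op:
  fixes a :: "'a::euclidean_space dform"
  assumes a: "form_deg_le r (Suc k) a" and p: "affine_map p" and closed: "ext_d (Suc k) a = (\<lambda>x v. 0)"
  shows "ext_d k (homotopy_op p a) = (\<lambda>x v. a x v - pull p a x v)"
proof (intro ext)
  fix x and v :: "nat \<Rightarrow> 'a"
  define X where "X = x - p x"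
  define H where "H = (\<lambda>t. p x + t *\<^sub>R X)"
  define d where "d = (\<lambda>i. v i - (p (v i) - p 0))"
  define w where "w = moved p v"
  have w_eq: "w t = (\<lambda>i. (p (v i) - p 0) + t *\<^sub>R d i)" for t by (simp add: w_def moved_def d_def)
  note alt = form_deg_leD(1)[OF a]
  let ?g = "\<lambda>i t. dir_deriv (\<lambda>x. homotopy_integrand p a x (omit i v) t) x (v i)"
  have g: "?g i t = dir_deriv (\<lambda>z. a z (vcons X (omit i (w t)))) (H t) (w t i) +
      a (H t) (vcons (d i) (omit i (w t)))" for i t
    by (simp add: dir_deriv_homotopy_integrand[OF a p] omit_moved X_def H_def d_def w_def)
      (simp add: moved_def)
  let ?F = "\<lambda>t. dir_deriv (\<lambda>z. a z (w t)) (H t) X + (\<Sum>i<Suc k. a (H t) ((w t)(i := d i)))"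
  have sum_g: "(\<Sum>i\<le>k. (-1) ^ i * ?g i t) = ?F t" for t
  proof -
    have "0 = ext_d (Suc k) a (H t) (vcons X (w t))" by (simp add: closed)
    also have "\<dots> = dir_deriv (\<lambda>z. a z (w t)) (H t) X -
        (\<Sum>i\<le>k. (-1) ^ i * dir_deriv (\<lambda>z. a z (vcons X (omit i (w t)))) (H t) (w t i))"
      unfolding ext_d_def by (subst sum.atMost_Suc_shift) (simp add: omit_vcons sum_negf)
    finally have "(\<Sum>i\<le>k. (-1) ^ i * dir_deriv (\<lambda>z. a z (vcons X (omit i (w t)))) (H t) (w t i)) =
        dir_deriv (\<lambda>z. a z (w t)) (H t) X" by simp
    moreover have "(-1) ^ i * a (H t) (vcons (d i) (omit i (w t))) = a (H t) ((w t)(i := d i))" if "i \<le> k" for i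
      using that alternating_move_first[OF alt, of i "H t" "d i" "w t"]
      by (simp add: power_mult_distrib[symmetric] mult.assoc[symmetric] del: fun_upd_apply)
    ultimately show ?thesis
      by (simp add: g distrib_left sum.distrib lessThan_Suc_atMost del: fun_upd_apply sum.lessThan_Suc)
  qed
  have int: "?g i integrable_on {0..1}" for i
    by (rule poly_family_integrable[OF poly_family_dir_deriv[OF poly_family_homotopy_integrand[OF a p]]])
  have "ext_d k (homotopy_op p a) x v = (\<Sum>i\<le>k. (-1) ^ i * integral {0..1} (?g i))"
    unfolding ext_d_def homotopy_op_def
    by (simp add: poly_family_dir_deriv_integral[OF poly_family_homotopy_integrand[OF a p]])
  also have "\<dots> = integral {0..1} (\<lambda>t. \<Sum>i\<le>k. (-1) ^ i * ?g i t)"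
    by (subst integral_sum) (auto intro: integrable_on_mult_right int)
  also have "\<dots> = integral {0..1} ?F" by (simp only: sum_g)
  also have "\<dots> = a (H 1) (w 1) - a (H 0) (w 0)"
  proof (rule integral_unique, rule fundamental_theorem_of_calculus)
    fix t :: real
    show "((\<lambda>t. a (H t) (w t)) has_vector_derivative ?F t) (at t within {0..1})"
      unfolding H_def w_eq
      by (rule has_vector_derivative_at_within)
        (use has_derivative_form_along[OF a, of "p x" X "\<lambda>i. p (v i) - p 0" d t] in
          \<open>simp add: has_real_derivative_iff_has_vector_derivative\<close>)
  qed simp
  also have "w 1 = v" by (simp add: w_eq d_def)
  finally show "ext_d k (homotopy_op p a) x v = a x v - pull p a x v"
    by (simp add: H_def X_def w_eq pull_def)
qed

section \<open>Extension of forms from the standard simplex\<close>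

definition closed_form :: "nat \<Rightarrow> 'a::euclidean_space dform \<Rightarrow> bool" where
  "closed_form k a \<longleftrightarrow> ext_d k a = (\<lambda>x v. 0)"

definition coord_proj :: "'m set \<Rightarrow> real ^ 'm \<Rightarrow> real ^ 'm" where
  "coord_proj J x = (\<chi> i. if i \<in> J then x $ i else 0)"

text \<open>The forms in the coordinates \<open>y\<^sub>i\<close> with \<open>i \<in> J\<close> and their differentials, that is, the forms on
  \<open>\<real>\<^sup>J\<close>.  They are kept on one ambient space so that induction on \<open>J\<close> is possible.\<close>

definition on_coords :: "'m set \<Rightarrow> (real ^ 'm::finite) dform \<Rightarrow> bool" where
  "on_coords J a \<longleftrightarrow> pull (coord_proj J) a = a"

definition coord_plane :: "'m \<Rightarrow> (real ^ 'm) set" where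
  "coord_plane i = {x. x $ i = 0}"

definition coord_sum :: "'m set \<Rightarrow> real ^ 'm::finite \<Rightarrow> real" where
  "coord_sum J x = (\<Sum>i\<in>J. x $ i)"

definition simplex_plane :: "'m set \<Rightarrow> (real ^ 'm::finite) set" where
  "simplex_plane J = {x. coord_sum J x = 1}"

text \<open>For \<open>j \<in> J\<close> this is the affine retraction to \<open>simplex_plane J\<close> along the \<open>j\<close>-th axis; since the
  result does not depend on the \<open>j\<close>-th coordinate, it parametrizes the plane by the other coordinates.\<close>

definition to_simplex :: "'m set \<Rightarrow> 'm \<Rightarrow> real ^ 'm::finite \<Rightarrow> real ^ 'm" where
  "to_simplex J j x = x + (1 - coord_sum J x) *\<^sub>R axis j 1"

lemma linear_nth: "linear (\<lambda>x :: real ^ 'm. x $ i)"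
  by (simp add: linear_iff)

lemma linear_coord_sum: "linear (coord_sum J)"
  unfolding coord_sum_def by (intro linear_compose_sum ballI linear_nth)

lemma linear_coord_proj: "linear (coord_proj J)"
  by (simp add: linear_iff coord_proj_def vec_eq_iff)

lemma affine_map_coord_proj: "affine_map (coord_proj J)"
  by (rule affine_map_linear[OF linear_coord_proj])

lemma affine_map_to_simplex: "affine_map (to_simplex J j)"
proof -
  have "affine_map (\<lambda>x. 1 - coord_sum J x)"
    by (intro affine_map_diff affine_map_const affine_map_linear linear_coord_sum)
  then show ?thesis unfolding to_simplex_def[abs_def]
    by (intro affine_map_add affine_map_id affine_map_linear_comp[of _ "\<lambda>t. t *\<^sub>R axis j 1"] linear_scaleR_left)
qed

lemma coord_sum_simps [simp]:
  "coord_sum J 0 = 0"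
  "coord_sum J (x + y) = coord_sum J x + coord_sum J y"
  "coord_sum J (x - y) = coord_sum J x - coord_sum J y"
  "coord_sum J (- x) = - coord_sum J x"
  "coord_sum J (c *\<^sub>R x) = c * coord_sum J x"
  using linear_coord_sum[of J] by (simp_all add: linear_0 linear_add linear_diff linear_neg linear_scale)

lemma coord_sum_axis: "coord_sum J (axis i 1) = (if i \<in> J then 1 else 0)"
  by (simp add: coord_sum_def axis_def if_distrib sum.delta cong: if_cong)

lemma coord_sum_insert: "j \<notin> J \<Longrightarrow> coord_sum (insert j J) x = x $ j + coord_sum J x"
  by (simp add: coord_sum_def)

lemma coord_sum_coord_proj: "K \<subseteq> J \<Longrightarrow> coord_sum K (coord_proj J x) = coord_sum K x"
  unfolding coord_sum_def coord_proj_def by (intro sum.cong) auto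

lemma coord_proj_0 [simp]: "coord_proj J 0 = 0"
  by (rule linear_0[OF linear_coord_proj])

lemma coord_proj_coord_proj: "coord_proj J (coord_proj K x) = coord_proj (J \<inter> K) x"
  by (auto simp: coord_proj_def vec_eq_iff)

lemma coord_proj_axis: "i \<in> J \<Longrightarrow> coord_proj J (axis i c) = axis i c"
  by (auto simp: coord_proj_def vec_eq_iff axis_def)

lemma affine_coord_plane: "affine (coord_plane i)"
  by (auto simp: affine_def coord_plane_def)

lemma affine_simplex_plane: "affine (simplex_plane J)"
  by (auto simp: affine_def simplex_plane_def)

lemma to_simplex_in_plane: "j \<in> J \<Longrightarrow> to_simplex J j x \<in> simplex_plane J"
  by (simp add: to_simplex_def simplex_plane_def coord_sum_axis)

lemma to_simplex_id: "x \<in> simplex_plane J \<Longrightarrow> to_simplex J j x = x"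
  by (simp add: to_simplex_def simplex_plane_def)

lemma to_simplex_nth: "i \<noteq> j \<Longrightarrow> to_simplex J j x $ i = x $ i"
  by (simp add: to_simplex_def axis_def)

lemma to_simplex_nth_same: "j \<notin> J \<Longrightarrow> to_simplex (insert j J) j x $ j = 1 - coord_sum J x"
  by (simp add: to_simplex_def axis_def coord_sum_insert)

lemma to_simplex_coord_proj:
  assumes "j \<in> J" "J - {j} \<subseteq> K" "K \<subseteq> J"
  shows "to_simplex J j (coord_proj K x) = coord_proj J (to_simplex J j x)"
proof -
  have "coord_sum J (coord_proj K x) - coord_proj K x $ j = coord_sum J x - x $ j"
  proof -
    have "coord_sum J y - y $ j = coord_sum (J - {j}) y" for y :: "real ^ 'a"
      using assms(1) by (simp add: coord_sum_def sum_diff1)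
    then show ?thesis using coord_sum_coord_proj[OF assms(2)] by simp
  qed
  then have "coord_proj K x $ j + (1 - coord_sum J (coord_proj K x)) = x $ j + (1 - coord_sum J x)"
    by simp
  moreover have "to_simplex J j (coord_proj K x) $ i = coord_proj J (to_simplex J j x) $ i" if "i \<noteq> j" for i
    using assms that by (auto simp: to_simplex_nth coord_proj_def)
  moreover have "to_simplex J j y $ j = y $ j + (1 - coord_sum J y)" for y
    by (simp add: to_simplex_def axis_def)
  moreover have "coord_proj J y $ j = y $ j" for y
    using assms(1) by (simp add: coord_proj_def)
  ultimately show ?thesis unfolding vec_eq_iff by metis
qed

lemma on_coords_apply:
  assumes "on_coords J a"
  shows "a (coord_proj J x) (\<lambda>i. coord_proj J (v i)) = a x v"
proof -
  have "pull (coord_proj J) a x v = a x v" using assms by (simp add: on_coords_def)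
  then show ?thesis by (simp add: pull_def)
qed

lemma on_coordsI:
  "(\<And>x v. a (coord_proj J x) (\<lambda>i. coord_proj J (v i)) = a x v) \<Longrightarrow> on_coords J a"
  by (auto simp: on_coords_def pull_def)

lemma on_coords_mono:
  assumes "on_coords K a" "K \<subseteq> J"
  shows "on_coords J a"
proof (rule on_coordsI)
  fix x v
  have "coord_proj K (coord_proj J y) = coord_proj K y" for y :: "real ^ 'a"
    using assms(2) by (simp add: coord_proj_coord_proj inf.absorb1)
  then show "a (coord_proj J x) (\<lambda>i. coord_proj J (v i)) = a x v"
    using on_coords_apply[OF assms(1), of "coord_proj J x" "\<lambda>i. coord_proj J (v i)"]
      on_coords_apply[OF assms(1), of x v] by simp
qed

lemma on_coords_pull_to_simplex:
  assumes "on_coords J a" "j \<in> J" "J - {j} \<subseteq> K" "K \<subseteq> J"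
  shows "on_coords K (pull (to_simplex J j) a)"
proof -
  have "pull (coord_proj K) (pull (to_simplex J j) a) = pull (\<lambda>x. coord_proj J (to_simplex J j x)) a"
    by (simp add: pull_pull[OF affine_map_to_simplex] to_simplex_coord_proj[OF assms(2-4)])
  also have "\<dots> = pull (to_simplex J j) (pull (coord_proj J) a)"
    by (simp add: pull_pull[OF affine_map_coord_proj])
  finally show ?thesis using assms(1) by (simp add: on_coords_def)
qed

lemma on_coords_ext_d:
  assumes "form_deg_le r k a" "on_coords J a"
  shows "on_coords J (ext_d k a)"
  using ext_d_pull[OF assms(1) affine_map_coord_proj, of J] assms(2) by (simp add: on_coords_def)

lemma on_coords_lincomb:
  "on_coords J a \<Longrightarrow> on_coords J b \<Longrightarrow> on_coords J (\<lambda>x v. c * a x v + c' * b x v)"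
  by (intro on_coordsI) (simp add: on_coords_apply)


text \<open>The exterior product of a constant one-form with a form.\<close>

definition wedge1 :: "nat \<Rightarrow> ('a \<Rightarrow> real) \<Rightarrow> 'a::real_vector dform \<Rightarrow> 'a dform" where
  "wedge1 k l a = (\<lambda>x v. \<Sum>i\<le>k. (-1) ^ i * (l (v i) * a x (omit i v)))"

lemma form_deg_le_wedge1:
  assumes a: "form_deg_le r k a" and l: "linear l"
  shows "form_deg_le r (Suc k) (wedge1 k l a)"
  unfolding form_deg_le_def wedge1_def
proof (intro conjI allI)
  fix x
  have lin: "linear (\<lambda>u. l u * c)" for c
    using linear_cmult_real[OF l, of c] by (simp add: mult.commute)
  show "alternating (Suc k) (\<lambda>v. \<Sum>i\<le>k. (-1) ^ i * (l (v i) * a x (omit i v)))"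
    by (rule alternating_alternating_sum[of k "\<lambda>u v. l u * a x v"])
      (auto intro: alternating_cmult form_deg_leD[OF a] lin)
next
  fix v
  show "deg_le r (\<lambda>x. \<Sum>i\<le>k. (-1) ^ i * (l (v i) * a x (omit i v)))"
    by (intro deg_le_sum deg_le_cmult form_deg_leD[OF a])
qed

lemma trace0_wedge1:
  assumes "trace0 k A a"
  shows "trace0 (Suc k) A (wedge1 k l a)"
proof (rule trace0I)
  fix x v assume x: "x \<in> A" and v: "\<And>i. i < Suc k \<Longrightarrow> x + v i \<in> A"
  have "a x (omit i v) = 0" if "i \<le> k" for i
    by (rule trace0D[OF assms x]) (use v in \<open>auto simp: omit_def\<close>)
  then show "wedge1 k l a x v = 0" by (simp add: wedge1_def)
qed

lemma wedge1_eq_0: "(\<And>i. i \<le> k \<Longrightarrow> l (v i) = 0) \<Longrightarrow> wedge1 k l a x v = 0"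
  by (simp add: wedge1_def)

lemma wedge1_vcons:
  assumes "l u = 1" "\<And>i. i < k \<Longrightarrow> l (v i) = 0"
  shows "wedge1 k l a x (vcons u v) = a x v"
proof -
  have "l (vcons u v i) = 0" if "i \<in> {..k} - {0}" for i
    using assms(2)[of "i - 1"] that by (auto simp: vcons_eq)
  then have "wedge1 k l a x (vcons u v) = (\<Sum>i\<in>{0}. (-1) ^ i * (l (vcons u v i) * a x (omit i (vcons u v))))"
    unfolding wedge1_def by (intro sum.mono_neutral_right) auto
  then show ?thesis by (simp add: assms(1) omit_vcons)
qed

lemma on_coords_wedge1:
  assumes "on_coords J a" "\<And>v. l (coord_proj J v) = l v"
  shows "on_coords J (wedge1 k l a)"
  by (rule on_coordsI)
    (simp add: wedge1_def assms(2) omit_comp[of _ "coord_proj J"] on_coords_apply[OF assms(1)])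


lemma deg_le_zero_if_dense:
  assumes f: "deg_le r f" and g: "affine_map g" "g u - g 0 = (1::real)"
    and zero: "\<And>x. g x \<noteq> 0 \<Longrightarrow> f x = 0"
  shows "f x = 0"
proof (cases "g x = 0")
  case True
  have "g (x + t *\<^sub>R u) = t" for t
    using affine_map_plus[OF g(1), of x "t *\<^sub>R u"] g True
      linear_scale[of "\<lambda>x. g x - g 0" t u] by (simp add: affine_map_def)
  then have "f (x + t *\<^sub>R u) = 0" if "0 < t" for t using that zero by simp
  from deg_le_zero_on_line[OF f zero_less_one this, where t = 0] show ?thesis by simp
qed (use zero in blast)

text \<open>The quotients of the values of the form are alternating again because multiplication by a nonconstant
  affine function is injective on polynomials.\<close>

lemma form_divide_affine:
  assumes a: "form_deg_le (Suc r) k a" and g: "affine_map g" "g u - g 0 = 1"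
    and zero: "\<And>x v. g x = 0 \<Longrightarrow> a x v = 0"
  shows "\<exists>b. form_deg_le r k b \<and> a = (\<lambda>x v. g x * b x v)"
proof -
  have "\<exists>q. deg_le r q \<and> (\<forall>x. a x v = g x * q x)" for v
    by (rule deg_le_divide_affine[OF form_deg_leD(2)[OF a] g zero])
  then obtain q where q: "\<And>v. deg_le r (q v)" "\<And>v x. a x v = g x * q v x" by metis
  note alt = form_deg_leD(1)[OF a]
  have "alternating k (\<lambda>v. q v x)" for x
  proof (rule alternatingI)
    show "q v x = q w x" if "\<And>i. i < k \<Longrightarrow> v i = w i" for v w
    proof -
      have "q v y - q w y = 0" if "g y \<noteq> 0" for y
        using alternating_cong[OF alt, of v w y] \<open>\<And>i. i < k \<Longrightarrow> v i = w i\<close> that by (simp add: q(2))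
      from deg_le_zero_if_dense[OF deg_le_diff[OF q(1) q(1)] g this] show ?thesis by simp
    qed
    show "q v x = 0" if "i < j" "j < k" "v i = v j" for v i j
    proof -
      have "q v y = 0" if "g y \<noteq> 0" for y
        using alternating_eq_0[OF alt, of i j v y] \<open>i < j\<close> \<open>j < k\<close> \<open>v i = v j\<close> that by (simp add: q(2))
      from deg_le_zero_if_dense[OF q(1) g this] show ?thesis by simp
    qed
    show "linear (\<lambda>y. q (v(i := y)) x)" if i: "i < k" for v i
    proof (rule linearI)
      fix y z and c :: real
      have "q (v(i := y + z)) w - (q (v(i := y)) w + q (v(i := z)) w) = 0" if "g w \<noteq> 0" for w
      proof -
        have "g w * q (v(i := y + z)) w = g w * (q (v(i := y)) w + q (v(i := z)) w)"
          using alternating_upd_add[OF alt i, of w v y z] by (simp only: q(2) distrib_left)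
        then show ?thesis using that by (simp del: fun_upd_apply)
      qed
      from deg_le_zero_if_dense[OF deg_le_diff[OF q(1) deg_le.add[OF q(1) q(1)]] g this]
      show "q (v(i := y + z)) x = q (v(i := y)) x + q (v(i := z)) x" by (simp del: fun_upd_apply)
      have "q (v(i := c *\<^sub>R y)) w - c * q (v(i := y)) w = 0" if "g w \<noteq> 0" for w
      proof -
        have "g w * q (v(i := c *\<^sub>R y)) w = g w * (c * q (v(i := y)) w)"
          using alternating_upd_scaleR[OF alt i, of w v c y] by (simp only: q(2) mult.left_commute)
        then show ?thesis using that by (simp del: fun_upd_apply)
      qed
      from deg_le_zero_if_dense[OF deg_le_diff[OF q(1) deg_le_cmult[OF q(1)]] g this]
      show "q (v(i := c *\<^sub>R y)) x = c *\<^sub>R q (v(i := y)) x" by (simp del: fun_upd_apply)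
    qed
  qed
  then show ?thesis
    using q by (intro exI[of _ "\<lambda>x v. q v x"]) (simp add: form_deg_le_def fun_eq_iff)
qed

text \<open>In the plane with coordinates \<open>K\<close> the face becomes the standard simplex: its boundary consists of the
  coordinate hyperplanes and of the hyperplane where the eliminated coordinate vanishes.\<close>

lemma eliminate_coord:
  fixes a :: "(real ^ 'm::finite) dform"
  assumes j: "j \<notin> K" and a: "form_deg_le r k a" "on_coords (insert j K) a"
    "\<And>i. i \<in> insert j K \<Longrightarrow> trace0 k (simplex_plane (insert j K) \<inter> coord_plane i) a"
  defines "a1 \<equiv> pull (to_simplex (insert j K) j) a"
  shows "form_deg_le r k a1" "on_coords K a1" "\<And>i. i \<in> K \<Longrightarrow> trace0 k (coord_plane i) a1"
    "trace0 k (simplex_plane K) a1" "trace0 k (simplex_plane (insert j K)) (\<lambda>x v. a1 x v - a x v)"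
proof -
  let ?J = "insert j K"
  show "form_deg_le r k a1"
    unfolding a1_def by (intro form_deg_le_pull a affine_map_to_simplex)
  show "on_coords K a1"
    unfolding a1_def using j by (intro on_coords_pull_to_simplex[OF a(2)]) auto
  show "trace0 k (coord_plane i) a1" if "i \<in> K" for i
    unfolding a1_def
  proof (rule trace0_pull[OF a(3)[of i] affine_map_to_simplex])
    show "to_simplex ?J j x \<in> simplex_plane ?J \<inter> coord_plane i" if "x \<in> coord_plane i" for x
      using to_simplex_in_plane[of j ?J x] to_simplex_nth[of i j ?J x] that \<open>i \<in> K\<close> j
      by (auto simp: coord_plane_def)
  qed (use that in simp)
  show "trace0 k (simplex_plane K) a1"
    unfolding a1_def
  proof (rule trace0_pull[OF a(3)[of j] affine_map_to_simplex])
    show "to_simplex ?J j x \<in> simplex_plane ?J \<inter> coord_plane j" if "x \<in> simplex_plane K" for x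
      using to_simplex_in_plane[of j ?J x] to_simplex_nth_same[OF j, of x] that
      by (auto simp: coord_plane_def simplex_plane_def)
  qed simp
  show "trace0 k (simplex_plane ?J) (\<lambda>x v. a1 x v - a x v)"
    unfolding a1_def by (rule trace0_pull_diff[OF a(1) affine_map_to_simplex to_simplex_id])
qed

text \<open>Eliminate one coordinate \<open>y\<^sub>j\<close> and let \<open>l = 1 - (sum of the others)\<close>, so that \<open>l = y\<^sub>j\<close> on the face.  On
  \<open>l = 0\<close> the form is \<open>dl \<and> c\<close> with \<open>c\<close> a form with vanishing boundary trace on a face of smaller
  dimension, so by induction it is \<open>dl \<and> c' + l b\<close>, which extends as \<open>dy\<^sub>j \<and> c' + y\<^sub>j b\<close>.  The degree is not
  raised; it has to be positive because a constant \<open>a\<close> on a face that is a point extends as \<open>y\<^sub>j a\<close>.\<close>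

lemma extend_from_simplex:
  fixes a :: "(real ^ 'm::finite) dform"
  assumes "form_deg_le (Suc r) k a" "on_coords J a"
    and "\<And>i. i \<in> J \<Longrightarrow> trace0 k (simplex_plane J \<inter> coord_plane i) a"
  shows "\<exists>c. form_deg_le (Suc r) k c \<and> on_coords J c \<and> (\<forall>i\<in>J. trace0 k (coord_plane i) c) \<and>
    trace0 k (simplex_plane J) (\<lambda>x v. c x v - a x v)"
  using finite[of J] assms
proof (induction J arbitrary: k a rule: finite_induct)
  case empty
  have "simplex_plane {} = ({} :: (real ^ 'm) set)" by (simp add: simplex_plane_def coord_sum_def)
  then show ?case using empty.prems by (intro exI[of _ a]) (simp add: trace0_def)
next
  case (insert j K)
  let ?J = "insert j K"
  define a1 where "a1 = pull (to_simplex ?J j) a"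
  define l where "l = (\<lambda>x :: real ^ 'm. 1 - coord_sum K x)"
  have a1: "form_deg_le (Suc r) k a1" and a1_coords: "on_coords K a1"
    and a1_plane: "\<And>i. i \<in> K \<Longrightarrow> trace0 k (coord_plane i) a1"
    and a1_simplex: "trace0 k (simplex_plane K) a1"
    and a1_diff: "trace0 k (simplex_plane ?J) (\<lambda>x v. a1 x v - a x v)"
    using eliminate_coord[OF insert.hyps(2) insert.prems(1,2), folded a1_def] insert.prems(3) by blast+
  have l_affine: "affine_map l"
    unfolding l_def by (intro affine_map_diff affine_map_const affine_map_linear linear_coord_sum)
  have yj: "affine_map (\<lambda>x :: real ^ 'm. x $ j)" by (rule affine_map_linear[OF linear_nth])
  show ?case
  proof (cases "K = {}")
    case True
    have const: "a1 x v = a1 0 (\<lambda>_. 0)" for x v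
    proof -
      have "coord_proj K y = 0" for y :: "real ^ 'm" by (simp add: True coord_proj_def vec_eq_iff)
      then show ?thesis using on_coords_apply[OF a1_coords, of x v] by simp
    qed
    let ?c = "\<lambda>x v. x $ j * a1 x v"
    show ?thesis
    proof (intro exI conjI ballI)
      have "deg_le (Suc r) (\<lambda>x. ?c x v)" for v
        unfolding const[of _ v] by (intro deg_le_affine yj deg_le.const)
      then show "form_deg_le (Suc r) k ?c"
        using form_deg_leD(1)[OF a1] by (auto simp: form_deg_le_def intro: alternating_cmult)
      show "on_coords ?J ?c"
      proof (rule on_coordsI)
        fix x v
        show "?c (coord_proj ?J x) (\<lambda>i. coord_proj ?J (v i)) = ?c x v"
          using const[of "coord_proj ?J x" "\<lambda>i. coord_proj ?J (v i)"] const[of x v]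
          by (simp add: coord_proj_def)
      qed
      show "trace0 k (coord_plane i) ?c" if "i \<in> ?J" for i
        using that True by (intro trace0I) (simp add: coord_plane_def)
      have "trace0 k (simplex_plane ?J) (\<lambda>x v. ?c x v - a1 x v)"
        by (intro trace0I) (simp add: simplex_plane_def coord_sum_def True)
      from trace0_add[OF this a1_diff]
      show "trace0 k (simplex_plane ?J) (\<lambda>x v. ?c x v - a x v)" by simp
    qed
  next
    case False
    then obtain m where m: "m \<in> K" by blast
    define u where "u = (- axis m 1 :: real ^ 'm)"
    have u: "coord_sum K u = -1" using m by (simp add: u_def coord_sum_axis)
    have lu: "l u - l 0 = 1" by (simp add: l_def u)
    have "\<exists>w e. form_deg_le (Suc r) k w \<and> on_coords K w \<and> (\<forall>i\<in>K. trace0 k (coord_plane i) w) \<and>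
        (\<forall>x v. l x = 0 \<longrightarrow> a1 x v = w x v) \<and>
        form_deg_le (Suc r) k e \<and> on_coords ?J e \<and> (\<forall>i\<in>?J. trace0 k (coord_plane i) e) \<and>
        trace0 k (simplex_plane ?J) (\<lambda>x v. e x v - w x v)"
    proof (cases k)
      case 0
      have "l x = 0 \<longrightarrow> a1 x v = 0" for x v
        using trace0D[OF a1_simplex, of x v] 0 by (simp add: l_def simplex_plane_def)
      then show ?thesis
        by (intro exI[of _ "\<lambda>x v. 0"]) (simp add: form_deg_le_zero on_coords_def pull_def trace0_def)
    next
      case (Suc k')
      define c0 where "c0 = (\<lambda>x v. a1 x (vcons u v))"
      have c0: "form_deg_le (Suc r) k' c0"
        unfolding c0_def using a1 Suc by (intro form_deg_le_contract) simp
      have c0_coords: "on_coords K c0"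
      proof (rule on_coordsI)
        fix x v
        have "vcons u (\<lambda>i. coord_proj K (v i)) = (\<lambda>i. coord_proj K (vcons u v i))"
          using coord_proj_axis[OF m, of 1] linear_neg[OF linear_coord_proj, of K "axis m 1"]
          by (auto simp: vcons_def u_def split: nat.split)
        then show "c0 (coord_proj K x) (\<lambda>i. coord_proj K (v i)) = c0 x v"
          by (simp add: c0_def on_coords_apply[OF a1_coords])
      qed
      \<comment> \<open>Any vector transversal to the face may be used for the contraction; for each hyperplane
        there is one that is tangent to it.\<close>
      have c0_trace: "trace0 k' (simplex_plane K \<inter> coord_plane i) c0" if i: "i \<in> K" for i
      proof (rule trace0I)
        fix x v assume x: "x \<in> simplex_plane K \<inter> coord_plane i"
          and v: "\<And>n. n < k' \<Longrightarrow> x + v n \<in> simplex_plane K \<inter> coord_plane i"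
        have "\<exists>m'\<in>K. m' \<noteq> i"
        proof (rule ccontr)
          assume "\<not> (\<exists>m'\<in>K. m' \<noteq> i)"
          then have "K = {i}" using i by blast
          then show False using x by (auto simp: simplex_plane_def coord_plane_def coord_sum_def)
        qed
        then obtain m' where m': "m' \<in> K" "m' \<noteq> i" by blast
        let ?u' = "- axis m' 1 :: real ^ 'm"
        have "a1 x (vcons ?u' v) = 0"
        proof (rule trace0D[OF a1_plane[OF i]])
          show "x + vcons ?u' v n \<in> coord_plane i" if "n < k" for n
            using that v[of "n - 1"] x m'(2) Suc by (auto simp: vcons_eq coord_plane_def axis_def)
        qed (use x in simp)
        moreover have "a1 x (vcons (u - ?u') v) = 0"
        proof (rule trace0D[OF a1_simplex])
          show "x + vcons (u - ?u') v n \<in> simplex_plane K" if "n < k" for n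
            using that v[of "n - 1"] x m'(1) Suc u
            by (auto simp: vcons_eq simplex_plane_def coord_sum_axis)
        qed (use x in simp)
        moreover have "a1 x (vcons (u - ?u') v) = a1 x (vcons u v) - a1 x (vcons ?u' v)"
          using alternating_upd_diff[OF form_deg_leD(1)[OF a1], of 0 x "vcons 0 v" u ?u'] Suc
          by (simp add: vcons_upd_0 del: fun_upd_apply)
        ultimately show "c0 x v = 0" by (simp add: c0_def)
      qed
      obtain c' where c': "form_deg_le (Suc r) k' c'" "on_coords K c'"
        "\<And>i. i \<in> K \<Longrightarrow> trace0 k' (coord_plane i) c'"
        "trace0 k' (simplex_plane K) (\<lambda>x v. c' x v - c0 x v)"
        using insert.IH[OF c0 c0_coords c0_trace] by blast
      define dl where "dl = (\<lambda>v :: real ^ 'm. - coord_sum K v)"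
      have dl: "linear dl" unfolding dl_def by (intro linear_compose_neg linear_coord_sum)
      have dl_u: "dl u = 1" by (simp add: dl_def u)
      define w where "w = wedge1 k' dl c'"
      define e where "e = wedge1 k' (\<lambda>v. v $ j) c'"
      have w: "form_deg_le (Suc r) k w" "form_deg_le (Suc r) k e"
        unfolding w_def e_def Suc by (intro form_deg_le_wedge1 c' dl linear_nth)+
      have "a1 x v = w x v" if "l x = 0" for x v
      proof -
        have x: "x \<in> simplex_plane K" using that by (simp add: l_def simplex_plane_def)
        have tang: "x + y \<in> simplex_plane K" if "dl y = 0" for y
          using that x by (simp add: dl_def simplex_plane_def)
        have "(\<lambda>v. a1 x v - w x v) v = 0"
        proof (rule alternating_zero_if_hyperplane[of k' _ dl u])
          show "alternating (Suc k') (\<lambda>v. a1 x v - w x v)"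
            using form_deg_leD(1)[OF a1] form_deg_leD(1)[OF w(1)] by (simp add: Suc alternating_diff)
          show "a1 x v - w x v = 0" if "\<And>i. i < Suc k' \<Longrightarrow> dl (v i) = 0" for v
            using trace0D[OF a1_simplex x, of v] that tang wedge1_eq_0[of k' dl v c' x]
            by (simp add: Suc w_def)
          show "a1 x (vcons u v) - w x (vcons u v) = 0" if "\<And>i. i < k' \<Longrightarrow> dl (v i) = 0" for v
            using trace0D[OF c'(4) x, of v] that tang wedge1_vcons[of dl u k' v c' x] dl_u
            by (simp add: w_def c0_def)
        qed (use dl dl_u in auto)
        then show ?thesis by simp
      qed
      moreover have "on_coords K w" "on_coords ?J e"
        unfolding w_def e_def
        using c'(2) on_coords_mono[OF c'(2), of ?J]
        by (auto intro!: on_coords_wedge1 simp: dl_def coord_sum_coord_proj) (simp add: coord_proj_def)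
      moreover have "trace0 k (coord_plane i) w" "trace0 k (coord_plane i) e" if "i \<in> K" for i
        unfolding w_def e_def Suc using c'(3)[OF that] by (auto intro: trace0_wedge1)
      moreover have "trace0 k (coord_plane j) e"
        unfolding e_def Suc by (intro trace0I wedge1_eq_0) (auto simp: coord_plane_def less_Suc_eq_le)
      moreover have "trace0 k (simplex_plane ?J) (\<lambda>x v. e x v - w x v)"
      proof (rule trace0I)
        fix x v assume x: "x \<in> simplex_plane ?J" and v: "\<And>i. i < k \<Longrightarrow> x + v i \<in> simplex_plane ?J"
        have "v i $ j = dl (v i)" if "i \<le> k'" for i
          using x v[of i] that Suc
          by (simp add: simplex_plane_def coord_sum_insert[OF insert.hyps(2)] dl_def)
        then show "e x v - w x v = 0" by (simp add: e_def w_def wedge1_def)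
      qed
      ultimately show ?thesis using w by (intro exI[of _ w] exI[of _ e]) auto
    qed
    then obtain w e where w: "form_deg_le (Suc r) k w" "on_coords K w"
      "\<And>i. i \<in> K \<Longrightarrow> trace0 k (coord_plane i) w" "\<And>x v. l x = 0 \<Longrightarrow> a1 x v = w x v"
      and e: "form_deg_le (Suc r) k e" "on_coords ?J e" "\<And>i. i \<in> ?J \<Longrightarrow> trace0 k (coord_plane i) e"
      and ew: "trace0 k (simplex_plane ?J) (\<lambda>x v. e x v - w x v)" by blast
    obtain b where b: "form_deg_le r k b" "(\<lambda>x v. a1 x v - w x v) = (\<lambda>x v. l x * b x v)"
      using form_divide_affine[OF form_deg_le_diff[OF a1 w(1)] l_affine lu] w(4) by auto
    have b_eq: "a1 x v - w x v = l x * b x v" for x v using b(2) by meson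
    have b_coords: "on_coords ?J b"
    proof (rule on_coords_mono[OF on_coordsI, where K = K])
      fix x v
      let ?P = "coord_proj K"
      have l_proj: "l (?P y) = l y" for y by (simp add: l_def coord_sum_coord_proj)
      have "deg_le r (\<lambda>y. b (?P y) (\<lambda>i. ?P (v i)) - b y v)"
        by (intro deg_le_diff form_deg_leD(2)[OF b(1)]
            deg_le_comp_affine[OF form_deg_leD(2)[OF b(1)] affine_map_coord_proj])
      moreover have "b (?P y) (\<lambda>i. ?P (v i)) - b y v = 0" if "l y \<noteq> 0" for y
        using b_eq[of "?P y" "\<lambda>i. ?P (v i)"] b_eq[of y v] that
        by (simp add: l_proj on_coords_apply[OF a1_coords] on_coords_apply[OF w(2)])
      ultimately have "b (?P x) (\<lambda>i. ?P (v i)) - b x v = 0"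
        by (rule deg_le_zero_if_dense[OF _ l_affine lu])
      then show "b (?P x) (\<lambda>i. ?P (v i)) = b x v" by simp
    qed auto
    have b_trace: "trace0 k (coord_plane i) b" if i: "i \<in> K" for i
    proof (rule trace0I)
      fix x v assume x: "x \<in> coord_plane i" and v: "\<And>n. n < k \<Longrightarrow> x + v n \<in> coord_plane i"
      have zero: "b y v = 0" if "y \<in> coord_plane i" "l y \<noteq> 0" for y
      proof -
        have "y + v n \<in> coord_plane i" if "n < k" for n
          using v[OF that] x \<open>y \<in> coord_plane i\<close> by (simp add: coord_plane_def)
        then have "a1 y v = 0" "w y v = 0"
          using trace0D[OF a1_plane[OF i] \<open>y \<in> coord_plane i\<close>]
            trace0D[OF w(3)[OF i] \<open>y \<in> coord_plane i\<close>] by blast+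
        then show ?thesis using b_eq[of y v] that(2) by simp
      qed
      show "b x v = 0"
      proof (cases "l x = 0")
        case True
        have "b (x + t *\<^sub>R (- x)) v = 0" if "0 < t" for t
          using that True x by (intro zero) (auto simp: coord_plane_def l_def algebra_simps)
        from deg_le_zero_on_line[OF form_deg_leD(2)[OF b(1)] zero_less_one this, where t = 0]
        show ?thesis by simp
      qed (use zero x in blast)
    qed
    let ?c = "\<lambda>x v. x $ j * b x v + e x v"
    show ?thesis
    proof (intro exI conjI ballI)
      have "form_deg_le (Suc r) k (\<lambda>x v. x $ j * b x v)"
        unfolding form_deg_le_def
        by (intro conjI allI alternating_cmult deg_le_affine[OF yj] form_deg_leD[OF b(1)])
      from form_deg_le_add[OF this e(1)] show "form_deg_le (Suc r) k ?c" .
      show "on_coords ?J ?c"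
        by (rule on_coordsI)
          (simp add: on_coords_apply[OF b_coords] on_coords_apply[OF e(2)], simp add: coord_proj_def)
      show "trace0 k (coord_plane i) ?c" if i: "i \<in> ?J" for i
      proof (rule trace0_add[OF _ e(3)[OF i]])
        show "trace0 k (coord_plane i) (\<lambda>x v. x $ j * b x v)"
          using i b_trace by (cases "i = j") (auto simp: trace0_def coord_plane_def)
      qed
      have "trace0 k (simplex_plane ?J) (\<lambda>x v. x $ j * b x v - (a1 x v - w x v))"
      proof (rule trace0I)
        fix x v assume "x \<in> simplex_plane ?J"
        then have "x $ j = l x"
          by (simp add: l_def simplex_plane_def coord_sum_insert[OF insert.hyps(2)])
        then show "x $ j * b x v - (a1 x v - w x v) = 0" by (simp add: b_eq)
      qed
      from trace0_add[OF trace0_add[OF this ew] a1_diff]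
      show "trace0 k (simplex_plane ?J) (\<lambda>x v. ?c x v - a x v)" by (simp add: algebra_simps)
    qed
  qed
qed

lemma closed_formD: "closed_form k a \<Longrightarrow> ext_d k a x v = 0"
  by (simp add: closed_form_def)

lemma closed_form_lincomb:
  assumes "form_deg_le r k a" "form_deg_le s k b" "closed_form k a" "closed_form k b"
  shows "closed_form k (\<lambda>x v. c * a x v + c' * b x v)"
  using assms(3,4) unfolding closed_form_def by (simp add: ext_d_lincomb[OF assms(1,2)])

lemma closed_form_pull:
  "form_deg_le r k a \<Longrightarrow> affine_map f \<Longrightarrow> closed_form k a \<Longrightarrow> closed_form k (pull f a)"
  unfolding closed_form_def by (simp add: ext_d_pull) (simp add: pull_def)

lemma closed_form_ext_d: "form_deg_le r k a \<Longrightarrow> closed_form (Suc k) (ext_d k a)"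
  by (simp add: closed_form_def ext_d_ext_d)

lemma closed_0_form_const:
  fixes a :: "'a::euclidean_space dform"
  assumes a: "form_deg_le r 0 a" and closed: "closed_form 0 a"
  shows "a x v = a y w"
proof -
  have "dir_deriv (\<lambda>z. a z v) z u = 0" for z u
  proof -
    have "omit 0 (vcons u v) = v" by (rule omit_vcons)
    then show ?thesis using closed_formD[OF closed, of z "vcons u v"] by (simp add: ext_d_def)
  qed
  then have "((\<lambda>z. a z v) has_derivative (\<lambda>_. 0)) (at z)" for z
    using deg_le_frechet[OF form_deg_leD(2)[OF a, of v], of z] by (metis ext)
  then have "a x v = a y v"
    using has_derivative_zero_unique[of UNIV "\<lambda>z. a z v" x y] by simp
  then show ?thesis using alternating_cong[OF form_deg_leD(1)[OF a], of v w y] by simp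
qed

text \<open>The radial operator respects coordinate subspaces: these are cones with apex \<open>0\<close>.\<close>

lemma on_coords_radial:
  assumes "on_coords J a"
  shows "on_coords J (homotopy_op (\<lambda>x. 0) a)"
proof (rule on_coordsI)
  fix x v
  note l = linear_scale[OF linear_coord_proj]
  have "homotopy_integrand (\<lambda>x. 0) a (coord_proj J x) (\<lambda>i. coord_proj J (v i)) t =
      homotopy_integrand (\<lambda>x. 0) a x v t" for t
  proof -
    have "vcons (coord_proj J x) (\<lambda>i. t *\<^sub>R coord_proj J (v i)) =
        (\<lambda>i. coord_proj J (vcons x (\<lambda>i. t *\<^sub>R v i) i))"
      by (auto simp: vcons_def l split: nat.split)
    then show ?thesis
      using on_coords_apply[OF assms, of "t *\<^sub>R x" "vcons x (\<lambda>i. t *\<^sub>R v i)"]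
      by (simp add: homotopy_integrand_def moved_def l)
  qed
  then show "homotopy_op (\<lambda>x. 0) a (coord_proj J x) (\<lambda>i. coord_proj J (v i)) = homotopy_op (\<lambda>x. 0) a x v"
    unfolding homotopy_op_def by (metis ext)
qed

lemma trace0_radial:
  assumes "trace0 (Suc k) (coord_plane i) a"
  shows "trace0 k (coord_plane i) (homotopy_op (\<lambda>x. 0) a)"
proof (rule trace0I)
  fix x v assume x: "x \<in> coord_plane i" and v: "\<And>n. n < k \<Longrightarrow> x + v n \<in> coord_plane i"
  have "homotopy_integrand (\<lambda>x. 0) a x v t = 0" for t
    unfolding homotopy_integrand_def
  proof (rule trace0D[OF assms])
    show "0 + t *\<^sub>R (x - 0) + vcons (x - 0) (moved (\<lambda>x. 0) v t) n \<in> coord_plane i" if "n < Suc k" for n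
      using x v[of "n - 1"] that by (auto simp: coord_plane_def vcons_eq moved_def)
  qed (use x in \<open>simp add: coord_plane_def\<close>)
  then have "homotopy_integrand (\<lambda>x. 0) a x v = (\<lambda>t. 0)" by blast
  then show "homotopy_op (\<lambda>x. 0) a x v = 0" by (simp add: homotopy_op_def)
qed

lemma ext_d_radial:
  fixes a :: "'a::euclidean_space dform"
  assumes a: "form_deg_le r (Suc k) a" and closed: "closed_form (Suc k) a"
  shows "ext_d k (homotopy_op (\<lambda>x. 0) a) = a"
proof -
  have "pull (\<lambda>x. 0) a x v = 0" for x :: 'a and v
    using linear_0[OF alternating_linear[OF form_deg_leD(1)[OF a], of 0 0 "\<lambda>_. 0"]]
    by (simp add: pull_def fun_upd_idem)
  then show ?thesis
    using ext_d_homotopy_op[OF a affine_map_const] closed by (simp add: closed_form_def)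
qed

text \<open>Eliminate one coordinate.  The radial primitive \<open>b\<close> in the remaining coordinates \<open>K\<close> has zero traces on
  all faces through the origin.  Its trace on the last face is closed, so by induction it can be
  corrected by a closed form; the corrected primitive extends by \<open>extend_from_simplex\<close>, and the
  derivative of the extension is the form that is wanted.  In top degree there is one obstruction, the
  integral over the face.  It appears at the end of the induction as the value at a point, and is stated
  as the linear dependence of any two forms modulo those that extend.\<close>

lemma closed_extension_from_simplex:
  fixes a a' :: "(real ^ 'm::finite) dform"
  assumes "k < card J"
    and "form_deg_le r k a" "on_coords J a" "closed_form k a"
      "\<And>i. i \<in> J \<Longrightarrow> trace0 k (simplex_plane J \<inter> coord_plane i) a"
    and "form_deg_le r k a'" "on_coords J a'" "closed_form k a'"
      "\<And>i. i \<in> J \<Longrightarrow> trace0 k (simplex_plane J \<inter> coord_plane i) a'"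
  shows "\<exists>c c' \<delta>. (c \<noteq> 0 \<or> c' \<noteq> 0) \<and> (Suc k < card J \<longrightarrow> c = 1 \<and> c' = 0) \<and>
    form_deg_le r k \<delta> \<and> closed_form k \<delta> \<and> on_coords J \<delta> \<and> (\<forall>i\<in>J. trace0 k (coord_plane i) \<delta>) \<and>
    trace0 k (simplex_plane J) (\<lambda>x v. c * a x v + c' * a' x v - \<delta> x v)"
  using finite[of J] assms
proof (induction J arbitrary: k r a a' rule: finite_induct)
  case empty
  then show ?case by simp
next
  case (insert j K)
  let ?J = "insert j K"
  note prems = insert.prems
  show ?case
  proof (cases k)
    case 0
    have const: "a x v = a 0 (\<lambda>_. 0)" "a' x v = a' 0 (\<lambda>_. 0)" for x v
      using closed_0_form_const prems(2,4,6,8) unfolding 0 by blast+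
    have "\<exists>c c'. (c \<noteq> 0 \<or> c' \<noteq> 0) \<and> (Suc k < card ?J \<longrightarrow> c = 1 \<and> c' = 0) \<and>
        c * a 0 (\<lambda>_. 0) + c' * a' 0 (\<lambda>_. 0) = 0"
    proof (cases "a 0 (\<lambda>_. 0) = 0")
      case True
      then show ?thesis by - (rule exI[of _ 1], rule exI[of _ 0], simp)
    next
      case False
      have "K = {}"
      proof (rule ccontr)
        assume "K \<noteq> {}"
        then obtain m where m: "m \<in> K" by blast
        have "axis m 1 \<in> simplex_plane ?J \<inter> coord_plane j"
          using m insert.hyps(2) by (auto simp: simplex_plane_def coord_plane_def coord_sum_axis)
          (auto simp: axis_def)
        from trace0D[OF prems(5)[of j] this] have "a (axis m 1) (\<lambda>_. 0) = 0" by (simp add: 0)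
        then show False using const(1)[of "axis m 1" "\<lambda>_. 0"] False by simp
      qed
      show ?thesis
        by (rule exI[of _ "- a' 0 (\<lambda>_. 0)"], rule exI[of _ "a 0 (\<lambda>_. 0)"])
          (use False \<open>K = {}\<close> in \<open>simp add: mult.commute\<close>)
    qed
    then obtain c c' where c: "c \<noteq> 0 \<or> c' \<noteq> 0" "Suc k < card ?J \<longrightarrow> c = 1 \<and> c' = 0"
      "c * a 0 (\<lambda>_. 0) + c' * a' 0 (\<lambda>_. 0) = 0" by blast
    have "c * a x v + c' * a' x v = 0" for x v using c(3) const[of x v] by simp
    then have "trace0 k (simplex_plane ?J) (\<lambda>x v. c * a x v + c' * a' x v - 0)"
      by (simp add: trace0_def)
    with c(1,2) show ?thesis
      by - (rule exI[of _ c], rule exI[of _ c'], rule exI[of _ "\<lambda>x v. 0"],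
        auto simp: form_deg_le_zero closed_form_def ext_d_def dir_deriv_const on_coords_def pull_def trace0_def)
  next
    case (Suc k')
    define red where "red = (\<lambda>a :: (real ^ 'm) dform. pull (to_simplex ?J j) a)"
    define prim where "prim = (\<lambda>a :: (real ^ 'm) dform. homotopy_op (\<lambda>x. 0) (red a))"
    have card: "card ?J = Suc (card K)" using insert.hyps by simp
    then have "K \<noteq> {}" using prems(1) Suc by auto
    then obtain m where m: "m \<in> K" by blast
    define face where "face = (\<lambda>b :: (real ^ 'm) dform. pull (to_simplex K m) b)"
    have facts: "form_deg_le r k (red a)" "trace0 k (simplex_plane ?J) (\<lambda>x v. red a x v - a x v)"
        "form_deg_le (Suc r) k' (prim a)" "on_coords K (prim a)"
        "\<And>i. i \<in> K \<Longrightarrow> trace0 k' (coord_plane i) (prim a)"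
        "ext_d k' (prim a) = red a"
        "form_deg_le (Suc r) k' (face (prim a))" "on_coords K (face (prim a))" "closed_form k' (face (prim a))"
        "\<And>i. i \<in> K \<Longrightarrow> trace0 k' (simplex_plane K \<inter> coord_plane i) (face (prim a))"
        "trace0 k' (simplex_plane K) (\<lambda>x v. face (prim a) x v - prim a x v)"
      if a: "form_deg_le r k a" "on_coords ?J a" "closed_form k a"
        "\<And>i. i \<in> ?J \<Longrightarrow> trace0 k (simplex_plane ?J \<inter> coord_plane i) a" for a
    proof -
      have red': "form_deg_le r k (red a)" and red_coords: "on_coords K (red a)"
        and red_plane: "\<And>i. i \<in> K \<Longrightarrow> trace0 k (coord_plane i) (red a)"
        and red_simplex: "trace0 k (simplex_plane K) (red a)"
        and red_diff: "trace0 k (simplex_plane ?J) (\<lambda>x v. red a x v - a x v)"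
        using eliminate_coord[OF insert.hyps(2) a(1,2)] a(4) unfolding red_def by blast+
      show red: "form_deg_le r k (red a)" by (rule red')
      have red_closed: "closed_form k (red a)"
        unfolding red_def by (intro closed_form_pull[OF a(1)] affine_map_to_simplex a(3))
      show "trace0 k (simplex_plane ?J) (\<lambda>x v. red a x v - a x v)" by (rule red_diff)
      show prim: "form_deg_le (Suc r) k' (prim a)"
        unfolding prim_def using red Suc by (intro form_deg_le_homotopy_op affine_map_const) simp
      show prim_coords: "on_coords K (prim a)"
        unfolding prim_def by (rule on_coords_radial[OF red_coords])
      show prim_plane: "trace0 k' (coord_plane i) (prim a)" if "i \<in> K" for i
        unfolding prim_def using red_plane[OF that] Suc by (intro trace0_radial) simp
      show d_prim: "ext_d k' (prim a) = red a"
        unfolding prim_def using red red_closed Suc by (intro ext_d_radial) auto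
      show "form_deg_le (Suc r) k' (face (prim a))"
        unfolding face_def by (intro form_deg_le_pull prim affine_map_to_simplex)
      show "on_coords K (face (prim a))"
        unfolding face_def using m by (intro on_coords_pull_to_simplex[OF prim_coords]) auto
      show "closed_form k' (face (prim a))"
        unfolding closed_form_def face_def ext_d_pull[OF prim affine_map_to_simplex] d_prim
      proof (intro ext)
        fix x v
        show "pull (to_simplex K m) (red a) x v = 0"
          unfolding pull_def
        proof (rule trace0D[OF red_simplex])
          show "to_simplex K m x + (to_simplex K m (v i) - to_simplex K m 0) \<in> simplex_plane K" for i
            using to_simplex_in_plane[OF m, of "x + v i"] affine_map_plus[OF affine_map_to_simplex, of K m x "v i"]
            by simp
        qed (rule to_simplex_in_plane[OF m])
      qed
      show "trace0 k' (simplex_plane K \<inter> coord_plane i) (face (prim a))" if "i \<in> K" for i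
        unfolding face_def
        by (rule trace0_pull[OF prim_plane[OF that] affine_map_to_simplex]) (simp add: to_simplex_id)
      show "trace0 k' (simplex_plane K) (\<lambda>x v. face (prim a) x v - prim a x v)"
        unfolding face_def by (rule trace0_pull_diff[OF prim affine_map_to_simplex to_simplex_id])
    qed
    note fa = facts[OF prems(2-5)] and fa' = facts[OF prems(6-9)]
    have "k' < card K" using prems(1) card Suc by simp
    from insert.IH[OF this fa(7-10) fa'(7-10)] obtain c c' \<delta>' where
      c: "c \<noteq> 0 \<or> c' \<noteq> 0" "Suc k' < card K \<longrightarrow> c = 1 \<and> c' = 0" and
      \<delta>': "form_deg_le (Suc r) k' \<delta>'" "closed_form k' \<delta>'" "on_coords K \<delta>'"
        "\<And>i. i \<in> K \<Longrightarrow> trace0 k' (coord_plane i) \<delta>'"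
        "trace0 k' (simplex_plane K) (\<lambda>x v. c * face (prim a) x v + c' * face (prim a') x v - \<delta>' x v)"
      by blast
    define P where "P = (\<lambda>x v. c * prim a x v + c' * prim a' x v)"
    define \<beta>1 where "\<beta>1 = (\<lambda>x v. P x v - \<delta>' x v)"
    have P: "form_deg_le (Suc r) k' P"
      unfolding P_def by (intro form_deg_le_add form_deg_le_cmult fa(3) fa'(3))
    have \<beta>1: "form_deg_le (Suc r) k' \<beta>1"
      unfolding \<beta>1_def by (intro form_deg_le_diff P \<delta>')
    have "on_coords K P" unfolding P_def by (rule on_coords_lincomb[OF fa(4) fa'(4)])
    from on_coords_lincomb[OF this \<delta>'(3), of 1 "-1"]
    have "on_coords K \<beta>1" by (simp add: \<beta>1_def)
    then have \<beta>1_coords: "on_coords ?J \<beta>1" by (rule on_coords_mono) auto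
    have \<beta>1_plane: "trace0 k' (coord_plane i) \<beta>1" if "i \<in> K" for i
      unfolding \<beta>1_def P_def using fa(5) fa'(5) \<delta>'(4) that by (intro trace0_diff trace0_lincomb)
    have "trace0 k' (simplex_plane K) (\<lambda>x v. (c * face (prim a) x v + c' * face (prim a') x v - \<delta>' x v) -
        (c * (face (prim a) x v - prim a x v) + c' * (face (prim a') x v - prim a' x v)))"
      by (intro trace0_diff[OF \<delta>'(5)] trace0_lincomb fa(11) fa'(11))
    then have \<beta>1_simplex: "trace0 k' (simplex_plane K) \<beta>1"
      by (simp add: \<beta>1_def P_def algebra_simps)
    have "trace0 k' (simplex_plane ?J \<inter> coord_plane i) \<beta>1" if "i \<in> ?J" for i
    proof (cases "i = j")
      case True
      show ?thesis
        by (rule trace0_mono[OF \<beta>1_simplex])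
          (auto simp: True simplex_plane_def coord_plane_def coord_sum_insert[OF insert.hyps(2)])
    next
      case False
      then show ?thesis using that by (intro trace0_mono[OF \<beta>1_plane]) auto
    qed
    from extend_from_simplex[OF \<beta>1 \<beta>1_coords this] obtain \<beta> where
      \<beta>: "form_deg_le (Suc r) k' \<beta>" "on_coords ?J \<beta>" "\<And>i. i \<in> ?J \<Longrightarrow> trace0 k' (coord_plane i) \<beta>"
        "trace0 k' (simplex_plane ?J) (\<lambda>x v. \<beta> x v - \<beta>1 x v)" by blast
    have X: "ext_d k' (prim a) = red a" by (rule fa(6))
    have X': "ext_d k' (prim a') = red a'" by (rule fa'(6))
    have "ext_d k' \<beta>1 = (\<lambda>x v. c * red a x v + c' * red a' x v)"
      using ext_d_lincomb[OF fa(3) fa'(3), of c c'] unfolding \<beta>1_def ext_d_diff[OF P \<delta>'(1)]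
      by (simp add: X X' closed_formD[OF \<delta>'(2)] flip: P_def)
    with trace0_ext_d[OF form_deg_le_diff[OF \<beta>(1) \<beta>1] affine_simplex_plane \<beta>(4)]
    have "trace0 k (simplex_plane ?J) (\<lambda>x v. ext_d k' \<beta> x v - (c * red a x v + c' * red a' x v))"
      by (simp add: ext_d_diff[OF \<beta>(1) \<beta>1] Suc)
    from trace0_add[OF this trace0_lincomb[OF fa(2) fa'(2), of c c']]
    have "trace0 k (simplex_plane ?J) (\<lambda>x v. ext_d k' \<beta> x v - (c * a x v + c' * a' x v))"
      by (simp add: algebra_simps)
    then have "trace0 k (simplex_plane ?J) (\<lambda>x v. c * a x v + c' * a' x v - ext_d k' \<beta> x v)"
      by (auto simp: trace0_def)
    moreover have "form_deg_le r k (ext_d k' \<beta>)" using form_deg_le_ext_d[OF \<beta>(1)] Suc by simp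
    moreover have "closed_form k (ext_d k' \<beta>)" unfolding Suc by (rule closed_form_ext_d[OF \<beta>(1)])
    moreover have "on_coords ?J (ext_d k' \<beta>)" by (rule on_coords_ext_d[OF \<beta>(1,2)])
    moreover have "\<forall>i\<in>?J. trace0 k (coord_plane i) (ext_d k' \<beta>)"
      unfolding Suc by (intro ballI trace0_ext_d[OF \<beta>(1) affine_coord_plane] \<beta>(3))
    moreover have "Suc k < card ?J \<longrightarrow> c = 1 \<and> c' = 0" using c(2) card Suc by simp
    ultimately show ?thesis using c(1) by blast
  qed
qed

section \<open>Smooth bump functions\<close>

text \<open>The factors \<open>t\<^sup>-\<^sup>m\<close> make the family closed under differentiation, up to linear combinations.\<close>

definition flat :: "nat \<Rightarrow> real \<Rightarrow> real" where
  "flat m t = (if t \<le> 0 then 0 else exp (- inverse t) * inverse t ^ m)"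

lemma flat_le: "\<bar>flat m t\<bar> \<le> real (Suc m) ^ Suc m * \<bar>t\<bar>"
proof (cases "t \<le> 0")
  case False
  then have t: "t > 0" by simp
  let ?n = "Suc m"
  have "(inverse t / ?n) ^ ?n \<le> (1 + inverse t / ?n) ^ ?n"
    using t by (intro power_mono) auto
  also have "\<dots> \<le> exp (inverse t)"
    using t by (intro exp_ge_one_plus_x_over_n_power_n) (auto intro: order_trans[of _ 0])
  finally have "exp (- inverse t) * (inverse t / ?n) ^ ?n \<le> exp (- inverse t) * exp (inverse t)"
    by (intro mult_left_mono) auto
  then have "exp (- inverse t) * (inverse t / ?n) ^ ?n \<le> 1"
    by (simp only: exp_add[symmetric]) simp
  then have "exp (- inverse t) * inverse t ^ ?n \<le> real ?n ^ ?n"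
    by (simp add: power_divide divide_le_eq del: power_Suc of_nat_Suc)
  then have "exp (- inverse t) * inverse t ^ ?n * t \<le> real ?n ^ ?n * t"
    using t by (intro mult_right_mono) auto
  moreover have "inverse t ^ ?n * t = inverse t ^ m" using t by simp
  ultimately have "exp (- inverse t) * inverse t ^ m \<le> real ?n ^ ?n * t" by (simp only: mult.assoc)
  then show ?thesis using t by (simp add: flat_def del: of_nat_Suc power_Suc)
next
  case True
  have "0 \<le> real (Suc m) ^ Suc m * \<bar>t\<bar>" by (intro mult_nonneg_nonneg) auto
  then show ?thesis using True by (simp only: flat_def if_True abs_zero)
qed

lemma flat_has_derivative:
  "(flat m has_real_derivative (flat (m + 2) t - real m * flat (m + 1) t)) (at t)"
proof -
  consider "t < 0" | "t > 0" | "t = 0" by linarith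
  then show ?thesis
  proof cases
    case 1
    have "((\<lambda>t. 0) has_real_derivative 0) (at t)" by simp
    then have "(flat m has_real_derivative 0) (at t)"
      by (rule has_field_derivative_transform_within_open[of _ _ _ "{..<0}"]) (use 1 in \<open>auto simp: flat_def\<close>)
    then show ?thesis using 1 by (simp add: flat_def)
  next
    case 2
    have "((\<lambda>t. exp (- inverse t) * inverse t ^ m) has_real_derivative
        exp (- inverse t) * inverse t ^ (m + 2) - real m * (exp (- inverse t) * inverse t ^ (m + 1))) (at t)"
      using 2 by (auto intro!: derivative_eq_intros simp: power_Suc2 power_add power2_eq_square)
        (cases m; simp add: field_simps power2_eq_square)
    then have "(flat m has_real_derivative
        exp (- inverse t) * inverse t ^ (m + 2) - real m * (exp (- inverse t) * inverse t ^ (m + 1))) (at t)"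
      by (rule has_field_derivative_transform_within_open[of _ _ _ "{0<..}"]) (use 2 in \<open>auto simp: flat_def\<close>)
    then show ?thesis using 2 by (simp add: flat_def)
  next
    case 3
    have eq: "(flat m h - flat m 0) / (h - 0) = flat (Suc m) h" for h
      by (simp add: flat_def divide_inverse)
    have "(flat (Suc m) \<longlongrightarrow> 0) (at 0)"
    proof (rule Lim_null_comparison)
      show "\<forall>\<^sub>F h in at 0. norm (flat (Suc m) h) \<le> real (Suc (Suc m)) ^ Suc (Suc m) * \<bar>h\<bar>"
        by (rule always_eventually) (use flat_le[of "Suc m"] in simp)
      show "((\<lambda>h. real (Suc (Suc m)) ^ Suc (Suc m) * \<bar>h\<bar>) \<longlongrightarrow> 0) (at 0)"
        by (auto intro!: tendsto_eq_intros)
    qed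
    then have "(flat m has_real_derivative 0) (at 0)"
      unfolding has_field_derivative_iff eq .
    then show ?thesis using 3 by (simp add: flat_def)
  qed
qed

text \<open>This class is closed under partial derivatives as well, so that its members are smooth.\<close>

inductive bump_fun :: "'a::euclidean_space \<Rightarrow> real \<Rightarrow> ('a \<Rightarrow> real) \<Rightarrow> bool" for c R where
  base: "deg_le r g \<Longrightarrow> bump_fun c R (\<lambda>x. g x * flat m (R\<^sup>2 - (x - c) \<bullet> (x - c)))"
| add: "bump_fun c R f \<Longrightarrow> bump_fun c R g \<Longrightarrow> bump_fun c R (\<lambda>x. f x + g x)"

lemma bump_fun_mult:
  assumes "bump_fun c R f" "deg_le r h"
  shows "bump_fun c R (\<lambda>x. h x * f x)"
  using assms(1)
proof (induction rule: bump_fun.induct)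
  case (base s g m)
  from bump_fun.base[OF deg_le_mult[OF assms(2) base], of c R m] show ?case by (simp add: mult.assoc)
next
  case (add f g)
  from bump_fun.add[OF add.IH] show ?case by (simp add: distrib_left)
qed

lemma bump_fun_cmult: "bump_fun c R f \<Longrightarrow> bump_fun c R (\<lambda>x. b * f x)"
  by (rule bump_fun_mult[OF _ deg_le.const[of 0]])

lemma bump_fun_sum:
  "(\<And>i. i \<in> I \<Longrightarrow> bump_fun c R (f i)) \<Longrightarrow> bump_fun c R (\<lambda>x. \<Sum>i\<in>I. f i x)"
proof (induction I rule: infinite_finite_induct)
  case (insert i I)
  then show ?case by (simp add: bump_fun.add)
qed (use bump_fun.base[OF deg_le.const[of 0 0], of c R 0] in simp_all)

lemma bump_profile_has_derivative:
  "((\<lambda>x. flat m (R\<^sup>2 - (x - c) \<bullet> (x - c))) has_derivative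
    (\<lambda>u. (flat (m + 2) (R\<^sup>2 - (x - c) \<bullet> (x - c)) - real m * flat (m + 1) (R\<^sup>2 - (x - c) \<bullet> (x - c)))
       * (- 2 * ((x - c) \<bullet> u)))) (at x)"
proof -
  have q: "((\<lambda>x. R\<^sup>2 - (x - c) \<bullet> (x - c)) has_derivative (\<lambda>u. - 2 * ((x - c) \<bullet> u))) (at x)"
    by (auto intro!: derivative_eq_intros simp: inner_commute)
  from has_derivative_compose[OF q flat_has_derivative[unfolded has_field_derivative_def]]
  show ?thesis by simp
qed

lemma bump_fun_has_derivative:
  assumes "bump_fun c R f"
  shows "\<exists>f'. (\<forall>x. (f has_derivative f' x) (at x)) \<and> (\<forall>u. bump_fun c R (\<lambda>x. f' x u))"
  using assms
proof (induction rule: bump_fun.induct)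
  case (base r g m)
  let ?q = "\<lambda>x. R\<^sup>2 - (x - c) \<bullet> (x - c)"
  let ?p' = "\<lambda>x u. (flat (m + 2) (?q x) - real m * flat (m + 1) (?q x)) * (- 2 * ((x - c) \<bullet> u))"
  let ?f' = "\<lambda>x u. g x * ?p' x u + dir_deriv g x u * flat m (?q x)"
  have "((\<lambda>x. g x * flat m (?q x)) has_derivative ?f' x) (at x)" for x
    by (rule has_derivative_mult[OF deg_le_frechet[OF base] bump_profile_has_derivative])
  moreover have "bump_fun c R (\<lambda>x. ?f' x u)" for u
  proof -
    have lin: "deg_le 1 (\<lambda>x. (x - c) \<bullet> u)"
      by (intro deg_le_affine_inner affine_map_diff affine_map_id affine_map_const)
    note gl = deg_le_mult[OF base lin]
    have "bump_fun c R (\<lambda>x. ((-2) * (g x * ((x - c) \<bullet> u))) * flat (m + 2) (?q x) +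
        ((2 * real m) * (g x * ((x - c) \<bullet> u))) * flat (m + 1) (?q x) + dir_deriv g x u * flat m (?q x))"
      by (rule bump_fun.add[OF bump_fun.add[OF bump_fun.base[OF deg_le_cmult[OF gl]]
            bump_fun.base[OF deg_le_cmult[OF gl]]] bump_fun.base[OF deg_le_dir_deriv[OF base]]])
    then show ?thesis by (simp add: algebra_simps)
  qed
  ultimately show ?case by (intro exI[of _ ?f']) blast
next
  case (add f g)
  then obtain f' g' where "\<forall>x. (f has_derivative f' x) (at x)" "\<forall>u. bump_fun c R (\<lambda>x. f' x u)"
    "\<forall>x. (g has_derivative g' x) (at x)" "\<forall>u. bump_fun c R (\<lambda>x. g' x u)" by blast
  then show ?case
    by (intro exI[of _ "\<lambda>x u. f' x u + g' x u"]) (auto intro: bump_fun.add has_derivative_add)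
qed

lemma bump_fun_frechet:
  assumes "bump_fun c R f"
  shows "(f has_derivative dir_deriv f x) (at x)" "bump_fun c R (\<lambda>x. dir_deriv f x u)"
proof -
  obtain f' where f': "\<And>x. (f has_derivative f' x) (at x)" "\<And>u. bump_fun c R (\<lambda>x. f' x u)"
    using bump_fun_has_derivative[OF assms] by blast
  have "dir_deriv f x = f' x" for x using frechet_derivative_at[OF f'(1)] by simp
  then show "(f has_derivative dir_deriv f x) (at x)" "bump_fun c R (\<lambda>x. dir_deriv f x u)"
    using f' by simp_all
qed

lemma bump_fun_continuous: "bump_fun c R f \<Longrightarrow> continuous_on A f"
  by (meson bump_fun_frechet(1) continuous_at_imp_continuous_on has_derivative_continuous)

lemma bump_fun_Ck: "bump_fun c R f \<Longrightarrow> Ck_function m f"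
proof (induction m arbitrary: f)
  case 0
  then show ?case by (simp add: bump_fun_continuous)
next
  case (Suc m)
  then show ?case using bump_fun_has_derivative[OF Suc.prems] by auto
qed

lemma bump_fun_eq_0: "bump_fun c R f \<Longrightarrow> x \<notin> cball c R \<Longrightarrow> R > 0 \<Longrightarrow> f x = 0"
proof (induction rule: bump_fun.induct)
  case (base r g m)
  have "R\<^sup>2 \<le> (x - c) \<bullet> (x - c)"
    using base.prems by (simp add: dot_square_norm dist_norm norm_minus_commute power_mono)
  then show ?case by (simp add: flat_def)
qed auto

lemma bump_fun_test: "bump_fun c R f \<Longrightarrow> R > 0 \<Longrightarrow> cball c R \<subseteq> U \<Longrightarrow> f \<in> test_functions U"
  unfolding test_functions_def mem_Collect_eq
  by (intro conjI allI exI[of _ "cball c R"] impI bump_fun_Ck bump_fun_eq_0 compact_cball)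

lemma has_real_derivative_along:
  fixes f :: "'a::real_normed_vector \<Rightarrow> real"
  assumes "(f has_derivative f') (at (x + s *\<^sub>R u))"
  shows "((\<lambda>t. f (x + t *\<^sub>R u)) has_real_derivative f' u) (at s)"
proof -
  have "((\<lambda>t. x + t *\<^sub>R u) has_derivative (\<lambda>h. h *\<^sub>R u)) (at s)"
    by (auto intro!: derivative_eq_intros)
  from has_derivative_compose[OF this assms]
  have "((\<lambda>t. f (x + t *\<^sub>R u)) has_derivative (\<lambda>h. f' (h *\<^sub>R u))) (at s)" .
  moreover have "(\<lambda>h. f' (h *\<^sub>R u)) = (*) (f' u)"
    by (simp add: fun_eq_iff linear_scale[OF has_derivative_linear[OF assms]] mult.commute)
  ultimately show ?thesis by (simp add: has_field_derivative_def)
qed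

lemma bump_fun_lipschitz:
  assumes f: "bump_fun c R f" and R: "R > 0"
  shows "\<exists>L. \<forall>x t. \<bar>f (x + t *\<^sub>R u) - f x\<bar> \<le> L * \<bar>t\<bar>"
proof -
  have "compact ((\<lambda>x. dir_deriv f x u) ` cball c R)"
    by (intro compact_continuous_image bump_fun_continuous[OF bump_fun_frechet(2)[OF f]] compact_cball)
  from compact_imp_bounded[OF this] obtain L where L: "\<And>x. x \<in> cball c R \<Longrightarrow> \<bar>dir_deriv f x u\<bar> \<le> L"
    unfolding bounded_iff by (auto simp del: mem_cball)
  have L0: "\<bar>dir_deriv f x u\<bar> \<le> \<bar>L\<bar>" for x
    using L[of x] bump_fun_eq_0[OF bump_fun_frechet(2)[OF f], of x u] R by (cases "x \<in> cball c R") auto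
  have "\<bar>f (x + t *\<^sub>R u) - f x\<bar> \<le> \<bar>L\<bar> * \<bar>t\<bar>" for x t
  proof -
    have "((\<lambda>t. f (x + t *\<^sub>R u)) has_real_derivative dir_deriv f (x + s *\<^sub>R u) u) (at s)" for s
      by (rule has_real_derivative_along[OF bump_fun_frechet(1)[OF f]])
    then have "norm (f (x + t *\<^sub>R u) - f (x + 0 *\<^sub>R u)) \<le> \<bar>L\<bar> * norm (t - 0)"
      using L0 by (intro field_differentiable_bound[of UNIV "\<lambda>t. f (x + t *\<^sub>R u)"
          "\<lambda>s. dir_deriv f (x + s *\<^sub>R u) u"]) auto
    then show ?thesis by simp
  qed
  then show ?thesis by blast
qed

section \<open>Integrals of directional derivatives\<close>

lemma integral_translate:
  fixes g :: "'a::euclidean_space \<Rightarrow> real"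
  assumes "integrable lborel g"
  shows "integrable lborel (\<lambda>x. g (x + c))" "integral\<^sup>L lborel (\<lambda>x. g (x + c)) = integral\<^sup>L lborel g"
proof -
  have "(\<lambda>x. x + c) = (+) c" by (simp add: fun_eq_iff add.commute)
  then have d: "distr lborel borel (\<lambda>x. x + c) = lborel" using lborel_distr_plus[of c] by simp
  have m: "g \<in> borel_measurable borel" using borel_measurable_integrable[OF assms] by simp
  have s: "(\<lambda>x. x + c) \<in> measurable lborel borel" by simp
  show "integrable lborel (\<lambda>x. g (x + c))"
    using integrable_distr_eq[OF s m] assms unfolding d by simp
  show "integral\<^sup>L lborel (\<lambda>x. g (x + c)) = integral\<^sup>L lborel g"
    using integral_distr[OF s m] unfolding d by simp
qed

text \<open>Difference quotients have integral zero by translation invariance; the Lipschitz bound allows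
  to pass to the limit.\<close>

lemma integral_dir_deriv_eq_0:
  fixes g g' :: "'a::euclidean_space \<Rightarrow> real"
  assumes int: "integrable lborel g"
    and lip: "\<And>x t. \<bar>g (x + t *\<^sub>R u) - g x\<bar> \<le> L * \<bar>t\<bar>"
    and supp: "\<And>x. x \<notin> cball 0 B \<Longrightarrow> g x = 0"
    and meas: "g' \<in> borel_measurable lebesgue"
    and deriv: "AE x in lebesgue. ((\<lambda>t. g (x + t *\<^sub>R u)) has_real_derivative g' x) (at 0)"
  shows "integrable lebesgue g'" "integral\<^sup>L lebesgue g' = 0"
proof -
  define h where "h = (\<lambda>n. inverse (real (Suc n)))"
  define s where "s = (\<lambda>n x. (g (x + h n *\<^sub>R u) - g x) / h n)"
  have h: "0 < h n" "h n \<le> 1" for n by (auto simp: h_def field_simps)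
  have L: "0 \<le> L" using lip[of 0 1] by (smt (verit) mult_cancel_left2)
  have int_s: "integrable lborel (s n)" for n
    unfolding s_def by (intro integrable_divide Bochner_Integration.integrable_diff integral_translate int)
  have int0: "integral\<^sup>L lebesgue (s n) = 0" for n
  proof -
    have "integral\<^sup>L lebesgue (s n) = integral\<^sup>L lborel (s n)"
      by (rule integral_completion) (use borel_measurable_integrable[OF int_s] in simp)
    also have "\<dots> = 0"
      unfolding s_def
      by (simp add: Bochner_Integration.integral_diff[OF integral_translate(1)[OF int] int] integral_translate(2)[OF int])
    finally show ?thesis .
  qed
  have s_meas: "s n \<in> borel_measurable lebesgue" for n
    using borel_measurable_integrable[OF int_s] by (rule measurable_completion)
  have w: "integrable lebesgue (\<lambda>x. L * indicator (cball (0::'a) (B + norm u)) x)"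
    using lmeasurable_cball lmeasurable_iff_integrable by (intro integrable_mult_right) blast
  have lim: "AE x in lebesgue. (\<lambda>n. s n x) \<longlonglongrightarrow> g' x"
    using deriv
  proof (rule AE_mp, intro AE_I2 impI)
    fix x assume "((\<lambda>t. g (x + t *\<^sub>R u)) has_real_derivative g' x) (at 0)"
    then have "((\<lambda>t. (g (x + t *\<^sub>R u) - g x) / t) \<longlongrightarrow> g' x) (at 0)"
      by (simp add: has_field_derivative_iff)
    moreover have "filterlim h (at 0) sequentially"
      unfolding filterlim_at h_def using LIMSEQ_inverse_real_of_nat by (auto simp: eventually_sequentially)
    ultimately show "(\<lambda>n. s n x) \<longlonglongrightarrow> g' x"
      unfolding s_def by (rule filterlim_compose)
  qed
  have bound: "AE x in lebesgue. norm (s n x) \<le> L * indicator (cball 0 (B + norm u)) x" for n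
  proof (intro AE_I2)
    fix x
    show "norm (s n x) \<le> L * indicator (cball 0 (B + norm u)) x"
    proof (cases "x \<in> cball 0 (B + norm u)")
      case True
      then show ?thesis using lip[of x "h n"] h[of n] by (simp add: s_def divide_le_eq)
    next
      case False
      have "norm (h n *\<^sub>R u) \<le> norm u" using h[of n] by (simp add: mult_left_le_one_le)
      moreover have "norm x \<le> norm (x + h n *\<^sub>R u) + norm (h n *\<^sub>R u)"
        using norm_triangle_ineq4[of "x + h n *\<^sub>R u" "h n *\<^sub>R u"] by simp
      moreover have "norm x > B + norm u" using False by simp
      ultimately have "norm x > B" "norm (x + h n *\<^sub>R u) > B"
        using norm_ge_zero[of u] by linarith+
      then have "x \<notin> cball 0 B" "x + h n *\<^sub>R u \<notin> cball 0 B" by auto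
      then show ?thesis using supp L by (simp add: s_def)
    qed
  qed
  show "integrable lebesgue g'"
    by (rule integrable_dominated_convergence[OF meas s_meas w lim bound])
  have "(\<lambda>n. integral\<^sup>L lebesgue (s n)) \<longlonglongrightarrow> integral\<^sup>L lebesgue g'"
    by (rule integral_dominated_convergence[OF meas s_meas w lim bound])
  then show "integral\<^sup>L lebesgue g' = 0" by (simp add: int0 LIMSEQ_const_iff)
qed

definition half_integral :: "('a::euclidean_space \<Rightarrow> real) \<Rightarrow> ('a \<Rightarrow> real) \<Rightarrow> real" where
  "half_integral l f = integral\<^sup>L lebesgue (\<lambda>x. if l x > 0 then f x else 0)"

lemma affine_map_borel:
  fixes l :: "'a::euclidean_space \<Rightarrow> real"
  assumes "affine_map l"
  shows "l \<in> borel_measurable borel"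
  using has_derivative_continuous[OF affine_map_has_derivative[OF assms]]
  by (intro borel_measurable_continuous_onI continuous_at_imp_continuous_on) blast

lemma bump_fun_integrable:
  fixes l :: "'a::euclidean_space \<Rightarrow> real"
  assumes f: "bump_fun c R f" "R > 0" and l: "affine_map l"
  shows "integrable lborel (\<lambda>x. if l x > 0 then f x else 0)"
    "integrable lebesgue (\<lambda>x. if l x > 0 then f x else 0)"
proof -
  have m: "f \<in> borel_measurable lborel"
    using bump_fun_continuous[OF f(1), of UNIV] by (simp add: borel_measurable_continuous_onI)
  have lm: "l \<in> borel_measurable lborel" using affine_map_borel[OF l] by simp
  have "integrable lborel (\<lambda>x. indicator (cball c R) x *\<^sub>R f x)"
    by (intro borel_integrable_compact compact_cball bump_fun_continuous[OF f(1)])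
  then have "integrable lborel f"
    by (rule Bochner_Integration.integrable_cong[THEN iffD1, rotated 2])
      (use bump_fun_eq_0[OF f(1)] f(2) in \<open>auto simp: indicator_def\<close>)
  then show int: "integrable lborel (\<lambda>x. if l x > 0 then f x else 0)"
    by (rule Bochner_Integration.integrable_bound) (use m lm in auto)
  then show "integrable lebesgue (\<lambda>x. if l x > 0 then f x else 0)"
    using integrable_completion[OF borel_measurable_integrable[OF int]] by simp
qed

lemma half_integral_add:
  assumes "bump_fun c R f" "bump_fun c R g" "R > 0" "affine_map l"
  shows "half_integral l (\<lambda>x. f x + g x) = half_integral l f + half_integral l g"
  unfolding half_integral_def
  by (subst Bochner_Integration.integral_add[symmetric])
    (use bump_fun_integrable(2) assms in \<open>auto intro!: Bochner_Integration.integral_cong\<close>)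

lemma half_integral_cmult: "half_integral l (\<lambda>x. c * f x) = c * half_integral l f"
proof -
  have "(\<lambda>x. if l x > 0 then c * f x else 0) = (\<lambda>x. c * (if l x > 0 then f x else 0))" by auto
  then show ?thesis by (simp add: half_integral_def)
qed

lemma half_integral_sum:
  assumes "\<And>i. i \<in> I \<Longrightarrow> bump_fun c R (f i)" "finite I" "R > 0" "affine_map l"
  shows "half_integral l (\<lambda>x. \<Sum>i\<in>I. f i x) = (\<Sum>i\<in>I. half_integral l (f i))"
  using assms(2,1)
proof (induction I rule: finite_induct)
  case (insert i I)
  then show ?case
    using half_integral_add[of c R "f i" "\<lambda>x. \<Sum>i\<in>I. f i x" l] assms(3,4) by (simp add: bump_fun_sum)
qed (simp add: half_integral_def)

lemma negligible_affine_zero: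
  fixes l :: "'a::euclidean_space \<Rightarrow> real"
  assumes l: "affine_map l" and pq: "l p \<noteq> l q"
  shows "negligible {x. l x = 0}"
proof -
  have lin: "linear (\<lambda>x. l x - l 0)" using l by (simp add: affine_map_def)
  have adj: "l x - l 0 = x \<bullet> adjoint (\<lambda>x. l x - l 0) 1" for x
    using adjoint_works[OF lin, of x 1] by simp
  have "adjoint (\<lambda>x. l x - l 0) 1 \<noteq> 0" using adj[of p] adj[of q] pq by auto
  moreover have "{x. l x = 0} = {x. adjoint (\<lambda>x. l x - l 0) 1 \<bullet> x = - l 0}"
    using adj by (smt (verit) Collect_cong inner_commute)
  ultimately show ?thesis using negligible_hyperplane[of "adjoint (\<lambda>x. l x - l 0) 1" "- l 0"] by simp
qed

text \<open>On a half space the same holds if \<open>u\<close> is parallel to the boundary, or if the function vanishes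
  on the boundary, so that its extension by zero is Lipschitz continuous along \<open>u\<close>.\<close>

lemma half_integral_dir_deriv:
  fixes l :: "'a::euclidean_space \<Rightarrow> real"
  assumes f: "bump_fun c R f" and R: "R > 0" and l: "affine_map l"
    and u: "l u = l 0 \<or> l u - l 0 = 1 \<and> (\<forall>x. l x = 0 \<longrightarrow> f x = 0)"
  shows "half_integral l (\<lambda>x. dir_deriv f x u) = 0"
proof -
  let ?g = "\<lambda>x. if l x > 0 then f x else 0" and ?g' = "\<lambda>x. if l x > 0 then dir_deriv f x u else 0"
  have lin: "linear (\<lambda>x. l x - l 0)" using l by (simp add: affine_map_def)
  have l_along: "l (x + t *\<^sub>R u) = l x + t * (l u - l 0)" for x t
    using affine_map_plus[OF l, of x "t *\<^sub>R u"] linear_scale[OF lin, of t u] by simp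
  obtain L where L: "\<And>x t. \<bar>f (x + t *\<^sub>R u) - f x\<bar> \<le> L * \<bar>t\<bar>"
    using bump_fun_lipschitz[OF f R] by blast
  have L0: "0 \<le> L" using L[of 0 1] by (smt (verit) mult_cancel_left2)
  have d: "((\<lambda>t. f (x + t *\<^sub>R u)) has_real_derivative dir_deriv f x u) (at 0)" for x
    using has_real_derivative_along[of f "dir_deriv f x" x 0 u] bump_fun_frechet(1)[OF f] by simp
  have lip: "\<bar>?g (x + t *\<^sub>R u) - ?g x\<bar> \<le> L * \<bar>t\<bar>" for x t
  proof (cases "l u = l 0")
    case True
    then show ?thesis using L[of x t] L0 by (simp add: l_along)
  next
    case False
    \<comment> \<open>Move points of the other half space to the boundary.\<close>
    define \<psi> where "\<psi> = (\<lambda>x. x + max 0 (- l x) *\<^sub>R u)"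
    have lu: "l u - l 0 = 1" and zero: "\<And>x. l x = 0 \<Longrightarrow> f x = 0" using u False by auto
    have g: "?g y = f (\<psi> y)" for y
      using zero[of "\<psi> y"] by (auto simp: \<psi>_def l_along lu max_def)
    let ?s = "max t (- l x) - max 0 (- l x)"
    have "\<psi> (x + t *\<^sub>R u) = x + (t + max 0 (- l x - t)) *\<^sub>R u"
    proof -
      have "- (l x + t * 1) = - l x - t" by simp
      then show ?thesis unfolding \<psi>_def l_along lu by (simp add: scaleR_add_left)
    qed
    also have "t + max 0 (- l x - t) = max 0 (- l x) + ?s" by (simp add: max_def)
    finally have "\<psi> (x + t *\<^sub>R u) = \<psi> x + ?s *\<^sub>R u"
      by (simp add: \<psi>_def scaleR_add_left algebra_simps)
    then have "\<bar>?g (x + t *\<^sub>R u) - ?g x\<bar> \<le> L * \<bar>?s\<bar>" using L[of "\<psi> x" ?s] by (simp only: g)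
    also have "\<dots> \<le> L * \<bar>t\<bar>" using L0 by (intro mult_left_mono) (auto simp: max_def)
    finally show ?thesis .
  qed
  have deriv: "AE x in lebesgue. ((\<lambda>t. ?g (x + t *\<^sub>R u)) has_real_derivative ?g' x) (at 0)"
  proof (cases "l u = l 0")
    case True
    then show ?thesis using d by (intro AE_I2) (simp add: l_along)
  next
    case False
    then have lu: "l u - l 0 = 1" using u by auto
    then have "negligible {x. l x = 0}" by (intro negligible_affine_zero[OF l, of u 0]) simp
    then have "AE x in lebesgue. x \<notin> {x. l x = 0}"
      by (intro AE_not_in) (simp add: negligible_iff_null_sets)
    then show ?thesis
    proof (rule AE_mp, intro AE_I2 impI)
      fix x assume "x \<notin> {x. l x = 0}"
      then consider "l x > 0" | "l x < 0" by fastforce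
      then show "((\<lambda>t. ?g (x + t *\<^sub>R u)) has_real_derivative ?g' x) (at 0)"
      proof cases
        case 1
        have "((\<lambda>t. ?g (x + t *\<^sub>R u)) has_real_derivative dir_deriv f x u) (at 0)"
          by (rule has_field_derivative_transform_within_open[OF d, of "{- l x<..}"])
            (use 1 in \<open>auto simp: l_along lu\<close>)
        then show ?thesis using 1 by simp
      next
        case 2
        have "((\<lambda>t. ?g (x + t *\<^sub>R u)) has_real_derivative 0) (at 0)"
          by (rule has_field_derivative_transform_within_open[of "\<lambda>_. 0" _ _ "{..<- l x}"])
            (use 2 in \<open>auto simp: l_along lu\<close>)
        then show ?thesis using 2 by simp
      qed
    qed
  qed
  have "integral\<^sup>L lebesgue ?g' = 0"
  proof (rule integral_dir_deriv_eq_0[OF bump_fun_integrable(1)[OF f R l] lip _ _ deriv])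
    show "?g x = 0" if "x \<notin> cball 0 (norm c + R)" for x
    proof -
      have "x \<notin> cball c R"
        using that norm_triangle_ineq2[of x c] by (auto simp: dist_norm norm_minus_commute)
      then show ?thesis using bump_fun_eq_0[OF f _ R] by simp
    qed
    show "?g' \<in> borel_measurable lebesgue"
      by (rule borel_measurable_integrable[OF bump_fun_integrable(2)[OF bump_fun_frechet(2)[OF f] R l]])
  qed
  then show ?thesis by (simp add: half_integral_def)
qed

lemma dir_deriv_mult_bump:
  assumes "deg_le r h" "bump_fun c R f"
  shows "dir_deriv (\<lambda>x. h x * f x) x u = h x * dir_deriv f x u + dir_deriv h x u * f x"
  by (rule dir_deriv_eqI[OF has_derivative_mult[OF deg_le_frechet[OF assms(1)] bump_fun_frechet(1)[OF assms(2)]]])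

lemma half_integral_by_parts:
  fixes l :: "'a::euclidean_space \<Rightarrow> real"
  assumes h: "deg_le r h" and f: "bump_fun c R f" and R: "R > 0" and l: "affine_map l"
    and u: "l u = l 0 \<or> l u - l 0 = 1 \<and> (\<forall>x. l x = 0 \<longrightarrow> h x = 0)"
  shows "half_integral l (\<lambda>x. h x * dir_deriv f x u) = - half_integral l (\<lambda>x. dir_deriv h x u * f x)"
proof -
  have "half_integral l (\<lambda>x. dir_deriv (\<lambda>x. h x * f x) x u) = 0"
    by (rule half_integral_dir_deriv[OF bump_fun_mult[OF f h] R l]) (use u in auto)
  then show ?thesis
    using half_integral_add[OF bump_fun_mult[OF bump_fun_frechet(2)[OF f] h]
        bump_fun_mult[OF f deg_le_dir_deriv[OF h]] R l, of u u]
    by (simp add: dir_deriv_mult_bump[OF h f])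
qed

text \<open>The boundary term of the integration by parts over a half space is written as an integral over the
  half space: the boundary values of \<open>h\<close>, extended to be constant in the direction \<open>w\<close>, times the
  derivative of the bump function along \<open>w\<close>.\<close>

lemma half_integral_by_parts_boundary:
  fixes l :: "'a::euclidean_space \<Rightarrow> real"
  assumes h: "deg_le r h" and f: "bump_fun c R f" and R: "R > 0" and l: "affine_map l"
    and w: "l w - l 0 = 1"
  shows "half_integral l (\<lambda>x. h x * dir_deriv f x v) =
    (l v - l 0) * half_integral l (\<lambda>x. h (x - l x *\<^sub>R w) * dir_deriv f x w) -
    half_integral l (\<lambda>x. dir_deriv h x v * f x)"
proof -
  define b where "b = l v - l 0"
  define u where "u = v - b *\<^sub>R w"
  have lin: "linear (\<lambda>x. l x - l 0)" using l by (simp add: affine_map_def)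
  have v: "v = u + b *\<^sub>R w" by (simp add: u_def)
  have "l u - l 0 = 0"
    using linear_diff[OF lin, of v "b *\<^sub>R w"] linear_scale[OF lin, of b w] w by (simp add: u_def b_def)
  then have u0: "l u = l 0" by simp
  define h0 where "h0 = (\<lambda>x. h (x - l x *\<^sub>R w))"
  have pr: "affine_map (\<lambda>x. x - l x *\<^sub>R w)"
    by (intro affine_map_diff affine_map_id affine_map_linear_comp[OF l, of "\<lambda>t. t *\<^sub>R w"] linear_scaleR_left)
  have h0: "deg_le r h0" unfolding h0_def by (rule deg_le_comp_affine[OF h pr])
  have h0_w: "dir_deriv h0 x w = 0" for x
  proof -
    have "w - l w *\<^sub>R w - (0 - l 0 *\<^sub>R w) = 0" using w by (simp flip: scaleR_left.diff)
        (simp add: algebra_simps flip: scaleR_left.diff)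
    then show ?thesis
      unfolding h0_def dir_deriv_comp_affine[OF h pr] using linear_0[OF linear_dir_deriv[OF h]] by simp
  qed
  note dh = deg_le_diff[OF h h0]
  note bf = bump_fun_mult[OF bump_fun_frechet(2)[OF f]] and bd = bump_fun_mult[OF f deg_le_dir_deriv[OF h]]
  note df = has_derivative_linear[OF bump_fun_frechet(1)[OF f]]
  note D = linear_dir_deriv[OF h]
  have "half_integral l (\<lambda>x. h x * dir_deriv f x v) =
      half_integral l (\<lambda>x. h x * dir_deriv f x u + b * (h x * dir_deriv f x w))"
    unfolding v by (simp add: linear_add[OF df] linear_scale[OF df] distrib_left mult.left_commute)
  also have "\<dots> = half_integral l (\<lambda>x. h x * dir_deriv f x u) + b * half_integral l (\<lambda>x. h x * dir_deriv f x w)"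
    by (simp add: half_integral_add[OF bf[OF h] bump_fun_cmult[OF bf[OF h]] R l] half_integral_cmult)
  also have "half_integral l (\<lambda>x. h x * dir_deriv f x u) = - half_integral l (\<lambda>x. dir_deriv h x u * f x)"
    by (rule half_integral_by_parts[OF h f R l]) (simp add: u0)
  also have "half_integral l (\<lambda>x. h x * dir_deriv f x w) =
      half_integral l (\<lambda>x. (h x - h0 x) * dir_deriv f x w + h0 x * dir_deriv f x w)"
    by (simp add: algebra_simps)
  also have "\<dots> = half_integral l (\<lambda>x. (h x - h0 x) * dir_deriv f x w) +
      half_integral l (\<lambda>x. h0 x * dir_deriv f x w)"
    by (rule half_integral_add[OF bf[OF dh] bf[OF h0] R l])
  also have "half_integral l (\<lambda>x. (h x - h0 x) * dir_deriv f x w) =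
      - half_integral l (\<lambda>x. dir_deriv (\<lambda>x. h x - h0 x) x w * f x)"
    by (rule half_integral_by_parts[OF dh f R l]) (simp add: w h0_def)
  also have "\<dots> = - half_integral l (\<lambda>x. dir_deriv h x w * f x)"
    by (simp add: dir_deriv_diff[OF h h0] h0_w)
  finally have "half_integral l (\<lambda>x. h x * dir_deriv f x v) = b * half_integral l (\<lambda>x. h0 x * dir_deriv f x w) -
      (half_integral l (\<lambda>x. dir_deriv h x u * f x) + b * half_integral l (\<lambda>x. dir_deriv h x w * f x))"
    by (simp add: algebra_simps)
  also have "half_integral l (\<lambda>x. dir_deriv h x u * f x) + b * half_integral l (\<lambda>x. dir_deriv h x w * f x) =
      half_integral l (\<lambda>x. dir_deriv h x u * f x + b * (dir_deriv h x w * f x))"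
    by (simp add: half_integral_add[OF bd bump_fun_cmult[OF bd] R l] half_integral_cmult)
  also have "\<dots> = half_integral l (\<lambda>x. dir_deriv h x v * f x)"
    unfolding v by (simp add: linear_add[OF D] linear_scale[OF D] algebra_simps)
  finally show ?thesis by (simp add: b_def h0_def)
qed

lemma integral_pos_if_pos_on_open:
  fixes f :: "'a::euclidean_space \<Rightarrow> real"
  assumes int: "integrable lebesgue f" and nonneg: "\<And>x. 0 \<le> f x"
    and U: "open U" "U \<noteq> {}" "\<And>x. x \<in> U \<Longrightarrow> 0 < f x"
  shows "integral\<^sup>L lebesgue f \<noteq> 0"
proof
  assume "integral\<^sup>L lebesgue f = 0"
  then have "AE x in lebesgue. f x = 0"
    using integral_nonneg_eq_0_iff_AE[OF int] nonneg by simp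
  then have "AE x in lebesgue. x \<notin> U" by (rule AE_mp) (use U(3) in \<open>fastforce intro!: AE_I2\<close>)
  then have "U \<in> null_sets lebesgue"
    by (subst (asm) AE_iff_null_sets[symmetric]) (use U(1) in auto)
  then show False using open_not_negligible[OF U(1,2)] by (simp add: negligible_iff_null_sets)
qed

section \<open>Weakly closed piecewise polynomial forms\<close>

lemma omit_in_Pi: "v \<in> {..<Suc k} \<rightarrow> A \<Longrightarrow> i \<le> k \<Longrightarrow> omit i v \<in> {..<k} \<rightarrow> A"
  by (auto simp: omit_def Pi_iff)

text \<open>On the ball \<open>\<omega>\<close> is \<open>q\<close> plus the jump \<open>p - q\<close> on one half space; the contribution of \<open>q\<close> is integrated by
  parts.  In both applications below one side vanishes.\<close>

lemma weak_closed_tested: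
  fixes \<omega> p q :: "'n::finite form" and l :: "real ^ 'n \<Rightarrow> real"
  assumes weak: "weak_ext_deriv k T \<omega> zero_form" and T: "T \<in> sets lebesgue"
    and meas: "\<And>v. v \<in> {..<k} \<rightarrow> Basis \<Longrightarrow> (\<lambda>x. \<omega> x v) \<in> borel_measurable (lebesgue_on T)"
    and p: "form_deg_le r k p" and q: "form_deg_le r k q" and l: "affine_map l"
    and R: "R > 0" and ball: "cball c R \<subseteq> interior T"
    and ae: "AE x in lebesgue_on T. x \<in> cball c R \<longrightarrow> \<omega> x = (if l x > 0 then p x else q x)"
    and f: "bump_fun c R f" and v: "v \<in> {..<Suc k} \<rightarrow> Basis"
  shows "(\<Sum>i\<le>k. (-1) ^ i * half_integral l (\<lambda>x. (p x (omit i v) - q x (omit i v)) * dir_deriv f x (v i))) =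
    half_integral (\<lambda>_. 1) (\<lambda>x. ext_d k q x v * f x)"
proof -
  have one: "affine_map (\<lambda>_ :: real ^ 'n. 1 :: real)" by (rule affine_map_const)
  have ballT: "cball c R \<subseteq> T" using ball interior_subset by blast
  have TS: "T \<inter> space lebesgue \<in> sets lebesgue" using T by simp
  have tested: "(LINT x|lebesgue_on T. \<omega> x (omit i v) * dir_deriv f x (v i)) =
      half_integral l (\<lambda>x. (p x (omit i v) - q x (omit i v)) * dir_deriv f x (v i)) +
      half_integral (\<lambda>_. 1) (\<lambda>x. q x (omit i v) * dir_deriv f x (v i))" if i: "i \<le> k" for i
  proof -
    let ?Df = "\<lambda>x. dir_deriv f x (v i)"
    let ?G = "\<lambda>x. (if l x > 0 then p x else q x) (omit i v) * ?Df x"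
    let ?G1 = "\<lambda>x. if l x > 0 then (p x (omit i v) - q x (omit i v)) * ?Df x else 0"
    let ?G2 = "\<lambda>x. if (1::real) > 0 then q x (omit i v) * ?Df x else 0"
    note Df = bump_fun_frechet(2)[OF f, of "v i"]
    have i1: "integrable lebesgue ?G1"
      by (rule bump_fun_integrable(2)[OF bump_fun_mult[OF Df
            deg_le_diff[OF form_deg_leD(2)[OF p] form_deg_leD(2)[OF q]]] R l])
    have i2: "integrable lebesgue ?G2"
      by (rule bump_fun_integrable(2)[OF bump_fun_mult[OF Df form_deg_leD(2)[OF q]] R one])
    have G: "?G = (\<lambda>x. ?G1 x + ?G2 x)" by (auto simp: algebra_simps)
    have iG: "integrable lebesgue ?G" unfolding G by (rule Bochner_Integration.integrable_add[OF i1 i2])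
    have "?Df \<in> borel_measurable lebesgue"
      by (rule measurable_completion) (simp add: borel_measurable_continuous_onI bump_fun_continuous[OF Df])
    then have mDf: "?Df \<in> borel_measurable (lebesgue_on T)" by (rule measurable_restrict_space1)
    have "(LINT x|lebesgue_on T. \<omega> x (omit i v) * ?Df x) = (LINT x|lebesgue_on T. ?G x)"
    proof (rule integral_cong_AE)
      show "(\<lambda>x. \<omega> x (omit i v) * ?Df x) \<in> borel_measurable (lebesgue_on T)"
        by (intro borel_measurable_times meas omit_in_Pi[OF v i] mDf)
      show "?G \<in> borel_measurable (lebesgue_on T)"
        by (rule measurable_restrict_space1[OF borel_measurable_integrable[OF iG]])
      show "AE x in lebesgue_on T. \<omega> x (omit i v) * ?Df x = ?G x"
        using ae
      proof (rule AE_mp, intro AE_I2 impI)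
        fix x assume *: "x \<in> cball c R \<longrightarrow> \<omega> x = (if l x > 0 then p x else q x)"
        show "\<omega> x (omit i v) * ?Df x = ?G x"
        proof (cases "x \<in> cball c R")
          case False
          then show ?thesis using bump_fun_eq_0[OF Df False R] by simp
        qed (use * in simp)
      qed
    qed
    also have "\<dots> = integral\<^sup>L lebesgue (\<lambda>x. indicator T x *\<^sub>R ?G x)"
      by (rule integral_restrict_space[OF TS])
    also have "\<dots> = integral\<^sup>L lebesgue ?G"
    proof (rule Bochner_Integration.integral_cong[OF refl])
      fix x
      show "indicator T x *\<^sub>R ?G x = ?G x"
      proof (cases "x \<in> T")
        case False
        then have "?Df x = 0" using bump_fun_eq_0[OF Df _ R, of x] ballT by blast
        then show ?thesis by simp
      qed simp
    qed
    also have "\<dots> = integral\<^sup>L lebesgue ?G1 + integral\<^sup>L lebesgue ?G2"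
      unfolding G by (rule Bochner_Integration.integral_add[OF i1 i2])
    finally show ?thesis by (simp add: half_integral_def)
  qed
  have "f \<in> test_functions (interior T)" by (rule bump_fun_test[OF f R ball])
  then have "(\<Sum>i\<le>k. (-1) ^ i * (LINT x|lebesgue_on T. \<omega> x (omit i v) * dir_deriv f x (v i))) = 0"
    using weak v unfolding weak_ext_deriv_def by (fastforce simp: zero_form_def)
  then have "(\<Sum>i\<le>k. (-1) ^ i * half_integral l (\<lambda>x. (p x (omit i v) - q x (omit i v)) * dir_deriv f x (v i))) =
    - (\<Sum>i\<le>k. (-1) ^ i * half_integral (\<lambda>_. 1) (\<lambda>x. q x (omit i v) * dir_deriv f x (v i)))"
    by (simp add: tested distrib_left sum.distrib)
  also have "\<dots> = (\<Sum>i\<le>k. half_integral (\<lambda>_. 1) (\<lambda>x. (-1) ^ i * (dir_deriv (\<lambda>y. q y (omit i v)) x (v i) * f x)))"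
    by (simp add: half_integral_by_parts[OF form_deg_leD(2)[OF q] f R one] half_integral_cmult sum_negf)
  also have "\<dots> = half_integral (\<lambda>_. 1) (\<lambda>x. \<Sum>i\<le>k. (-1) ^ i * (dir_deriv (\<lambda>y. q y (omit i v)) x (v i) * f x))"
    by (rule half_integral_sum[symmetric, OF _ _ R one])
      (auto intro!: bump_fun_cmult bump_fun_mult[OF f] deg_le_dir_deriv form_deg_leD[OF q])
  also have "\<dots> = half_integral (\<lambda>_. 1) (\<lambda>x. ext_d k q x v * f x)"
    by (simp add: ext_d_def sum_distrib_right mult.assoc)
  finally show ?thesis .
qed

lemma deg_le_pos_near:
  fixes h :: "'a::euclidean_space \<Rightarrow> real"
  assumes "deg_le r h" "h c > 0" "R > 0"
  shows "\<exists>R'>0. R' \<le> R \<and> (\<forall>x\<in>cball c R'. h x > 0)"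
proof -
  have "open {x. 0 < h x}"
    by (intro open_Collect_less continuous_intros deg_le_continuous[OF assms(1)])
  then obtain e where e: "e > 0" "cball c e \<subseteq> {x. 0 < h x}"
    using assms(2) open_contains_cball by blast
  then show ?thesis using assms(3) by (intro exI[of _ "min e R"]) (auto simp: subset_iff)
qed

definition bump :: "'a::euclidean_space \<Rightarrow> real \<Rightarrow> 'a \<Rightarrow> real" where
  "bump c R = (\<lambda>x. flat 0 (R\<^sup>2 - (x - c) \<bullet> (x - c)))"

lemma bump_fun_bump: "bump_fun c R (bump c R)"
  using bump_fun.base[OF deg_le.const[of 0 1], of c R 0] by (simp add: bump_def)

lemma dir_deriv_bump: "dir_deriv (bump c R) x u = - 2 * ((x - c) \<bullet> u) * flat 2 (R\<^sup>2 - (x - c) \<bullet> (x - c))"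
  unfolding bump_def by (subst dir_deriv_eqI[OF bump_profile_has_derivative]) (simp add: numeral_2_eq_2)

lemma flat_nonneg: "0 \<le> flat m t"
  by (simp add: flat_def)

lemma flat_pos_on_ball: "x \<in> ball c R \<Longrightarrow> 0 < flat m (R\<^sup>2 - (x - c) \<bullet> (x - c))"
proof -
  assume "x \<in> ball c R"
  then have "(norm (x - c))\<^sup>2 < R\<^sup>2"
    by (intro power_strict_mono) (auto simp: dist_norm norm_minus_commute)
  then show ?thesis by (simp add: flat_def dot_square_norm)
qed

lemma poly_zero_if_tested:
  fixes h :: "'a::euclidean_space \<Rightarrow> real"
  assumes h: "deg_le r h" and R: "R > 0"
    and zero: "\<And>R'. 0 < R' \<Longrightarrow> R' \<le> R \<Longrightarrow> half_integral (\<lambda>_. 1) (\<lambda>x. h x * bump c R' x) = 0"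
  shows "h c = 0"
proof (rule ccontr)
  assume "h c \<noteq> 0"
  define s where "s = sgn (h c)"
  have "s * h c > 0" using \<open>h c \<noteq> 0\<close> by (simp add: s_def sgn_if)
  then obtain R' where R': "R' > 0" "R' \<le> R" "\<And>x. x \<in> cball c R' \<Longrightarrow> s * h x > 0"
    using deg_le_pos_near[OF deg_le_cmult[OF h, of s] _ R, of c] by blast
  have one: "affine_map (\<lambda>_ :: 'a. 1 :: real)" by (rule affine_map_const)
  let ?f = "\<lambda>x. if (1::real) > 0 then s * (h x * bump c R' x) else 0"
  have bf: "bump_fun c R' (\<lambda>x. s * (h x * bump c R' x))"
    by (intro bump_fun_cmult bump_fun_mult[OF bump_fun_bump h])
  have "integral\<^sup>L lebesgue ?f \<noteq> 0"
  proof (rule integral_pos_if_pos_on_open[where U = "ball c R'"])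
    show "integrable lebesgue ?f" by (rule bump_fun_integrable(2)[OF bf R'(1) one])
    show "0 \<le> ?f x" for x
    proof (cases "x \<in> cball c R'")
      case True
      then have "0 \<le> (s * h x) * bump c R' x"
        unfolding bump_def by (rule mult_nonneg_nonneg[OF less_imp_le[OF R'(3)] flat_nonneg])
      then show ?thesis by (simp add: mult.assoc)
    next
      case False
      then show ?thesis using bump_fun_eq_0[OF bump_fun_bump False R'(1)] by simp
    qed
    show "0 < ?f x" if "x \<in> ball c R'" for x
    proof -
      have "0 < (s * h x) * bump c R' x"
        unfolding bump_def by (rule mult_pos_pos[OF R'(3) flat_pos_on_ball]) (use that in auto)
      then show ?thesis by (simp add: mult.assoc)
    qed
  qed (use R'(1) in auto)
  moreover have "integral\<^sup>L lebesgue ?f = half_integral (\<lambda>_. 1) (\<lambda>x. s * (h x * bump c R' x))"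
    by (simp only: half_integral_def)
  moreover have "\<dots> = s * half_integral (\<lambda>_. 1) (\<lambda>x. h x * bump c R' x)" by (rule half_integral_cmult)
  ultimately show False using zero[OF R'(1,2)] by simp
qed

text \<open>Along the gradient \<open>w\<close> of \<open>l\<close> the bump function decreases on the whole half ball \<open>l > 0\<close>, so
  testing with it detects the sign of \<open>h c\<close>.\<close>

lemma poly_zero_if_half_tested:
  fixes h l :: "'a::euclidean_space \<Rightarrow> real"
  assumes h: "deg_le r h" and R: "R > 0" and l: "affine_map l" and lc: "l c = 0"
    and w: "l w - l 0 = 1" "\<And>x. l x = b * ((x - c) \<bullet> w)" "b > 0"
    and zero: "\<And>R'. 0 < R' \<Longrightarrow> R' \<le> R \<Longrightarrow> half_integral l (\<lambda>x. h x * dir_deriv (bump c R') x w) = 0"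
  shows "h c = 0"
proof (rule ccontr)
  assume "h c \<noteq> 0"
  define s where "s = sgn (h c)"
  have "s * h c > 0" using \<open>h c \<noteq> 0\<close> by (simp add: s_def sgn_if)
  then obtain R' where R': "R' > 0" "R' \<le> R" "\<And>x. x \<in> cball c R' \<Longrightarrow> s * h x > 0"
    using deg_le_pos_near[OF deg_le_cmult[OF h, of s] _ R, of c] by blast
  let ?D = "\<lambda>x. dir_deriv (bump c R') x w"
  let ?f = "\<lambda>x. if l x > 0 then (- s) * (h x * ?D x) else 0"
  have D: "bump_fun c R' ?D" by (rule bump_fun_frechet(2)[OF bump_fun_bump])
  have bf: "bump_fun c R' (\<lambda>x. (- s) * (h x * ?D x))"
    by (intro bump_fun_cmult bump_fun_mult[OF D h])
  have D_eq: "- ?D x = 2 / b * l x * flat 2 (R'\<^sup>2 - (x - c) \<bullet> (x - c))" for x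
    using w(3) by (simp add: dir_deriv_bump w(2))
  have f_eq: "(- s) * (h x * ?D x) = (s * h x) * (- ?D x)" for x by simp
  have "integral\<^sup>L lebesgue ?f \<noteq> 0"
  proof (rule integral_pos_if_pos_on_open[where U = "ball c R' \<inter> {x. 0 < l x}"])
    show "integrable lebesgue ?f" by (rule bump_fun_integrable(2)[OF bf R'(1) l])
    show "0 \<le> ?f x" for x
    proof (cases "x \<in> cball c R' \<and> 0 < l x")
      case True
      then have "0 \<le> (s * h x) * (- ?D x)"
        unfolding D_eq using w(3)
        by (intro mult_nonneg_nonneg[OF less_imp_le[OF R'(3)]] mult_nonneg_nonneg[OF _ flat_nonneg]) auto
      then show ?thesis using True unfolding f_eq by simp
    next
      case False
      then show ?thesis using bump_fun_eq_0[OF D _ R'(1), of x] by auto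
    qed
    show "0 < ?f x" if "x \<in> ball c R' \<inter> {x. 0 < l x}" for x
    proof -
      have "0 < (s * h x) * (- ?D x)"
        unfolding D_eq using that w(3)
        by (intro mult_pos_pos[OF R'(3)] mult_pos_pos[OF _ flat_pos_on_ball]) auto
      then show ?thesis using that unfolding f_eq by simp
    qed
    have "continuous_on UNIV l"
      by (metis affine_map_has_derivative[OF l] continuous_at_imp_continuous_on has_derivative_continuous)
    then show "open (ball c R' \<inter> {x. 0 < l x})"
      by (intro open_Int open_ball open_Collect_less continuous_on_const)
    define t where "t = R' / (2 * (norm w + 1))"
    have nw: "norm w + 1 > 0" by (simp add: add_nonneg_pos)
    then have t: "t > 0" using R'(1) by (simp add: t_def)
    have "norm (t *\<^sub>R w) < R'"
    proof -
      have "norm (t *\<^sub>R w) \<le> t * (norm w + 1)" using t by (simp add: mult_left_mono)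
      also have "\<dots> = R' / 2" using nw by (simp add: t_def field_simps)
      finally show ?thesis using R'(1) by simp
    qed
    moreover have "l (c + t *\<^sub>R w) = t"
      using affine_map_plus[OF l, of c "t *\<^sub>R w"] linear_scale[of "\<lambda>x. l x - l 0" t w] l w(1) lc
      by (simp add: affine_map_def)
    ultimately have "c + t *\<^sub>R w \<in> ball c R' \<inter> {x. 0 < l x}" using t by (simp add: dist_norm)
    then show "ball c R' \<inter> {x. 0 < l x} \<noteq> {}" by blast
  qed
  moreover have "integral\<^sup>L lebesgue ?f = half_integral l (\<lambda>x. (- s) * (h x * ?D x))"
    by (simp only: half_integral_def)
  moreover have "\<dots> = (- s) * half_integral l (\<lambda>x. h x * ?D x)" by (rule half_integral_cmult)
  ultimately show False using zero[OF R'(1,2)] by simp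
qed

lemma alternating_zero_if_Basis:
  fixes \<alpha> :: "(nat \<Rightarrow> 'a::euclidean_space) \<Rightarrow> real"
  assumes "alternating k \<alpha>" "\<And>v. v \<in> {..<k} \<rightarrow> Basis \<Longrightarrow> \<alpha> v = 0"
  shows "\<alpha> v = 0"
  by (rule alternating_span_zero[OF assms(1), of Basis]) (use assms(2) in \<open>auto simp: span_Basis\<close>)

lemma closed_at_if_weakly_closed:
  fixes \<omega> p :: "'n::finite form"
  assumes weak: "weak_ext_deriv k T \<omega> zero_form" and T: "T \<in> sets lebesgue"
    and meas: "\<And>v. v \<in> {..<k} \<rightarrow> Basis \<Longrightarrow> (\<lambda>x. \<omega> x v) \<in> borel_measurable (lebesgue_on T)"
    and p: "form_deg_le r k p" and R: "R > 0" and ball: "cball c R \<subseteq> interior T"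
    and ae: "AE x in lebesgue_on T. x \<in> cball c R \<longrightarrow> \<omega> x = p x"
  shows "ext_d k p c v = 0"
proof (rule alternating_zero_if_Basis[where \<alpha> = "ext_d k p c"])
  note dp = form_deg_le_ext_d[OF p]
  show "alternating (Suc k) (ext_d k p c)" by (rule form_deg_leD(1)[OF dp])
  fix v :: "nat \<Rightarrow> real ^ 'n" assume v: "v \<in> {..<Suc k} \<rightarrow> Basis"
  show "ext_d k p c v = 0"
  proof (rule poly_zero_if_tested[OF form_deg_leD(2)[OF dp] R])
    fix R' assume R': "0 < R'" "R' \<le> R"
    have sub: "cball c R' \<subseteq> cball c R" using R' by auto
    have "AE x in lebesgue_on T. x \<in> cball c R' \<longrightarrow> \<omega> x = (if (1::real) > 0 then p x else p x)"
      using ae by (rule AE_mp) (use sub in \<open>auto intro!: AE_I2\<close>)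
    from weak_closed_tested[OF weak T meas p p affine_map_const R'(1) _ this bump_fun_bump v]
    show "half_integral (\<lambda>_. 1) (\<lambda>x. ext_d k p x v * bump c R' x) = 0"
      using sub ball by (auto simp: half_integral_def)
  qed
qed

text \<open>Integration by parts of the jump over the half space leaves \<open>dl \<and> (p - q)\<close> as a boundary term; the
  interior terms vanish because the pieces are closed.\<close>

lemma wedge_jump_zero_if_weakly_closed:
  fixes \<omega> p q :: "'n::finite form" and l :: "real ^ 'n \<Rightarrow> real"
  assumes weak: "weak_ext_deriv k T \<omega> zero_form" and T: "T \<in> sets lebesgue"
    and meas: "\<And>v. v \<in> {..<k} \<rightarrow> Basis \<Longrightarrow> (\<lambda>x. \<omega> x v) \<in> borel_measurable (lebesgue_on T)"
    and p: "form_deg_le r k p" and q: "form_deg_le r k q" and closed: "closed_form k p" "closed_form k q"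
    and l: "affine_map l" "l u - l 0 \<noteq> 0" and lc: "l c = 0"
    and R: "R > 0" and ball: "cball c R \<subseteq> interior T"
    and ae: "AE x in lebesgue_on T. x \<in> cball c R \<longrightarrow> \<omega> x = (if l x > 0 then p x else q x)"
  shows "wedge1 k (\<lambda>v. l v - l 0) (\<lambda>x v. p x v - q x v) c v = 0"
proof -
  let ?l' = "\<lambda>v. l v - l 0" and ?pq = "\<lambda>x v. p x v - q x v"
  have lin: "linear ?l'" using l by (simp add: affine_map_def)
  have pq: "form_deg_le r k ?pq" by (rule form_deg_le_diff[OF p q])
  define a where "a = adjoint ?l' 1"
  have adj: "?l' x = x \<bullet> a" for x using adjoint_works[OF lin, of x 1] by (simp add: a_def)
  have "a \<noteq> 0" using adj[of u] l(2) by auto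
  define w where "w = (1 / (a \<bullet> a)) *\<^sub>R a"
  have w: "l w - l 0 = 1" using \<open>a \<noteq> 0\<close> by (simp add: adj w_def)
  have lw: "l x = (a \<bullet> a) * ((x - c) \<bullet> w)" for x
  proof -
    have "l x = ?l' (x - c)" using linear_diff[OF lin, of x c] lc by simp
    then show ?thesis using \<open>a \<noteq> 0\<close> by (simp add: adj w_def)
  qed
  have pr: "affine_map (\<lambda>x. x - l x *\<^sub>R w)"
    by (intro affine_map_diff affine_map_id affine_map_linear_comp[OF l(1), of "\<lambda>t. t *\<^sub>R w"] linear_scaleR_left)
  have W: "form_deg_le r (Suc k) (wedge1 k ?l' ?pq)" by (rule form_deg_le_wedge1[OF pq lin])
  show ?thesis
  proof (rule alternating_zero_if_Basis[OF form_deg_leD(1)[OF W]])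
    fix v :: "nat \<Rightarrow> real ^ 'n" assume v: "v \<in> {..<Suc k} \<rightarrow> Basis"
    define h where "h = (\<lambda>x. wedge1 k ?l' ?pq (x - l x *\<^sub>R w) v)"
    have h: "deg_le r h" unfolding h_def by (rule deg_le_comp_affine[OF form_deg_leD(2)[OF W] pr])
    have "h c = 0"
    proof (rule poly_zero_if_half_tested[OF h R l(1) lc w lw])
      fix R' assume R': "0 < R'" "R' \<le> R"
      have sub: "cball c R' \<subseteq> cball c R" using R' by auto
      have "AE x in lebesgue_on T. x \<in> cball c R' \<longrightarrow> \<omega> x = (if l x > 0 then p x else q x)"
        using ae by (rule AE_mp) (use sub in \<open>auto intro!: AE_I2\<close>)
      let ?f = "bump c R'"
      note f = bump_fun_bump[of c R']
      let ?h = "\<lambda>i x. p x (omit i v) - q x (omit i v)"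
      have hd: "deg_le r (?h i)" for i by (rule form_deg_leD(2)[OF pq])
      have h0: "deg_le r (\<lambda>x. ?h i (x - l x *\<^sub>R w))" for i by (rule deg_le_comp_affine[OF hd pr])
      have pull_const: "half_integral l (\<lambda>x. (-1) ^ i * (?l' (v i) * ?h i (x - l x *\<^sub>R w)) * dir_deriv ?f x w) =
          (-1) ^ i * (?l' (v i) * half_integral l (\<lambda>x. ?h i (x - l x *\<^sub>R w) * dir_deriv ?f x w))" for i
        by (simp only: mult.assoc half_integral_cmult)
      have "(\<Sum>i\<le>k. (-1) ^ i * half_integral l (\<lambda>x. ?h i x * dir_deriv ?f x (v i))) =
          half_integral (\<lambda>_. 1) (\<lambda>x. ext_d k q x v * ?f x)"
        using sub ball \<open>AE x in lebesgue_on T. x \<in> cball c R' \<longrightarrow> \<omega> x = (if l x > 0 then p x else q x)\<close>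
        by (intro weak_closed_tested[OF weak T meas p q l(1) R'(1) _ _ f v]) auto
      also have "\<dots> = 0" by (simp add: closed_formD[OF closed(2)] half_integral_def)
      also have "(\<Sum>i\<le>k. (-1) ^ i * half_integral l (\<lambda>x. ?h i x * dir_deriv ?f x (v i))) =
          (\<Sum>i\<le>k. half_integral l (\<lambda>x. (-1) ^ i * (?l' (v i) * ?h i (x - l x *\<^sub>R w)) * dir_deriv ?f x w)) -
          (\<Sum>i\<le>k. half_integral l (\<lambda>x. (-1) ^ i * (dir_deriv (?h i) x (v i) * ?f x)))"
        unfolding half_integral_by_parts_boundary[OF hd f R'(1) l(1) w]
        by (simp only: pull_const half_integral_cmult right_diff_distrib[of "(-1) ^ _"] sum_subtractf)
      also have "(\<Sum>i\<le>k. half_integral l (\<lambda>x. (-1) ^ i * (?l' (v i) * ?h i (x - l x *\<^sub>R w)) * dir_deriv ?f x w)) =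
          half_integral l (\<lambda>x. \<Sum>i\<le>k. (-1) ^ i * (?l' (v i) * ?h i (x - l x *\<^sub>R w)) * dir_deriv ?f x w)"
        by (rule half_integral_sum[symmetric, OF _ _ R'(1) l(1)])
          (auto intro!: bump_fun_mult[OF bump_fun_frechet(2)[OF f]] deg_le_cmult h0)
      also have "\<dots> = half_integral l (\<lambda>x. h x * dir_deriv ?f x w)"
        by (simp add: h_def wedge1_def sum_distrib_right)
      also have "(\<Sum>i\<le>k. half_integral l (\<lambda>x. (-1) ^ i * (dir_deriv (?h i) x (v i) * ?f x))) =
          half_integral l (\<lambda>x. \<Sum>i\<le>k. (-1) ^ i * (dir_deriv (?h i) x (v i) * ?f x))"
        by (rule half_integral_sum[symmetric, OF _ _ R'(1) l(1)])
          (auto intro!: bump_fun_cmult bump_fun_mult[OF f] deg_le_dir_deriv hd)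
      also have "\<dots> = half_integral l (\<lambda>x. ext_d k ?pq x v * ?f x)"
        by (simp add: ext_d_def sum_distrib_right mult.assoc)
      also have "\<dots> = 0"
        by (simp add: ext_d_diff[OF p q] closed_formD[OF closed(1)] closed_formD[OF closed(2)] half_integral_def)
      finally show "half_integral l (\<lambda>x. h x * dir_deriv ?f x w) = 0" by simp
    qed (use \<open>a \<noteq> 0\<close> in simp)
    then show "wedge1 k ?l' ?pq c v = 0" by (simp add: h_def lc)
  qed
qed

section \<open>Gluing along coordinate hyperplanes\<close>

text \<open>The hyperplanes are treated one by one.  The error on \<open>y\<^sub>j = 0\<close> is pulled back by the projection to
  this hyperplane and added; since it vanishes on the intersections with the previous hyperplanes, this
  does not change the traces there.\<close>

lemma glue_on_coord_planes:
  fixes F :: "'m::finite \<Rightarrow> (real ^ 'm) dform"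
  assumes F: "\<And>i. form_deg_le r k (F i)" "\<And>i. closed_form k (F i)"
    and compat: "\<And>i j. trace0 k (coord_plane i \<inter> coord_plane j) (\<lambda>x v. F i x v - F j x v)"
  shows "\<exists>\<Omega>. form_deg_le r k \<Omega> \<and> closed_form k \<Omega> \<and>
    (\<forall>i. trace0 k (coord_plane i) (\<lambda>x v. \<Omega> x v - F i x v))"
proof -
  have "\<exists>\<Omega>. form_deg_le r k \<Omega> \<and> closed_form k \<Omega> \<and>
    (\<forall>i\<in>S. trace0 k (coord_plane i) (\<lambda>x v. \<Omega> x v - F i x v))" for S
    using finite[of S]
  proof (induction S rule: finite_induct)
    case empty
    have "closed_form k (\<lambda>x v. 0)" by (simp add: closed_form_def ext_d_def dir_deriv_const)
    then show ?case by (intro exI[of _ "\<lambda>x v. 0"]) (simp add: form_deg_le_zero)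
  next
    case (insert j S)
    then obtain \<Omega> where \<Omega>: "form_deg_le r k \<Omega>" "closed_form k \<Omega>"
      "\<And>i. i \<in> S \<Longrightarrow> trace0 k (coord_plane i) (\<lambda>x v. \<Omega> x v - F i x v)" by blast
    let ?\<pi> = "coord_proj (- {j})"
    define b where "b = (\<lambda>x v. F j x v - \<Omega> x v)"
    have b: "form_deg_le r k b" unfolding b_def by (rule form_deg_le_diff[OF F(1) \<Omega>(1)])
    have b_closed: "closed_form k b"
      using closed_form_lincomb[OF F(1)[of j] \<Omega>(1) F(2) \<Omega>(2), of 1 "-1"] by (simp add: b_def)
    have pb: "form_deg_le r k (pull ?\<pi> b)" "closed_form k (pull ?\<pi> b)"
      by (rule form_deg_le_pull[OF b affine_map_coord_proj],
          rule closed_form_pull[OF b affine_map_coord_proj b_closed])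
    let ?\<Omega>' = "\<lambda>x v. \<Omega> x v + pull ?\<pi> b x v"
    show ?case
    proof (intro exI conjI ballI)
      show "form_deg_le r k ?\<Omega>'" by (rule form_deg_le_add[OF \<Omega>(1) pb(1)])
      show "closed_form k ?\<Omega>'" using closed_form_lincomb[OF \<Omega>(1) pb(1) \<Omega>(2) pb(2), of 1 1] by simp
      show "trace0 k (coord_plane i) (\<lambda>x v. ?\<Omega>' x v - F i x v)" if i: "i \<in> insert j S" for i
      proof (cases "i = j")
        case True
        have "trace0 k (coord_plane j) (\<lambda>x v. pull ?\<pi> b x v - b x v)"
          by (rule trace0_pull_diff[OF b affine_map_coord_proj])
            (auto simp: coord_plane_def coord_proj_def vec_eq_iff)
        then show ?thesis by (simp add: True b_def algebra_simps)
      next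
        case False
        then have iS: "i \<in> S" using i by simp
        have "trace0 k (coord_plane i \<inter> coord_plane j) b"
          using trace0_add[OF compat[of i j] trace0_mono[OF \<Omega>(3)[OF iS] Int_lower1, of "coord_plane j"]]
          by (auto simp: b_def trace0_def)
        then have "trace0 k (coord_plane i) (pull ?\<pi> b)"
          by (rule trace0_pull[OF _ affine_map_coord_proj]) (auto simp: coord_plane_def coord_proj_def)
        from trace0_add[OF \<Omega>(3)[OF iS] this] show ?thesis by (simp add: algebra_simps)
      qed
    qed
  qed
  from this[of UNIV] show ?thesis by simp
qed


section \<open>Barycentric coordinates and the Alfeld split\<close>

text \<open>The vertices are indexed by \<open>'n option\<close>, a type with \<open>n + 1\<close> elements; barycentric coordinates are
  then vectors of a type to which the previous sections apply.\<close>

locale simplex_coords =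
  fixes \<nu> :: "'n::finite option \<Rightarrow> real ^ 'n"
  assumes inj_\<nu>: "inj \<nu>" and indep: "\<not> affine_dependent (range \<nu>)"
begin

definition z :: "real ^ 'n" where
  "z = (1 / real CARD('n option)) *\<^sub>R (\<Sum>i\<in>UNIV. \<nu> i)"

lemma card_V: "card (range \<nu>) = CARD('n option)"
  by (rule card_image[OF inj_\<nu>])

lemma N_pos: "real CARD('n option) > 0"
  by simp

lemma sum_\<nu>: "(\<Sum>i\<in>UNIV. \<nu> i) = real CARD('n option) *\<^sub>R z"
  by (simp add: z_def)

lemma barycenter_V: "barycenter (range \<nu>) = z"
  by (simp add: barycenter_def z_def card_V sum.reindex[OF inj_\<nu>])

lemma coords_unique:
  assumes "(\<Sum>i\<in>UNIV. y $ i) = (\<Sum>i\<in>UNIV. y' $ i)"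
    and "(\<Sum>i\<in>UNIV. y $ i *\<^sub>R \<nu> i) = (\<Sum>i\<in>UNIV. y' $ i *\<^sub>R \<nu> i)"
  shows "y = y'"
proof (rule ccontr)
  assume "y \<noteq> y'"
  then obtain j where j: "y $ j \<noteq> y' $ j" by (auto simp: vec_eq_iff)
  let ?U = "\<lambda>x. y $ (inv \<nu> x) - y' $ (inv \<nu> x)"
  have "sum ?U (range \<nu>) = 0" "(\<Sum>x\<in>range \<nu>. ?U x *\<^sub>R x) = 0"
    using assms by (simp_all add: sum.reindex[OF inj_\<nu>] inv_f_f[OF inj_\<nu>] sum_subtractf scaleR_left_diff_distrib)
  moreover have "\<exists>x\<in>range \<nu>. ?U x \<noteq> 0" using j by (auto simp: inv_f_f[OF inj_\<nu>])
  ultimately have "affine_dependent (range \<nu>)"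
    unfolding affine_dependent_explicit_finite[OF finite_imageI[OF finite]] by blast
  then show False using indep by blast
qed

lemma coords_exist: "\<exists>y :: real ^ 'n option. (\<Sum>i\<in>UNIV. y $ i) = 1 \<and> (\<Sum>i\<in>UNIV. y $ i *\<^sub>R \<nu> i) = x"
proof -
  have "aff_dim (range \<nu>) = int DIM(real ^ 'n)"
    using aff_dim_affine_independent[OF indep] by (simp add: card_V)
  then have "x \<in> affine hull (range \<nu>)" using aff_dim_eq_full by blast
  then obtain u where u: "sum u (range \<nu>) = 1" "(\<Sum>v\<in>range \<nu>. u v *\<^sub>R v) = x"
    unfolding affine_hull_finite[OF finite_imageI[OF finite]] by blast
  then show ?thesis
    by (intro exI[of _ "\<chi> i. u (\<nu> i)"]) (simp add: sum.reindex[OF inj_\<nu>])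
qed

definition bary :: "real ^ 'n \<Rightarrow> real ^ 'n option" where
  "bary x = (THE y. (\<Sum>i\<in>UNIV. y $ i) = 1 \<and> (\<Sum>i\<in>UNIV. y $ i *\<^sub>R \<nu> i) = x)"

lemma bary: "(\<Sum>i\<in>UNIV. bary x $ i) = 1" "(\<Sum>i\<in>UNIV. bary x $ i *\<^sub>R \<nu> i) = x"
proof -
  have "\<exists>!y :: real ^ 'n option. (\<Sum>i\<in>UNIV. y $ i) = 1 \<and> (\<Sum>i\<in>UNIV. y $ i *\<^sub>R \<nu> i) = x"
    using coords_exist coords_unique by (intro ex_ex1I) auto
  from theI'[OF this] show "(\<Sum>i\<in>UNIV. bary x $ i) = 1" "(\<Sum>i\<in>UNIV. bary x $ i *\<^sub>R \<nu> i) = x"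
    by (simp_all add: bary_def)
qed

lemma baryI: "(\<Sum>i\<in>UNIV. y $ i) = 1 \<Longrightarrow> (\<Sum>i\<in>UNIV. y $ i *\<^sub>R \<nu> i) = x \<Longrightarrow> bary x = y"
  by (rule coords_unique) (simp_all add: bary)

lemma affine_map_bary: "affine_map bary"
  unfolding affine_map_def
proof (rule linearI)
  fix x y :: "real ^ 'n" and c :: real
  have "bary (x + y) = bary x + bary y - bary 0"
    by (rule baryI) (simp_all add: sum.distrib sum_subtractf bary scaleR_left_distrib scaleR_left_diff_distrib)
  then show "bary (x + y) - bary 0 = (bary x - bary 0) + (bary y - bary 0)" by simp
  have "bary (c *\<^sub>R x) = bary 0 + c *\<^sub>R (bary x - bary 0)"
    by (rule baryI)
      (simp_all add: sum.distrib sum_subtractf bary scaleR_left_distrib scaleR_left_diff_distrib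
        scaleR_right_diff_distrib right_diff_distrib flip: sum_distrib_left scaleR_scaleR scaleR_right.sum)
  then show "bary (c *\<^sub>R x) - bary 0 = c *\<^sub>R (bary x - bary 0)" by simp
qed

lemma bary_\<nu>: "bary (\<nu> i) = axis i 1"
proof (rule baryI)
  show "(\<Sum>j\<in>UNIV. axis i (1::real) $ j) = 1" by (simp add: axis_def)
  have "axis i 1 $ j *\<^sub>R \<nu> j = (if j = i then \<nu> j else 0)" for j by (simp add: axis_def)
  then show "(\<Sum>j\<in>UNIV. axis i 1 $ j *\<^sub>R \<nu> j) = \<nu> i" by simp
qed

lemma affine_map_bary_nth: "affine_map (\<lambda>x. bary x $ i)"
  by (rule affine_map_linear_comp[OF affine_map_bary linear_nth])

lemma bary_continuous: "continuous_on A bary" "continuous_on A (\<lambda>x. bary x $ i)"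
  by (metis affine_map_has_derivative affine_map_bary continuous_at_imp_continuous_on has_derivative_continuous)
    (metis affine_map_has_derivative affine_map_bary_nth continuous_at_imp_continuous_on has_derivative_continuous)

text \<open>The lift of the split to \<open>\<real>\<^sup>n\<^sup>+\<^sup>1\<close>, with \<open>\<lambda>\<close> for the barycentric coordinates: the graph of the
  piecewise linear function \<open>min\<^sub>j \<lambda>\<^sub>j\<close> lies in the boundary of an orthant.  In coordinates adapted to
  the orthant the cell opposite to the vertex \<open>i\<close> is parametrized by \<open>y = \<lambda> - \<lambda>\<^sub>i e\<close>, in the hyperplane
  \<open>y\<^sub>i = 0\<close>; \<open>base\<close> is the vertical projection from the graph, and \<open>base\<close> followed by \<open>bary\<close> is the
  vertical projection to the hyperplane \<open>(\<Sum>j. y\<^sub>j) = 1\<close> of points at height zero.\<close>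

definition e :: "real ^ 'n option" where
  "e = (\<chi> i. 1)"

definition base :: "real ^ 'n option \<Rightarrow> real ^ 'n" where
  "base y = z + (\<Sum>i\<in>UNIV. y $ i *\<^sub>R (\<nu> i - z))"

definition sheet :: "'n option \<Rightarrow> real ^ 'n \<Rightarrow> real ^ 'n option" where
  "sheet i x = bary x - (bary x $ i) *\<^sub>R e"

lemma e_nth [simp]: "e $ i = 1"
  by (simp add: e_def)

lemma affine_map_base: "affine_map base"
proof -
  have "affine_map (\<lambda>y. (\<Sum>i\<in>UNIV. y $ i *\<^sub>R (\<nu> i - z)) + z)"
    by (intro affine_map_linear_plus linear_compose_sum ballI linear_compose_fun[OF linear_nth] linear_scaleR_left)
  then show ?thesis by (simp add: base_def[abs_def] add.commute)
qed

lemma affine_map_sheet: "affine_map (sheet i)"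
  unfolding sheet_def[abs_def]
  by (intro affine_map_diff affine_map_bary
      affine_map_linear_comp[OF affine_map_bary_nth, of "\<lambda>t. t *\<^sub>R e"] linear_scaleR_left)

lemma base_eq: "base y = (\<Sum>i\<in>UNIV. y $ i *\<^sub>R \<nu> i) + (1 - coord_sum UNIV y) *\<^sub>R z"
  by (simp add: base_def coord_sum_def scaleR_right_diff_distrib sum_subtractf scaleR_left_diff_distrib
      scaleR_left.sum)

lemma bary_base: "bary (base y) = y + ((1 - coord_sum UNIV y) / real CARD('n option)) *\<^sub>R e"
proof (rule baryI)
  let ?m = "(1 - coord_sum UNIV y) / real CARD('n option)"
  show "(\<Sum>i\<in>UNIV. (y + ?m *\<^sub>R e) $ i) = 1"
    by (simp add: sum.distrib coord_sum_def)
  have "(\<Sum>i\<in>UNIV. (y + ?m *\<^sub>R e) $ i *\<^sub>R \<nu> i) = (\<Sum>i\<in>UNIV. y $ i *\<^sub>R \<nu> i) + ?m *\<^sub>R (\<Sum>i\<in>UNIV. \<nu> i)"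
    by (simp add: scaleR_left_distrib sum.distrib scaleR_right.sum)
  also have "\<dots> = base y" by (simp add: sum_\<nu> base_eq)
  finally show "(\<Sum>i\<in>UNIV. (y + ?m *\<^sub>R e) $ i *\<^sub>R \<nu> i) = base y" .
qed

lemma base_add_e: "base (y + c *\<^sub>R e) = base y"
  by (simp add: base_eq coord_sum_def scaleR_left_distrib sum.distrib sum_\<nu> algebra_simps
      flip: scaleR_right.sum)

lemma base_bary: "base (bary x) = x"
  by (simp add: base_eq coord_sum_def bary)

lemma base_sheet: "base (sheet i x) = x"
  using base_add_e[of "bary x" "- (bary x $ i)"] by (simp add: sheet_def base_bary)

lemma sheet_in_plane: "sheet i x \<in> coord_plane i"
  by (simp add: sheet_def coord_plane_def)

lemma coord_sum_bary: "coord_sum UNIV (bary x) = 1"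
  by (simp add: coord_sum_def bary)

lemma hull_V: "convex hull (range \<nu>) = {x. \<forall>i. 0 \<le> bary x $ i}"
proof (intro set_eqI iffI)
  fix x assume "x \<in> convex hull (range \<nu>)"
  then obtain u where u: "\<forall>x\<in>range \<nu>. 0 \<le> u x" "sum u (range \<nu>) = 1" "(\<Sum>v\<in>range \<nu>. u v *\<^sub>R v) = x"
    unfolding convex_hull_finite[OF finite_imageI[OF finite]] by blast
  have "bary x = (\<chi> i. u (\<nu> i))"
    by (rule baryI) (use u in \<open>simp_all add: sum.reindex[OF inj_\<nu>]\<close>)
  then show "x \<in> {x. \<forall>i. 0 \<le> bary x $ i}" using u(1) by simp
next
  fix x assume "x \<in> {x. \<forall>i. 0 \<le> bary x $ i}"
  then have "(\<Sum>i\<in>UNIV. bary x $ i *\<^sub>R \<nu> i) \<in> convex hull (range \<nu>)"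
    by (intro convex_sum[OF _ convex_convex_hull]) (auto simp: bary hull_inc)
  then show "x \<in> convex hull (range \<nu>)" by (simp add: bary)
qed

definition cell :: "'n option \<Rightarrow> (real ^ 'n) set" where
  "cell i = convex hull (insert z (range \<nu> - {\<nu> i}))"

lemma alfeld_split_V: "alfeld_split (range \<nu>) = range cell"
  by (auto simp: alfeld_split_def barycenter_V cell_def)

lemma bary_z: "bary z = (1 / real CARD('n option)) *\<^sub>R e"
  using bary_base[of 0] by (simp add: base_def)

lemma convex_halfspace_bary:
  "convex {x. bary x $ i \<le> bary x $ j}" "convex {x. 0 \<le> bary x $ i}"
proof -
  have comb: "bary (s *\<^sub>R x + t *\<^sub>R y) = s *\<^sub>R bary x + t *\<^sub>R bary y" if "s + t = 1" for s t x y
    by (rule baryI) (use that in \<open>simp_all add: sum.distrib bary scaleR_left_distrib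
        flip: sum_distrib_left scaleR_scaleR scaleR_right.sum\<close>)
  show "convex {x. bary x $ i \<le> bary x $ j}"
    by (rule convexI) (simp add: comb add_mono mult_left_mono)
  show "convex {x. 0 \<le> bary x $ i}" by (rule convexI) (simp add: comb)
qed

lemma cell_eq: "cell i = {x. 0 \<le> bary x $ i \<and> (\<forall>j. bary x $ i \<le> bary x $ j)}"
proof
  have "insert z (range \<nu> - {\<nu> i}) \<subseteq> {x. 0 \<le> bary x $ i \<and> (\<forall>j. bary x $ i \<le> bary x $ j)}"
    using inj_\<nu> by (auto simp: bary_z bary_\<nu> axis_def inj_eq)
  moreover have "convex {x. 0 \<le> bary x $ i \<and> (\<forall>j. bary x $ i \<le> bary x $ j)}"
  proof -
    have "{x. 0 \<le> bary x $ i \<and> (\<forall>j. bary x $ i \<le> bary x $ j)} =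
        {x. 0 \<le> bary x $ i} \<inter> (\<Inter>j. {x. bary x $ i \<le> bary x $ j})" by auto
    then show ?thesis by (simp add: convex_Int convex_INT convex_halfspace_bary)
  qed
  ultimately show "cell i \<subseteq> {x. 0 \<le> bary x $ i \<and> (\<forall>j. bary x $ i \<le> bary x $ j)}"
    unfolding cell_def by (rule hull_minimal)
next
  show "{x. 0 \<le> bary x $ i \<and> (\<forall>j. bary x $ i \<le> bary x $ j)} \<subseteq> cell i"
  proof
    fix x assume x: "x \<in> {x. 0 \<le> bary x $ i \<and> (\<forall>j. bary x $ i \<le> bary x $ j)}"
    let ?N = "real CARD('n option)"
    let ?u = "\<lambda>j. if j = i then ?N * bary x $ i else bary x $ j - bary x $ i"
    let ?p = "\<lambda>j. if j = i then z else \<nu> j"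
    have s: "coord_sum UNIV (sheet i x) = 1 - ?N * bary x $ i"
      by (simp add: sheet_def coord_sum_bary) (simp add: coord_sum_def)
    have u: "?u = (\<lambda>j. (if j = i then ?N * bary x $ i else 0) + sheet i x $ j)"
      by (auto simp: sheet_def)
    have up: "(\<lambda>j. ?u j *\<^sub>R ?p j) = (\<lambda>j. (if j = i then (?N * bary x $ i) *\<^sub>R z else 0) + sheet i x $ j *\<^sub>R \<nu> j)"
      by (auto simp: sheet_def)
    have "(\<Sum>j\<in>UNIV. ?u j) = 1"
      unfolding u sum.distrib using s by (simp add: coord_sum_def)
    moreover have "(\<Sum>j\<in>UNIV. ?u j *\<^sub>R ?p j) = x"
      unfolding up sum.distrib using base_sheet[of i x] s by (simp add: base_eq add.commute)
    moreover have "(\<Sum>j\<in>UNIV. ?u j *\<^sub>R ?p j) \<in> cell i"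
      unfolding cell_def
      by (rule convex_sum[OF finite convex_convex_hull \<open>(\<Sum>j\<in>UNIV. ?u j) = 1\<close>])
        (use x inj_\<nu> in \<open>auto intro!: hull_inc simp: inj_eq\<close>)
    ultimately show "x \<in> cell i" by simp
  qed
qed

end

lemma open_line_segment:
  assumes "open U" "c \<in> U"
  shows "\<exists>\<epsilon>>0. \<forall>t. 0 < t \<longrightarrow> t < \<epsilon> \<longrightarrow> c + t *\<^sub>R (w :: 'a::real_normed_vector) \<in> U"
proof -
  obtain d where d: "d > 0" "ball c d \<subseteq> U" using assms open_contains_ball by blast
  have nw: "norm w + 1 > 0" by (simp add: add_nonneg_pos)
  show ?thesis
  proof (intro exI[of _ "d / (norm w + 1)"] conjI allI impI)
    fix t :: real assume t: "0 < t" "t < d / (norm w + 1)"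
    have "norm (t *\<^sub>R w) \<le> t * (norm w + 1)" using t by (simp add: mult_left_mono)
    also have "\<dots> < d" using t nw by (simp add: less_divide_eq)
    finally show "c + t *\<^sub>R w \<in> U" using d(2) by (auto simp: dist_norm)
  qed (use d nw in simp)
qed

lemma alternating_absorb:
  assumes \<alpha>: "alternating k \<alpha>" and zero: "\<And>w i. i < k \<Longrightarrow> w i = u \<Longrightarrow> \<alpha> w = 0"
  shows "\<alpha> (\<lambda>i. w i + s i *\<^sub>R u) = \<alpha> w"
proof -
  let ?f = "\<lambda>N i. if i < N then w i + s i *\<^sub>R u else w i"
  have "\<alpha> (?f N) = \<alpha> w" if "N \<le> k" for N using that
  proof (induction N)
    case (Suc N)
    have N: "N < k" using Suc.prems by simp
    have "\<alpha> (?f (Suc N)) = \<alpha> ((?f N)(N := w N)) + s N * \<alpha> ((?f N)(N := u))"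
      unfolding fun_upd_below(1) alternating_upd_add[OF \<alpha> N] alternating_upd_scaleR[OF \<alpha> N] ..
    also have "(?f N)(N := w N) = ?f N" by auto
    also have "\<alpha> ((?f N)(N := u)) = 0" by (rule zero[OF N]) simp
    finally show ?case using Suc by simp
  qed simp
  from this[of k] have "\<alpha> (?f k) = \<alpha> w" by simp
  moreover have "\<alpha> (\<lambda>i. w i + s i *\<^sub>R u) = \<alpha> (?f k)" by (rule alternating_cong[OF \<alpha>]) simp
  ultimately show ?thesis by simp
qed

context simplex_coords
begin

section \<open>The pieces of a weakly closed form\<close>

lemma bary_diff_nth_linear: "linear (\<lambda>v. bary v $ i - bary 0 $ i)"
  using affine_map_bary_nth[of i] by (simp add: affine_map_def)

lemma bary_line: "bary (c + t *\<^sub>R (x - c)) $ i = bary c $ i + t * (bary x $ i - bary c $ i)"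
  using affine_map_plus[OF affine_map_bary_nth[of i], of c "t *\<^sub>R (x - c)"]
    linear_scale[OF bary_diff_nth_linear[of i], of t "x - c"]
    linear_diff[OF bary_diff_nth_linear[of i], of x c] by simp

lemma ex_other_vertex: "\<exists>j. j \<noteq> (i :: 'n option)"
proof -
  have "card (UNIV - {i}) = CARD('n)" by (simp add: card_Diff_singleton)
  then show ?thesis by (metis DiffE card_gt_0_iff ex_in_conv finite insertI1 zero_less_card_finite)
qed

lemma ex_min_point:
  assumes "A \<noteq> {}"
  shows "\<exists>x c. c > 0 \<and> (\<forall>m\<in>A. bary x $ m = c) \<and> (\<forall>m. m \<notin> A \<longrightarrow> c < bary x $ m)"
proof -
  let ?N = "real CARD('n option)"
  define y :: "real ^ 'n option" where "y = (\<chi> m. if m \<in> A then 0 else 1 / ?N)"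
  define c where "c = (1 - coord_sum UNIV y) / ?N"
  have "coord_sum UNIV y = (\<Sum>m\<in>UNIV. if m \<in> - A then 1 / ?N else 0)"
    unfolding coord_sum_def y_def by (intro sum.cong) auto
  also have "\<dots> = real (card (- A)) / ?N" by (subst sum.If_cases) (auto simp: Compl_eq)
  also have "\<dots> < 1"
  proof -
    have "card (- A) < CARD('n option)" using assms by (intro psubset_card_mono) auto
    then show ?thesis by simp
  qed
  finally have "c > 0" by (simp add: c_def)
  moreover have "bary (base y) = y + c *\<^sub>R e" by (simp add: bary_base c_def)
  ultimately show ?thesis by (intro exI[of _ "base y"] exI[of _ c]) (simp add: y_def)
qed

lemma ex_face_point: "\<exists>x. bary x $ i = 0 \<and> (\<forall>m. m \<noteq> i \<longrightarrow> 0 < bary x $ m)"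
proof -
  let ?n = "real CARD('n)"
  define y :: "real ^ 'n option" where "y = (\<chi> m. if m = i then 0 else 1 / ?n)"
  have "coord_sum UNIV y = (\<Sum>m\<in>UNIV - {i}. 1 / ?n)"
    unfolding coord_sum_def y_def by (subst sum.remove[of _ i]) (auto intro!: sum.cong)
  also have "\<dots> = 1" by (simp add: card_Diff_singleton)
  finally have "bary (base y) = y" by (simp add: bary_base)
  then show ?thesis by (intro exI[of _ "base y"]) (simp add: y_def)
qed

text \<open>For \<open>i = j\<close> the interior of a cell, otherwise a neighbourhood of the relative interior of the common
  face of two cells that is contained in their union.\<close>

definition joint :: "'n option \<Rightarrow> 'n option \<Rightarrow> (real ^ 'n) set" where
  "joint i j = {x. 0 < bary x $ i \<and> 0 < bary x $ j \<and>
     (\<forall>m. m \<noteq> i \<and> m \<noteq> j \<longrightarrow> bary x $ i < bary x $ m \<and> bary x $ j < bary x $ m)}"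

lemma open_joint: "open (joint i j)"
proof -
  have "joint i j = {x. 0 < bary x $ i} \<inter> {x. 0 < bary x $ j} \<inter>
      (\<Inter>m\<in>- {i, j}. {x. bary x $ i < bary x $ m} \<inter> {x. bary x $ j < bary x $ m})"
    by (auto simp: joint_def)
  then show ?thesis
    by (auto intro!: open_Int open_INT open_Collect_less continuous_on_const bary_continuous)
qed

lemma joint_cell: "x \<in> joint i j \<Longrightarrow> bary x $ i \<le> bary x $ j \<Longrightarrow> x \<in> cell i"
  unfolding joint_def cell_eq mem_Collect_eq by (metis less_imp_le order_refl)

lemma joint_commute: "joint i j = joint j i"
  by (auto simp: joint_def)

lemma cell_subset: "cell i \<subseteq> convex hull (range \<nu>)"
  unfolding cell_eq hull_V using order_trans by blast

lemma joint_subset_interior: "joint i j \<subseteq> interior (convex hull (range \<nu>))"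
proof (rule interior_maximal[OF _ open_joint])
  show "joint i j \<subseteq> convex hull (range \<nu>)"
  proof
    fix x assume x: "x \<in> joint i j"
    show "x \<in> convex hull (range \<nu>)"
    proof (cases "bary x $ i \<le> bary x $ j")
      case True
      then show ?thesis using joint_cell[OF x] cell_subset by blast
    next
      case False
      then show ?thesis using joint_cell[of x j i] x cell_subset by (auto simp: joint_commute)
    qed
  qed
qed

lemma lebesgue_cell: "cell i \<in> sets lebesgue" "convex hull (range \<nu>) \<in> sets lebesgue"
proof -
  have "closed (cell i)" "closed (convex hull (range \<nu>))"
    unfolding cell_def by (auto intro!: compact_imp_closed finite_imp_compact_convex_hull)
  then show "cell i \<in> sets lebesgue" "convex hull (range \<nu>) \<in> sets lebesgue" by auto
qed

lemma AE_cell_iff: "(AE x in lebesgue_on (cell i). Q x) \<longleftrightarrow> (AE x in lebesgue. x \<in> cell i \<longrightarrow> Q x)"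
  by (rule AE_restrict_space_iff) (use lebesgue_cell(1) in simp)

lemma AE_hull_iff: "(AE x in lebesgue_on (convex hull (range \<nu>)). Q x) \<longleftrightarrow>
    (AE x in lebesgue. x \<in> convex hull (range \<nu>) \<longrightarrow> Q x)"
  by (rule AE_restrict_space_iff) (use lebesgue_cell(2) in simp)

context
  fixes \<omega> :: "'n form" and P :: "'n option \<Rightarrow> 'n form" and r k :: nat
  assumes weak: "weak_ext_deriv k (convex hull (range \<nu>)) \<omega> zero_form"
    and meas: "\<And>v. v \<in> {..<k} \<rightarrow> Basis \<Longrightarrow> (\<lambda>x. \<omega> x v) \<in> borel_measurable (lebesgue_on (convex hull (range \<nu>)))"
    and P: "\<And>i. form_deg_le r k (P i)"
    and ae: "\<And>i. AE x in lebesgue_on (cell i). \<omega> x = P i x"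
begin

lemma AE_near_joint:
  assumes "cball c R \<subseteq> joint i j"
  shows "AE x in lebesgue_on (convex hull (range \<nu>)).
    x \<in> cball c R \<longrightarrow> \<omega> x = (if bary x $ j - bary x $ i > 0 then P i x else P j x)"
proof -
  have "AE x in lebesgue. x \<in> cell i \<longrightarrow> \<omega> x = P i x" "AE x in lebesgue. x \<in> cell j \<longrightarrow> \<omega> x = P j x"
    using ae by (simp_all add: AE_cell_iff)
  then show ?thesis unfolding AE_hull_iff
  proof eventually_elim
    case (elim x)
    show ?case
    proof (intro impI)
      assume "x \<in> cball c R"
      then have x: "x \<in> joint i j" using assms by blast
      then have x': "x \<in> joint j i" by (simp add: joint_commute)
      show "\<omega> x = (if bary x $ j - bary x $ i > 0 then P i x else P j x)"
        using elim joint_cell[OF x] joint_cell[OF x'] by auto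
    qed
  qed
qed

lemma pieces_closed: "closed_form k (P i)"
proof -
  obtain c b where "b > 0" "bary c $ i = b" "\<And>m. m \<noteq> i \<Longrightarrow> b < bary c $ m"
    using ex_min_point[of "{i}"] by auto
  then have c: "c \<in> joint i i" by (auto simp: joint_def)
  have zero: "ext_d k (P i) x v = 0" if x: "x \<in> joint i i" for x v
  proof -
    obtain R where R: "R > 0" "cball x R \<subseteq> joint i i" using open_joint x open_contains_cball by blast
    show ?thesis
      using AE_near_joint[OF R(2)] R(2) joint_subset_interior[of i i]
      by (intro closed_at_if_weakly_closed[OF weak lebesgue_cell(2) meas P R(1)]) auto
  qed
  have "ext_d k (P i) x v = 0" for x v
  proof -
    obtain \<epsilon> where \<epsilon>: "\<epsilon> > 0" "\<And>t. 0 < t \<Longrightarrow> t < \<epsilon> \<Longrightarrow> c + t *\<^sub>R (x - c) \<in> joint i i"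
      using open_line_segment[OF open_joint c, of "x - c"] by blast
    have "ext_d k (P i) (c + 1 *\<^sub>R (x - c)) v = 0"
      by (rule deg_le_zero_on_line[OF form_deg_leD(2)[OF form_deg_le_ext_d[OF P]] \<epsilon>(1)])
        (intro zero \<epsilon>(2))
    then show ?thesis by simp
  qed
  then show ?thesis unfolding closed_form_def by blast
qed

text \<open>The hyperplane contains the common face of the two cells.  There the tangential part of the jump is
  zero, hence everywhere on the hyperplane.\<close>

lemma pieces_traces_agree: "trace0 k {x. bary x $ i = bary x $ j} (\<lambda>x v. P i x v - P j x v)"
proof (cases "i = j")
  case True
  then show ?thesis by (simp add: trace0_def)
next
  case False
  let ?l = "\<lambda>x. bary x $ j - bary x $ i"
  have l: "affine_map ?l" by (intro affine_map_diff affine_map_bary_nth)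
  have lin: "linear (\<lambda>x. ?l x - ?l 0)" using l by (simp add: affine_map_def)
  obtain u where u: "?l u - ?l 0 = 1"
  proof -
    have "?l (\<nu> j) \<noteq> ?l (\<nu> i)" using False by (simp add: bary_\<nu> axis_def)
    then obtain u where "?l u - ?l 0 \<noteq> 0" by (metis eq_iff_diff_eq_0)
    then have "?l ((1 / (?l u - ?l 0)) *\<^sub>R u) - ?l 0 = 1"
      using linear_scale[OF lin, of "1 / (?l u - ?l 0)" u] by simp
    then show thesis using that by blast
  qed
  obtain c b where b: "b > 0" "bary c $ i = b" "bary c $ j = b" "\<And>m. m \<noteq> i \<Longrightarrow> m \<noteq> j \<Longrightarrow> b < bary c $ m"
    using ex_min_point[of "{i, j}"] by auto
  then have c: "c \<in> joint i j" by (auto simp: joint_def)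
  have zero: "P i x v - P j x v = 0"
    if x: "x \<in> joint i j" "?l x = 0" and v: "\<And>m. m < k \<Longrightarrow> ?l (v m) - ?l 0 = 0" for x v
  proof -
    obtain R where R: "R > 0" "cball x R \<subseteq> joint i j" using open_joint x(1) open_contains_cball by blast
    have "wedge1 k (\<lambda>v. ?l v - ?l 0) (\<lambda>x v. P i x v - P j x v) x (vcons u v) = 0"
      using AE_near_joint[OF R(2)] R joint_subset_interior[of i j] u x(2)
      by (intro wedge_jump_zero_if_weakly_closed[OF weak lebesgue_cell(2) meas P P
            pieces_closed pieces_closed l, of u x R]) auto
    then show ?thesis
      using wedge1_vcons[of "\<lambda>v. ?l v - ?l 0" u k v "\<lambda>x v. P i x v - P j x v" x] u v by simp
  qed
  show ?thesis
  proof (rule trace0I)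
    fix x v assume x: "x \<in> {x. bary x $ i = bary x $ j}"
      and v: "\<And>m. m < k \<Longrightarrow> x + v m \<in> {x. bary x $ i = bary x $ j}"
    have v0: "?l (v m) - ?l 0 = 0" if "m < k" for m
      using v[OF that] x affine_map_plus[OF l, of x "v m"] by simp
    obtain \<epsilon> where \<epsilon>: "\<epsilon> > 0" "\<And>t. 0 < t \<Longrightarrow> t < \<epsilon> \<Longrightarrow> c + t *\<^sub>R (x - c) \<in> joint i j"
      using open_line_segment[OF open_joint c, of "x - c"] by blast
    have "P i (c + 1 *\<^sub>R (x - c)) v - P j (c + 1 *\<^sub>R (x - c)) v = 0"
    proof (rule deg_le_zero_on_line[OF deg_le_diff[OF form_deg_leD(2)[OF P] form_deg_leD(2)[OF P]] \<epsilon>(1)])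
      show "P i (c + t *\<^sub>R (x - c)) v - P j (c + t *\<^sub>R (x - c)) v = 0" if "0 < t" "t < \<epsilon>" for t
        using x b(2,3) by (intro zero \<epsilon>(2)[OF that] v0) (auto simp: bary_line)
    qed
    then show "P i x v - P j x v = 0" by simp
  qed
qed

end

lemma tangent_vector_eq:
  assumes v: "bary v $ i = bary 0 $ i"
  shows "v = (\<Sum>m\<in>UNIV - {i, j}. (bary v $ m - bary 0 $ m) *\<^sub>R (\<nu> m - \<nu> j))"
proof -
  let ?d = "\<lambda>m. bary v $ m - bary 0 $ m"
  have "v = (\<Sum>m\<in>UNIV. ?d m *\<^sub>R \<nu> m)" by (simp add: scaleR_left_diff_distrib sum_subtractf bary)
  moreover have "(\<Sum>m\<in>UNIV. ?d m *\<^sub>R \<nu> j) = 0"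
    by (simp add: sum_subtractf bary flip: scaleR_left.sum)
  ultimately have "v = (\<Sum>m\<in>UNIV. ?d m *\<^sub>R (\<nu> m - \<nu> j))"
    by (simp add: scaleR_right_diff_distrib sum_subtractf)
  also have "\<dots> = (\<Sum>m\<in>UNIV - {i, j}. ?d m *\<^sub>R (\<nu> m - \<nu> j))"
    by (rule sum.mono_neutral_right) (auto simp: v)
  finally show ?thesis .
qed

lemma plane_tangent:
  assumes "bary x $ i = 0" "bary (x + v) $ i = 0"
  shows "bary v $ i = bary 0 $ i"
  using affine_map_plus[OF affine_map_bary_nth[of i], of x v] assms by simp

text \<open>The hyperplane has dimension \<open>n - 1\<close>.\<close>

lemma trace0_face_top:
  fixes p :: "'n form"
  assumes p: "form_deg_le r CARD('n) p"
  shows "trace0 CARD('n) {x. bary x $ i = 0} p"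
proof (rule trace0I)
  fix x v assume x: "x \<in> {x. bary x $ i = 0}" and v: "\<And>m. m < CARD('n) \<Longrightarrow> x + v m \<in> {x. bary x $ i = 0}"
  obtain j where j: "j \<noteq> i" using ex_other_vertex by blast
  let ?B = "(\<lambda>m. \<nu> m - \<nu> j) ` (UNIV - {i, j})"
  have "card ?B \<le> card (UNIV - {i, j})" by (rule card_image_le) simp
  also have "\<dots> < CARD('n)" using j by (simp add: card_Diff_insert)
  finally have cB: "card ?B < CARD('n)" .
  have "v m \<in> span ?B" if "m < CARD('n)" for m
  proof -
    have "bary (v m) $ i = bary 0 $ i" using plane_tangent[of x i "v m"] x v[OF that] by simp
    then show ?thesis
      by (subst tangent_vector_eq[of "v m" i j]) (assumption, rule span_sum, rule span_scale, rule span_base, blast)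
  qed
  then show "p x v = 0"
    using alternating_zero_if_small_span[OF form_deg_leD(1)[OF p], of ?B v x] cB by simp
qed

text \<open>A polynomial that vanishes on the face vanishes on the hyperplane through it.\<close>

lemma trace0_face_if_tr:
  fixes p :: "'n form"
  assumes p: "form_deg_le r k p" and n: "CARD('n) \<ge> 2"
    and tr: "tr k (convex hull (range \<nu> - {\<nu> i})) p = zero_form"
  shows "trace0 k {x. bary x $ i = 0} p"
proof (rule trace0I)
  fix x v assume x: "x \<in> {x. bary x $ i = 0}" and v: "\<And>m. m < k \<Longrightarrow> x + v m \<in> {x. bary x $ i = 0}"
  let ?F = "convex hull (range \<nu> - {\<nu> i})"
  have vertex: "\<nu> m \<in> ?F" if "m \<noteq> i" for m
    using that inj_\<nu> by (auto intro!: hull_inc simp: inj_eq)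
  have in_F: "y \<in> ?F" if "bary y $ i = 0" "\<And>m. 0 \<le> bary y $ m" for y
  proof -
    have "(\<Sum>m\<in>UNIV - {i}. bary y $ m *\<^sub>R \<nu> m) \<in> ?F"
    proof (rule convex_sum[OF _ convex_convex_hull])
      show "(\<Sum>m\<in>UNIV - {i}. bary y $ m) = 1"
        using bary(1)[of y] sum.remove[of UNIV i "\<lambda>m. bary y $ m"] that(1) by simp
    qed (use that vertex in auto)
    moreover have "(\<Sum>m\<in>UNIV - {i}. bary y $ m *\<^sub>R \<nu> m) = y"
      using bary(2)[of y] sum.remove[of UNIV i "\<lambda>m. bary y $ m *\<^sub>R \<nu> m"] that(1) by simp
    ultimately show ?thesis by simp
  qed
  obtain j where j: "j \<noteq> i" using ex_other_vertex by blast
  have tangent: "v \<in> {..<k} \<rightarrow> tangent_space ?F"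
  proof
    fix m assume "m \<in> {..<k}"
    then have "bary (v m) $ i = bary 0 $ i" using plane_tangent[of x i "v m"] x v[of m] by simp
    then show "v m \<in> tangent_space ?F"
      unfolding tangent_space_def using vertex j
      by (subst tangent_vector_eq[of "v m" i j]) (assumption, rule span_sum, rule span_scale, rule span_base, blast)
  qed
  have on_F: "p y v = 0" if "y \<in> ?F" for y
    using fun_cong[OF fun_cong[OF tr, of y], of v] that tangent by (simp add: tr_def zero_form_def)
  obtain c where c: "bary c $ i = 0" "\<And>m. m \<noteq> i \<Longrightarrow> 0 < bary c $ m" using ex_face_point by blast
  define U where "U = (\<Inter>m\<in>UNIV - {i}. {x. 0 < bary x $ m})"
  have "open U" unfolding U_def
    by (intro open_INT ballI open_Collect_less continuous_on_const bary_continuous) simp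
  moreover have "c \<in> U" using c by (simp add: U_def)
  ultimately obtain \<epsilon> where \<epsilon>: "\<epsilon> > 0" "\<And>t. 0 < t \<Longrightarrow> t < \<epsilon> \<Longrightarrow> c + t *\<^sub>R (x - c) \<in> U"
    using open_line_segment[of U c "x - c"] by blast
  have "p (c + 1 *\<^sub>R (x - c)) v = 0"
  proof (rule deg_le_zero_on_line[OF form_deg_leD(2)[OF p] \<epsilon>(1)])
    fix t :: real assume t: "0 < t" "t < \<epsilon>"
    have "bary (c + t *\<^sub>R (x - c)) $ i = 0" using c(1) x by (simp add: bary_line)
    moreover have "0 \<le> bary (c + t *\<^sub>R (x - c)) $ m" for m
    proof (cases "m = i")
      case False
      then show ?thesis using \<epsilon>(2)[OF t] by (auto simp: U_def intro: less_imp_le)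
    qed (use calculation in simp)
    ultimately show "p (c + t *\<^sub>R (x - c)) v = 0" by (intro on_F in_F)
  qed
  then show "p x v = 0" by simp
qed


section \<open>The vertical primitive\<close>

definition low :: "real ^ 'n \<Rightarrow> real" where
  "low x = Min (range (\<lambda>i. bary x $ i))"

definition lift :: "real ^ 'n \<Rightarrow> real ^ 'n option" where
  "lift x = bary x - low x *\<^sub>R e"

text \<open>The pullback to the graph, for forms \<open>R\<close> without \<open>e\<close>-component: for these the derivative of \<open>low\<close>,
  which jumps between the cells, contributes nothing and may be left out.\<close>

definition graph_pull :: "(real ^ 'n option) dform \<Rightarrow> 'n form" where
  "graph_pull R = (\<lambda>x v. R (lift x) (\<lambda>i. bary (v i) - bary 0))"

lemma low_le: "low x \<le> bary x $ i"
  by (simp add: low_def)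

lemma low_attained: "\<exists>i. low x = bary x $ i"
proof -
  have "low x \<in> range (\<lambda>i. bary x $ i)" unfolding low_def by (rule Min_in) auto
  then show ?thesis by blast
qed

lemma low_cell: "x \<in> cell i \<Longrightarrow> low x = bary x $ i"
  using low_attained[of x] low_le[of x i] by (auto simp: cell_eq intro: antisym)

lemma low_frontier: "x \<in> frontier (convex hull (range \<nu>)) \<Longrightarrow> low x = 0"
proof -
  assume x: "x \<in> frontier (convex hull (range \<nu>))"
  have closed: "closed (convex hull (range \<nu>))"
    by (intro compact_imp_closed finite_imp_compact_convex_hull finite_imageI finite)
  then have "x \<in> convex hull (range \<nu>)" using x frontier_subset_closed by blast
  then have "0 \<le> low x" using low_attained[of x] by (auto simp: hull_V)
  moreover have "\<not> 0 < low x"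
  proof
    assume "0 < low x"
    then have "x \<in> (\<Inter>i. {x. 0 < bary x $ i})" using low_le[of x] less_le_trans by blast
    moreover have "open (\<Inter>i. {x. 0 < bary x $ i})"
      by (intro open_INT ballI open_Collect_less continuous_on_const bary_continuous) simp
    moreover have "(\<Inter>i. {x. 0 < bary x $ i}) \<subseteq> convex hull (range \<nu>)"
      by (auto simp: hull_V intro: less_imp_le)
    ultimately have "x \<in> interior (convex hull (range \<nu>))" by (meson interiorI)
    then show False using x by (simp add: frontier_def)
  qed
  ultimately show ?thesis by simp
qed

text \<open>The projection along \<open>e\<close> to the hyperplane \<open>(\<Sum>j. y\<^sub>j) = 1\<close>.\<close>

definition fall :: "real ^ 'n option \<Rightarrow> real ^ 'n option" where
  "fall y = bary (base y)"

lemma affine_map_fall: "affine_map fall"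
  unfolding fall_def[abs_def] by (rule affine_map_comp[OF affine_map_base affine_map_bary])

lemma fall_eq: "fall y = y + ((1 - coord_sum UNIV y) / real CARD('n option)) *\<^sub>R e"
  by (simp add: fall_def bary_base)

lemma fall_in_plane: "fall y \<in> simplex_plane UNIV"
  by (simp add: fall_def simplex_plane_def coord_sum_bary)

lemma fall_e: "fall e - fall 0 = 0"
proof -
  let ?N = "real CARD('n option)"
  have "coord_sum UNIV e = ?N" by (simp add: coord_sum_def)
  then have "fall e - fall 0 = (1 + ((1 - ?N) / ?N - 1 / ?N)) *\<^sub>R e"
    unfolding fall_eq scaleR_left_distrib scaleR_left_diff_distrib by simp
  also have "1 + ((1 - ?N) / ?N - 1 / ?N) = 0"
    using N_pos by (simp add: diff_divide_distrib del: card_option)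
  finally show ?thesis by simp
qed

definition grounded :: "nat \<Rightarrow> (real ^ 'n option) dform \<Rightarrow> bool" where
  "grounded k R \<longleftrightarrow> (\<forall>y w j. j < k \<longrightarrow> w j = e \<longrightarrow> R y w = 0) \<and> (\<forall>y w. coord_sum UNIV y = 1 \<longrightarrow> R y w = 0)"

text \<open>The velocity \<open>y - fall y\<close>, which the homotopy operator inserts as the first argument, is a multiple of
  \<open>e\<close>, and it is zero on the plane to which \<open>fall\<close> projects.\<close>

lemma vertical_primitive:
  fixes \<Omega> :: "(real ^ 'n option) dform"
  assumes \<Omega>: "form_deg_le r (Suc k) \<Omega>" "closed_form (Suc k) \<Omega>" "trace0 (Suc k) (simplex_plane UNIV) \<Omega>"
  defines "R \<equiv> homotopy_op fall \<Omega>"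
  shows "form_deg_le (Suc r) k R" "ext_d k R = \<Omega>" "grounded k R"
proof -
  note alt = form_deg_leD(1)[OF \<Omega>(1)]
  show "form_deg_le (Suc r) k R" unfolding R_def by (rule form_deg_le_homotopy_op[OF \<Omega>(1) affine_map_fall])
  have "pull fall \<Omega> y w = 0" for y w
    unfolding pull_def
  proof (rule trace0D[OF \<Omega>(3) fall_in_plane])
    show "fall y + (fall (w i) - fall 0) \<in> simplex_plane UNIV" for i
      using fall_in_plane[of "y + w i"] affine_map_plus[OF affine_map_fall, of y "w i"] by simp
  qed
  then show "ext_d k R = \<Omega>"
    unfolding R_def using ext_d_homotopy_op[OF \<Omega>(1) affine_map_fall] \<Omega>(2) by (simp add: closed_form_def)
  have vert: "y - fall y = (- ((1 - coord_sum UNIV y) / real CARD('n option))) *\<^sub>R e" for y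
    by (simp add: fall_eq)
  have scale0: "\<Omega> x (vcons (c *\<^sub>R u) w) = c * \<Omega> x (vcons u w)" for x c u w
    using alternating_upd_scaleR[OF alt, of 0 x "vcons 0 w" c u] by (simp add: vcons_upd_0 del: fun_upd_apply)
  have "R y w = 0" if "j < k" "w j = e" for y w j
  proof -
    have "homotopy_integrand fall \<Omega> y w t = 0" for t
    proof -
      let ?w = "moved fall w t"
      have "?w j = t *\<^sub>R e" using that(2) fall_e by (simp add: moved_def)
      then have "\<Omega> x (vcons e ?w) = t * \<Omega> x ((vcons e ?w)(Suc j := e))" for x
        using alternating_upd_scaleR[OF alt, of "Suc j" x "vcons e ?w" t e] that(1)
        by (metis Suc_less_eq fun_upd_triv vcons_simps(2))
      moreover have "\<Omega> x ((vcons e ?w)(Suc j := e)) = 0" for x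
        by (rule alternating_eq_0[OF alt, of 0 "Suc j"]) (use that(1) in auto)
      ultimately have "\<Omega> x (vcons (y - fall y) ?w) = 0" for x unfolding vert scale0 by simp
      then show ?thesis by (simp add: homotopy_integrand_def)
    qed
    then have "homotopy_integrand fall \<Omega> y w = (\<lambda>t. 0)" by blast
    then show ?thesis by (simp add: R_def homotopy_op_def)
  qed
  moreover have "R y w = 0" if "coord_sum UNIV y = 1" for y w
  proof -
    have "y - fall y = 0" by (simp add: fall_eq that)
    then have "homotopy_integrand fall \<Omega> y w = (\<lambda>t. 0)"
      using scale0[of _ 0 0] by (simp add: homotopy_integrand_def fun_eq_iff)
    then show ?thesis by (simp add: R_def homotopy_op_def)
  qed
  ultimately show "grounded k R" unfolding grounded_def by blast
qed

context
  fixes R :: "(real ^ 'n option) dform" and r k :: nat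
  assumes R: "form_deg_le r k R" and grounded: "grounded k R"
begin

lemma R_e: "j < k \<Longrightarrow> w j = e \<Longrightarrow> R y w = 0"
  and R_plane: "coord_sum UNIV y = 1 \<Longrightarrow> R y w = 0"
  using grounded unfolding grounded_def by blast+

text \<open>On a cell \<open>lift\<close> is the affine map \<open>sheet i\<close>, and its derivative differs from that of \<open>bary\<close> by a
  multiple of \<open>e\<close>.\<close>

lemma graph_pull_cell:
  assumes "x \<in> cell i"
  shows "graph_pull R x = pull (sheet i) R x"
proof (rule ext)
  fix v :: "nat \<Rightarrow> real ^ 'n"
  have "lift x = sheet i x" by (simp add: lift_def sheet_def low_cell[OF assms])
  moreover have "(\<lambda>j. sheet i (v j) - sheet i 0) =
      (\<lambda>j. (bary (v j) - bary 0) + (- (bary (v j) $ i - bary 0 $ i)) *\<^sub>R e)"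
    by (simp add: sheet_def algebra_simps)
  ultimately show "graph_pull R x v = pull (sheet i) R x v"
    by (simp only: graph_pull_def pull_def alternating_absorb[OF form_deg_leD(1)[OF R] R_e])
qed

lemma alternating_graph_pull: "alternating k (graph_pull R x)"
  unfolding graph_pull_def
  by (rule alternating_comp_linear[OF form_deg_leD(1)[OF R]])
    (use affine_map_bary in \<open>simp add: affine_map_def\<close>)

lemma graph_pull_frontier: "x \<in> frontier (convex hull (range \<nu>)) \<Longrightarrow> graph_pull R x v = 0"
  unfolding graph_pull_def by (rule R_plane) (simp add: lift_def low_frontier coord_sum_bary)

lemma graph_pull_lipschitz:
  "\<exists>M L. \<forall>x\<in>cball 0 B. \<forall>y\<in>cball 0 B. \<bar>graph_pull R x v\<bar> \<le> M \<and>
     \<bar>graph_pull R x v - graph_pull R y v\<bar> \<le> L * norm (x - y)"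
proof -
  have lin: "linear (\<lambda>x. bary x - bary 0)" using affine_map_bary by (simp add: affine_map_def)
  obtain K where K: "K > 0" "\<And>x. norm (bary x - bary 0) \<le> K * norm x"
    using linear_bounded_pos[OF lin] by auto
  have bary_lip: "norm (bary x - bary y) \<le> K * norm (x - y)" for x y
    using K(2)[of "x - y"] linear_diff[OF lin, of x y] by simp
  have nth_lip: "\<bar>bary x $ i - bary y $ i\<bar> \<le> K * norm (x - y)" for x y i
    using bary_lip[of x y] component_le_norm_cart[of "bary x - bary y" i] by simp
  have low_lip1: "low x - low y \<le> K * norm (x - y)" for x y
  proof -
    obtain j where "low y = bary y $ j" using low_attained by blast
    then show ?thesis using low_le[of x j] nth_lip[of x j y] by linarith
  qed
  have low_lip: "\<bar>low x - low y\<bar> \<le> K * norm (x - y)" for x y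
    using low_lip1[of x y] low_lip1[of y x] by (simp add: norm_minus_commute abs_le_iff)
  define C where "C = K + K * norm e"
  have lift_lip: "norm (lift x - lift y) \<le> C * norm (x - y)" for x y
  proof -
    have "lift x - lift y = (bary x - bary y) - (low x - low y) *\<^sub>R e"
      by (simp add: lift_def scaleR_left_diff_distrib)
    then have "norm (lift x - lift y) \<le> norm (bary x - bary y) + \<bar>low x - low y\<bar> * norm e"
      by (metis norm_scaleR norm_triangle_ineq4)
    also have "\<dots> \<le> K * norm (x - y) + (K * norm (x - y)) * norm e"
      by (intro add_mono bary_lip mult_right_mono low_lip norm_ge_zero)
    finally show ?thesis by (simp add: C_def algebra_simps)
  qed
  define B' where "B' = norm (lift 0) + C * \<bar>B\<bar>"
  have C0: "C \<ge> 0" using K(1) by (simp add: C_def)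
  have lift_ball: "lift x \<in> cball 0 B'" if "x \<in> cball 0 B" for x
  proof -
    have "norm (lift x) \<le> norm (lift 0) + norm (lift x - lift 0)" by (metis norm_triangle_sub)
    also have "\<dots> \<le> norm (lift 0) + C * norm x" using lift_lip[of x 0] by simp
    also have "\<dots> \<le> B'" unfolding B'_def using that C0 by (intro add_left_mono mult_left_mono) auto
    finally show ?thesis by simp
  qed
  let ?w = "\<lambda>i. bary (v i) - bary 0"
  obtain M L where bnd: "\<And>x y. x \<in> cball 0 B' \<Longrightarrow> y \<in> cball 0 B' \<Longrightarrow>
      \<bar>R x ?w\<bar> \<le> M \<and> \<bar>R x ?w - R y ?w\<bar> \<le> L * norm (x - y)"
    using deg_le_bounded_lipschitz[OF form_deg_leD(2)[OF R], of B' ?w] by blast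
  show ?thesis
  proof (rule exI[of _ M], rule exI[of _ "\<bar>L\<bar> * C"], intro ballI conjI)
    fix x y :: "real ^ 'n" assume xy: "x \<in> cball 0 B" "y \<in> cball 0 B"
    show "\<bar>graph_pull R x v\<bar> \<le> M" using bnd[OF lift_ball[OF xy(1)] lift_ball[OF xy(1)]] by (simp add: graph_pull_def)
    have "\<bar>graph_pull R x v - graph_pull R y v\<bar> \<le> L * norm (lift x - lift y)"
      using bnd[OF lift_ball[OF xy(1)] lift_ball[OF xy(2)]] by (simp add: graph_pull_def)
    also have "\<dots> \<le> \<bar>L\<bar> * (C * norm (x - y))"
      using lift_lip[of x y] by (intro mult_mono) auto
    finally show "\<bar>graph_pull R x v - graph_pull R y v\<bar> \<le> (\<bar>L\<bar> * C) * norm (x - y)" by simp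
  qed
qed

lemma graph_pull_continuous: "continuous_on A (\<lambda>x. graph_pull R x v)"
proof (rule continuous_at_imp_continuous_on, rule ballI)
  fix x :: "real ^ 'n"
  obtain L where L: "\<And>y z. y \<in> cball 0 (norm x + 1) \<Longrightarrow> z \<in> cball 0 (norm x + 1) \<Longrightarrow>
      \<bar>graph_pull R y v - graph_pull R z v\<bar> \<le> L * norm (y - z)"
    using graph_pull_lipschitz[of "norm x + 1" v] by blast
  have "\<bar>L\<bar>-lipschitz_on (ball 0 (norm x + 1)) (\<lambda>x. graph_pull R x v)"
  proof (rule lipschitz_onI)
    fix y z :: "real ^ 'n" assume "y \<in> ball 0 (norm x + 1)" "z \<in> ball 0 (norm x + 1)"
    then have "\<bar>graph_pull R y v - graph_pull R z v\<bar> \<le> L * norm (y - z)" by (intro L) auto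
    also have "\<dots> \<le> \<bar>L\<bar> * norm (y - z)" by (intro mult_right_mono) auto
    finally show "dist (graph_pull R y v) (graph_pull R z v) \<le> \<bar>L\<bar> * dist y z"
      by (simp add: dist_norm)
  qed simp
  from lipschitz_on_continuous_on[OF this] show "isCont (\<lambda>x. graph_pull R x v) x"
    by (rule continuous_on_interior) simp
qed

lemma graph_pull_M0: "graph_pull R \<in> M0_space r k (range \<nu>)"
  unfolding M0_space_def M_space_def C0_forms_def alfeld_split_V mem_Collect_eq
proof (intro conjI ballI alternating_graph_pull graph_pull_continuous graph_pull_frontier)
  fix S assume "S \<in> range cell"
  then obtain i where i: "S = cell i" by blast
  show "\<exists>p\<in>poly_forms r k. \<forall>x\<in>S. graph_pull R x = p x"
    by (rule bexI[of _ "pull (sheet i) R"])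
      (auto simp: i graph_pull_cell poly_forms_iff_form_deg_le intro: form_deg_le_pull[OF R affine_map_sheet])
qed

end

end

section \<open>The weak derivative of the primitive\<close>

context simplex_coords
begin

lemma compact_hull: "compact (convex hull (range \<nu>))"
  by (intro finite_imp_compact_convex_hull finite_imageI finite)

lemma AE_in_joint: "AE x in lebesgue. x \<in> convex hull (range \<nu>) \<longrightarrow> (\<exists>j. x \<in> joint j j)"
proof -
  define N where "N = (\<Union>i. {x. bary x $ i = 0}) \<union> (\<Union>(i, j)\<in>{(i, j). i \<noteq> j}. {x. bary x $ i - bary x $ j = 0})"
  have "negligible {x. bary x $ i = 0}" for i
  proof -
    obtain j where "j \<noteq> i" using ex_other_vertex by blast
    then show ?thesis
      by (intro negligible_affine_zero[OF affine_map_bary_nth, of "\<nu> i" _ "\<nu> j"]) (simp add: bary_\<nu> axis_def)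
  qed
  moreover have "negligible {x. bary x $ i - bary x $ j = 0}" if "i \<noteq> j" for i j
    using that
    by (intro negligible_affine_zero[OF affine_map_diff[OF affine_map_bary_nth affine_map_bary_nth], of "\<nu> i" _ _ "\<nu> j"])
      (simp add: bary_\<nu> axis_def)
  ultimately have "negligible N"
    unfolding N_def by (intro negligible_Un negligible_Union finite_imageI) auto
  then have "AE x in lebesgue. x \<notin> N" by (intro AE_not_in) (simp add: negligible_iff_null_sets)
  then show ?thesis
  proof (rule AE_mp, intro AE_I2 impI)
    fix x assume N: "x \<notin> N" and x: "x \<in> convex hull (range \<nu>)"
    obtain j where j: "low x = bary x $ j" using low_attained by blast
    have "0 < bary x $ j" using N x by (auto simp: N_def hull_V le_less)
    moreover have "bary x $ j < bary x $ m" if "m \<noteq> j" for m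
    proof -
      have "x \<notin> {x. bary x $ m - bary x $ j = 0}" using N that unfolding N_def by blast
      then show ?thesis using low_le[of x m] j by simp
    qed
    ultimately show "\<exists>j. x \<in> joint j j" by (auto simp: joint_def)
  qed
qed

lemma joint_unique: "x \<in> joint i i \<Longrightarrow> x \<in> joint j j \<Longrightarrow> i = j"
  unfolding joint_def by (metis (mono_tags, lifting) mem_Collect_eq order_less_asym)

lemma sum_joint:
  assumes "x \<in> joint j j"
  shows "(\<Sum>m\<in>UNIV. indicator (joint m m) x * f m) = (f j :: real)"
proof -
  have "(\<Sum>m\<in>UNIV. indicator (joint m m) x * f m) = (\<Sum>m\<in>{j}. indicator (joint m m) x * f m)"
    using joint_unique[OF assms] by (intro sum.mono_neutral_right) (auto simp: indicator_def)
  then show ?thesis using assms by simp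
qed

context
  fixes R :: "(real ^ 'n option) dform" and r k :: nat
  assumes R: "form_deg_le r k R" and grounded: "grounded k R"
begin

text \<open>The directional derivative of a coefficient of the primitive, outside a set of measure zero.\<close>

definition piece_deriv :: "(nat \<Rightarrow> real ^ 'n) \<Rightarrow> real ^ 'n \<Rightarrow> real ^ 'n \<Rightarrow> real" where
  "piece_deriv w u x = (\<Sum>j\<in>UNIV. indicator (joint j j) x * dir_deriv (\<lambda>y. pull (sheet j) R y w) x u)"

text \<open>Extended by zero, the primitive is Lipschitz continuous: the extension is the composition with the
  nearest point map of the simplex.\<close>

lemma integral_by_parts_graph_pull:
  fixes \<phi> :: "real ^ 'n \<Rightarrow> real"
  assumes \<phi>: "\<And>x. (\<phi> has_derivative \<phi>' x) (at x)" "continuous_on UNIV (\<lambda>x. \<phi>' x u)"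
    and bound: "\<And>x. \<bar>\<phi> x\<bar> \<le> K" "\<And>x. \<bar>\<phi>' x u\<bar> \<le> K'"
  shows "integrable lebesgue (\<lambda>x. piece_deriv w u x * \<phi> x)"
    "integral\<^sup>L lebesgue (\<lambda>x. piece_deriv w u x * \<phi> x) =
      - (LINT x|lebesgue_on (convex hull (range \<nu>)). graph_pull R x w * \<phi>' x u)"
proof -
  let ?T = "convex hull (range \<nu>)"
  let ?\<rho> = "\<lambda>x. graph_pull R x w"
  have T: "closed ?T" "convex ?T" "?T \<noteq> {}" using compact_hull by (auto intro: compact_imp_closed)
  obtain B where B: "?T \<subseteq> cball 0 B"
    using bounded_subset_ballD[OF compact_imp_bounded[OF compact_hull], of 0] ball_subset_cball by blast
  obtain M L where bnd: "\<And>x y. x \<in> cball 0 B \<Longrightarrow> y \<in> cball 0 B \<Longrightarrow>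
      \<bar>?\<rho> x\<bar> \<le> M \<and> \<bar>?\<rho> x - ?\<rho> y\<bar> \<le> L * norm (x - y)"
    using graph_pull_lipschitz[OF R grounded, of B w] by blast
  note \<rho>_cont = graph_pull_continuous[OF R grounded, where v = w]
  define ext where "ext x = ?\<rho> (closest_point ?T x)" for x
  have ext_in: "ext x = ?\<rho> x" if "x \<in> ?T" for x using that by (simp add: ext_def closest_point_self)
  have ext_out: "ext x = 0" if "x \<notin> ?T" for x
  proof -
    have "closest_point ?T x \<notin> interior ?T"
    proof
      assume *: "closest_point ?T x \<in> interior ?T"
      then have full: "affine hull ?T = UNIV" by (intro affine_hull_nonempty_interior) auto
      then have "x \<in> rel_interior ?T"
        using closest_point_in_rel_interior[OF T(1,3), of x] * by (simp add: rel_interior_interior)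
      then show False using that rel_interior_subset by blast
    qed
    then have "closest_point ?T x \<in> frontier ?T"
      using closest_point_in_set[OF T(1,3)] T(1) by (simp add: frontier_def)
    then show ?thesis unfolding ext_def by (rule graph_pull_frontier[OF R grounded])
  qed
  have ext_eq: "ext x = indicator ?T x * ?\<rho> x" for x using ext_in ext_out by (cases "x \<in> ?T") auto
  have cp: "closest_point ?T x \<in> cball 0 B" for x using closest_point_in_set[OF T(1,3)] B by blast
  have ext_M: "\<bar>ext x\<bar> \<le> \<bar>M\<bar>" for x unfolding ext_def using bnd[OF cp cp] by (smt (verit))
  have ext_L: "\<bar>ext x - ext y\<bar> \<le> \<bar>L\<bar> * norm (x - y)" for x y
  proof -
    have "\<bar>ext x - ext y\<bar> \<le> L * norm (closest_point ?T x - closest_point ?T y)"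
      unfolding ext_def using bnd[OF cp cp] by blast
    also have "\<dots> \<le> \<bar>L\<bar> * norm (x - y)"
      using closest_point_lipschitz[OF T(2,1,3), of x y] by (intro mult_mono) (auto simp: dist_norm)
    finally show ?thesis .
  qed
  have \<phi>_cont: "continuous_on A \<phi>" for A
    using \<phi>(1) by (meson continuous_at_imp_continuous_on has_derivative_continuous)
  have \<phi>_lip: "\<bar>\<phi> (x + t *\<^sub>R u) - \<phi> x\<bar> \<le> K' * \<bar>t\<bar>" for x t
  proof -
    have "((\<lambda>t. \<phi> (x + t *\<^sub>R u)) has_real_derivative \<phi>' (x + s *\<^sub>R u) u) (at s)" for s
      by (rule has_real_derivative_along[OF \<phi>(1)])
    then have "norm (\<phi> (x + t *\<^sub>R u) - \<phi> (x + 0 *\<^sub>R u)) \<le> K' * norm (t - 0)"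
      using bound(2) by (intro field_differentiable_bound[of UNIV "\<lambda>t. \<phi> (x + t *\<^sub>R u)"
          "\<lambda>s. \<phi>' (x + s *\<^sub>R u) u"]) auto
    then show ?thesis by simp
  qed
  define g where "g x = ext x * \<phi> x" for x
  define b where "b x = indicator ?T x * (?\<rho> x * \<phi>' x u)" for x
  define g' where "g' x = piece_deriv w u x * \<phi> x + b x" for x
  have g_int: "integrable lborel g"
  proof -
    have "integrable lborel (\<lambda>x. indicator ?T x *\<^sub>R (?\<rho> x * \<phi> x))"
      by (intro borel_integrable_compact compact_hull continuous_on_mult \<rho>_cont \<phi>_cont)
    then show ?thesis by (simp add: g_def[abs_def] ext_eq mult.assoc)
  qed
  have b_int: "integrable lborel b"
  proof -
    have "integrable lborel (\<lambda>x. indicator ?T x *\<^sub>R (?\<rho> x * \<phi>' x u))"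
      by (intro borel_integrable_compact compact_hull continuous_on_mult \<rho>_cont continuous_on_subset[OF \<phi>(2)]) simp
    then show ?thesis by (simp add: b_def[abs_def])
  qed
  have b_leb: "integrable lebesgue b"
    using integrable_completion[OF borel_measurable_integrable[OF b_int]] b_int by simp
  have p: "deg_le r (\<lambda>y. pull (sheet j) R y w)" for j
    by (rule form_deg_leD(2)[OF form_deg_le_pull[OF R affine_map_sheet]])
  have "piece_deriv w u \<in> borel_measurable borel"
    unfolding piece_deriv_def[abs_def]
  proof (intro borel_measurable_sum borel_measurable_times borel_measurable_indicator)
    show "joint j j \<in> sets borel" for j using open_joint by simp
    show "(\<lambda>x. dir_deriv (\<lambda>y. pull (sheet j) R y w) x u) \<in> borel_measurable borel" for j
      by (intro borel_measurable_continuous_onI deg_le_continuous[OF deg_le_dir_deriv[OF p]])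
  qed
  moreover have "\<phi> \<in> borel_measurable borel" by (intro borel_measurable_continuous_onI \<phi>_cont)
  moreover have "b \<in> borel_measurable borel" using borel_measurable_integrable[OF b_int] by simp
  ultimately have "g' \<in> borel_measurable lborel" unfolding g'_def[abs_def] by simp
  then have g'_meas: "g' \<in> borel_measurable lebesgue" by (rule measurable_completion)
  have lip: "\<bar>g (x + t *\<^sub>R u) - g x\<bar> \<le> (\<bar>L\<bar> * norm u * K + \<bar>M\<bar> * K') * \<bar>t\<bar>" for x t
  proof -
    have "g (x + t *\<^sub>R u) - g x = (ext (x + t *\<^sub>R u) - ext x) * \<phi> (x + t *\<^sub>R u) + ext x * (\<phi> (x + t *\<^sub>R u) - \<phi> x)"
      by (simp add: g_def algebra_simps)
    then have "\<bar>g (x + t *\<^sub>R u) - g x\<bar> \<le> \<bar>ext (x + t *\<^sub>R u) - ext x\<bar> * \<bar>\<phi> (x + t *\<^sub>R u)\<bar> +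
        \<bar>ext x\<bar> * \<bar>\<phi> (x + t *\<^sub>R u) - \<phi> x\<bar>"
      by (metis abs_mult abs_triangle_ineq)
    also have "\<dots> \<le> (\<bar>L\<bar> * (\<bar>t\<bar> * norm u)) * K + \<bar>M\<bar> * (K' * \<bar>t\<bar>)"
      using ext_L[of "x + t *\<^sub>R u" x] bound(1) ext_M \<phi>_lip by (intro add_mono mult_mono) auto
    finally show ?thesis by (simp add: algebra_simps)
  qed
  have deriv: "AE x in lebesgue. ((\<lambda>t. g (x + t *\<^sub>R u)) has_real_derivative g' x) (at 0)"
    using AE_in_joint
  proof (rule AE_mp, intro AE_I2 impI)
    fix x assume J: "x \<in> ?T \<longrightarrow> (\<exists>j. x \<in> joint j j)"
    show "((\<lambda>t. g (x + t *\<^sub>R u)) has_real_derivative g' x) (at 0)"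
    proof (cases "x \<in> ?T")
      case True
      then obtain j where j: "x \<in> joint j j" using J by blast
      let ?p = "\<lambda>y. pull (sheet j) R y w"
      have "((\<lambda>y. ?p y * \<phi> y) has_derivative (\<lambda>v. ?p x * \<phi>' x v + dir_deriv ?p x v * \<phi> x)) (at x)"
        by (intro has_derivative_mult deg_le_frechet[OF p] \<phi>(1))
      then have d: "(g has_derivative (\<lambda>v. ?p x * \<phi>' x v + dir_deriv ?p x v * \<phi> x)) (at x)"
      proof (rule has_derivative_transform_within_open[OF _ open_joint j])
        fix y assume y: "y \<in> joint j j"
        then have "y \<in> cell j" by (rule joint_cell) simp
        then show "?p y * \<phi> y = g y"
          using cell_subset[of j] graph_pull_cell[OF R grounded, of y j] by (auto simp: g_def ext_in)
      qed
      have "graph_pull R x = pull (sheet j) R x"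
        by (rule graph_pull_cell[OF R grounded]) (use joint_cell[OF j] in simp_all)
      then have "?p x * \<phi>' x u + dir_deriv ?p x u * \<phi> x = g' x"
        using True by (simp add: g'_def b_def piece_deriv_def sum_joint[OF j])
      then show ?thesis using has_real_derivative_along[of g _ x 0 u, simplified, OF d] by simp
    next
      case False
      have "((\<lambda>y. 0) has_derivative (\<lambda>v. 0)) (at x)" by simp
      then have d: "(g has_derivative (\<lambda>v. 0)) (at x)"
        by (rule has_derivative_transform_within_open[where s = "- ?T"])
          (use T(1) False in \<open>auto simp: g_def ext_out open_Compl\<close>)
      have "indicator (joint m m) x = (0::real)" for m
        using False joint_subset_interior[of m m] interior_subset[of ?T] by (auto simp: indicator_def)
      then have "g' x = 0" using False by (simp add: g'_def b_def piece_deriv_def)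
      then show ?thesis using has_real_derivative_along[of g _ x 0 u, simplified, OF d] by simp
    qed
  qed
  have supp: "g x = 0" if "x \<notin> cball 0 B" for x
  proof -
    have "x \<notin> ?T" using that B by blast
    then show ?thesis by (simp add: g_def ext_out)
  qed
  have zero: "integrable lebesgue g'" "integral\<^sup>L lebesgue g' = 0"
    using integral_dir_deriv_eq_0[OF g_int lip _ g'_meas deriv] supp by blast+
  have eq: "(\<lambda>x. piece_deriv w u x * \<phi> x) = (\<lambda>x. g' x - b x)" by (simp add: g'_def)
  show "integrable lebesgue (\<lambda>x. piece_deriv w u x * \<phi> x)"
    unfolding eq by (rule Bochner_Integration.integrable_diff[OF zero(1) b_leb])
  have "integral\<^sup>L lebesgue (\<lambda>x. piece_deriv w u x * \<phi> x) = - integral\<^sup>L lebesgue b"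
    using Bochner_Integration.integral_diff[OF zero(1) b_leb] zero(2) unfolding eq by linarith
  also have "integral\<^sup>L lebesgue b = (LINT x|lebesgue_on ?T. ?\<rho> x * \<phi>' x u)"
    using integral_restrict_space[of ?T lebesgue "\<lambda>x. ?\<rho> x * \<phi>' x u"] lebesgue_cell(2)
    by (simp add: b_def[abs_def])
  finally show "integral\<^sup>L lebesgue (\<lambda>x. piece_deriv w u x * \<phi> x) = - (LINT x|lebesgue_on ?T. ?\<rho> x * \<phi>' x u)" .
qed

text \<open>Apart from test functions, \<open>\<phi>\<close> may be the constant \<open>1\<close>; then the right hand side is zero and the
  statement is that the integral of the derivative of the primitive vanishes.\<close>

lemma weak_derivative_graph_pull:
  fixes \<phi> :: "real ^ 'n \<Rightarrow> real" and \<omega> :: "'n form"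
  assumes meas: "(\<lambda>x. \<omega> x v) \<in> borel_measurable (lebesgue_on (convex hull (range \<nu>)))"
    and ae: "\<And>i. AE x in lebesgue_on (cell i). \<omega> x v = ext_d k (pull (sheet i) R) x v"
    and \<phi>: "\<And>x. (\<phi> has_derivative \<phi>' x) (at x)" "\<And>u. continuous_on UNIV (\<lambda>x. \<phi>' x u)"
    and bound: "\<And>x. \<bar>\<phi> x\<bar> \<le> K" "\<And>u. \<exists>K'. \<forall>x. \<bar>\<phi>' x u\<bar> \<le> K'"
  shows "(LINT x|lebesgue_on (convex hull (range \<nu>)). \<omega> x v * \<phi> x) =
    - (\<Sum>i\<le>k. (-1) ^ i * (LINT x|lebesgue_on (convex hull (range \<nu>)). graph_pull R x (omit i v) * \<phi>' x (v i)))"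
proof -
  let ?T = "convex hull (range \<nu>)"
  have TS: "?T \<inter> space lebesgue \<in> sets lebesgue" using lebesgue_cell(2) by simp
  have parts: "integrable lebesgue (\<lambda>x. piece_deriv (omit i v) (v i) x * \<phi> x)"
    "integral\<^sup>L lebesgue (\<lambda>x. piece_deriv (omit i v) (v i) x * \<phi> x) =
      - (LINT x|lebesgue_on ?T. graph_pull R x (omit i v) * \<phi>' x (v i))" for i
  proof -
    obtain K' where K': "\<And>x. \<bar>\<phi>' x (v i)\<bar> \<le> K'" using bound(2) by blast
    show "integrable lebesgue (\<lambda>x. piece_deriv (omit i v) (v i) x * \<phi> x)"
      "integral\<^sup>L lebesgue (\<lambda>x. piece_deriv (omit i v) (v i) x * \<phi> x) =
      - (LINT x|lebesgue_on ?T. graph_pull R x (omit i v) * \<phi>' x (v i))"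
      using integral_by_parts_graph_pull[OF \<phi> bound(1) K'] by auto
  qed
  let ?S = "\<lambda>x. \<Sum>i\<le>k. (-1) ^ i * (piece_deriv (omit i v) (v i) x * \<phi> x)"
  have S_int: "integrable lebesgue ?S"
    by (intro Bochner_Integration.integrable_sum integrable_mult_right parts(1))
  have "(LINT x|lebesgue_on ?T. \<omega> x v * \<phi> x) = integral\<^sup>L lebesgue (\<lambda>x. indicator ?T x *\<^sub>R (\<omega> x v * \<phi> x))"
    by (rule integral_restrict_space[OF TS])
  also have "\<dots> = integral\<^sup>L lebesgue ?S"
  proof (rule integral_cong_AE)
    have "\<phi> \<in> borel_measurable borel"
      using \<phi>(1) by (intro borel_measurable_continuous_onI)
        (meson continuous_at_imp_continuous_on has_derivative_continuous)
    then have "\<phi> \<in> borel_measurable lebesgue" by (intro measurable_completion) simp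
    then have "(\<lambda>x. \<omega> x v * \<phi> x) \<in> borel_measurable (lebesgue_on ?T)"
      by (intro borel_measurable_times meas measurable_restrict_space1)
    then show "(\<lambda>x. indicator ?T x *\<^sub>R (\<omega> x v * \<phi> x)) \<in> borel_measurable lebesgue"
      by (simp only: borel_measurable_restrict_space_iff[OF TS])
    show "?S \<in> borel_measurable lebesgue" by (rule borel_measurable_integrable[OF S_int])
    have "AE x in lebesgue. \<forall>i\<in>UNIV. x \<in> cell i \<longrightarrow> \<omega> x v = ext_d k (pull (sheet i) R) x v"
      using ae by (subst AE_finite_all) (auto simp: AE_cell_iff)
    then show "AE x in lebesgue. indicator ?T x *\<^sub>R (\<omega> x v * \<phi> x) = ?S x"
      using AE_in_joint
    proof eventually_elim
      case (elim x)
      show ?case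
      proof (cases "x \<in> ?T")
        case True
        then obtain j where j: "x \<in> joint j j" using elim by blast
        then have "x \<in> cell j" by (rule joint_cell) simp
        then have "\<omega> x v = ext_d k (pull (sheet j) R) x v" using elim by blast
        also have "\<dots> = (\<Sum>i\<le>k. (-1) ^ i * piece_deriv (omit i v) (v i) x)"
          by (simp add: ext_d_def piece_deriv_def sum_joint[OF j])
        finally show ?thesis using True by (simp add: sum_distrib_right mult.assoc)
      next
        case False
        have "indicator (joint m m) x = (0::real)" for m
          using False joint_subset_interior[of m m] interior_subset[of ?T] by (auto simp: indicator_def)
        then show ?thesis using False by (simp add: piece_deriv_def)
      qed
    qed
  qed
  also have "\<dots> = (\<Sum>i\<le>k. (-1) ^ i * - (LINT x|lebesgue_on ?T. graph_pull R x (omit i v) * \<phi>' x (v i)))"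
    by (subst Bochner_Integration.integral_sum) (auto intro: parts(1) simp: parts(2))
  finally show ?thesis by (simp add: sum_negf)
qed

end

text \<open>The lifted pieces match because \<open>y\<^sub>i = y\<^sub>j = 0\<close> implies \<open>\<lambda>\<^sub>i = \<lambda>\<^sub>j\<close> below.  The boundary condition makes
  the trace of the glued form on the plane \<open>(\<Sum>j. y\<^sub>j) = 1\<close> vanish on the boundary of the face of the
  standard simplex there, so that it can be corrected to zero and integrated vertically.  The form
  \<open>P'\<close> provides the second form that the dependence in top degree needs.\<close>

lemma lifted_primitive:
  fixes P :: "'n option \<Rightarrow> 'n form" and P' :: "'n form"
  assumes k: "Suc k \<le> CARD('n)"
    and P: "\<And>i. form_deg_le r (Suc k) (P i)" "\<And>i. closed_form (Suc k) (P i)"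
    and agree: "\<And>i j. trace0 (Suc k) {x. bary x $ i = bary x $ j} (\<lambda>x v. P i x v - P j x v)"
    and face: "\<And>i. trace0 (Suc k) {x. bary x $ i = 0} (P i)"
    and P': "form_deg_le r (Suc k) P'" "closed_form (Suc k) P'" "\<And>i. trace0 (Suc k) {x. bary x $ i = 0} P'"
  shows "\<exists>c c' R. (c \<noteq> 0 \<or> c' \<noteq> 0) \<and> (Suc k < CARD('n) \<longrightarrow> c = 1 \<and> c' = 0) \<and>
    form_deg_le (Suc r) k R \<and> grounded k R \<and>
    (\<forall>i. ext_d k (pull (sheet i) R) = (\<lambda>x v. c * P i x v + c' * P' x v))"
proof -
  let ?F = "\<lambda>i. pull base (P i)" and ?F' = "pull base P'"
  have F: "form_deg_le r (Suc k) (?F i)" "closed_form (Suc k) (?F i)" for i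
    by (rule form_deg_le_pull[OF P(1) affine_map_base], rule closed_form_pull[OF P(1) affine_map_base P(2)])
  have F': "form_deg_le r (Suc k) ?F'" "closed_form (Suc k) ?F'"
    by (rule form_deg_le_pull[OF P'(1) affine_map_base], rule closed_form_pull[OF P'(1) affine_map_base P'(2)])
  have compat: "trace0 (Suc k) (coord_plane i \<inter> coord_plane j) (\<lambda>x v. ?F i x v - ?F j x v)" for i j
  proof -
    have "trace0 (Suc k) (coord_plane i \<inter> coord_plane j) (pull base (\<lambda>x v. P i x v - P j x v))"
      by (rule trace0_pull[OF agree affine_map_base]) (simp add: bary_base coord_plane_def)
    then show ?thesis by (simp add: pull_def)
  qed
  obtain \<Omega> where \<Omega>: "form_deg_le r (Suc k) \<Omega>" "closed_form (Suc k) \<Omega>"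
    "\<And>i. trace0 (Suc k) (coord_plane i) (\<lambda>x v. \<Omega> x v - ?F i x v)"
    using glue_on_coord_planes[of r "Suc k" ?F, OF F compat] by blast
  have face_lift: "trace0 (Suc k) (simplex_plane UNIV \<inter> coord_plane i) (pull base p)"
    if "trace0 (Suc k) {x. bary x $ i = 0} p" for p i
    by (rule trace0_pull[OF that affine_map_base]) (simp add: bary_base coord_plane_def simplex_plane_def)
  have tr: "trace0 (Suc k) (simplex_plane UNIV \<inter> coord_plane i) \<Omega>" for i
    using trace0_add[OF trace0_mono[OF \<Omega>(3)[of i] Int_lower2, of "simplex_plane UNIV"] face_lift[OF face[of i]]]
    by simp
  have coords: "on_coords UNIV a" for a :: "(real ^ 'n option) dform"
    by (rule on_coordsI) (simp add: coord_proj_def)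
  have card: "Suc k < card (UNIV :: 'n option set)" using k by simp
  obtain c c' \<delta> where c: "c \<noteq> 0 \<or> c' \<noteq> 0" "Suc (Suc k) < card (UNIV :: 'n option set) \<longrightarrow> c = 1 \<and> c' = 0"
    and \<delta>: "form_deg_le r (Suc k) \<delta>" "closed_form (Suc k) \<delta>" "\<And>i. trace0 (Suc k) (coord_plane i) \<delta>"
      "trace0 (Suc k) (simplex_plane UNIV) (\<lambda>x v. c * \<Omega> x v + c' * ?F' x v - \<delta> x v)"
    using closed_extension_from_simplex[OF card \<Omega>(1) coords \<Omega>(2) tr F'(1) coords F'(2) face_lift[OF P'(3)]]
    by blast
  define \<Omega>1 where "\<Omega>1 = (\<lambda>x v. (c * \<Omega> x v + c' * ?F' x v) - \<delta> x v)"
  have lin: "form_deg_le r (Suc k) (\<lambda>x v. c * \<Omega> x v + c' * ?F' x v)"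
    by (intro form_deg_le_add form_deg_le_cmult \<Omega>(1) F'(1))
  have \<Omega>1: "form_deg_le r (Suc k) \<Omega>1" unfolding \<Omega>1_def by (rule form_deg_le_diff[OF lin \<delta>(1)])
  have \<Omega>1_closed: "closed_form (Suc k) \<Omega>1"
    using closed_form_lincomb[OF lin \<delta>(1) closed_form_lincomb[OF \<Omega>(1) F'(1) \<Omega>(2) F'(2)] \<delta>(2), of 1 "-1"]
    by (simp add: \<Omega>1_def)
  have \<Omega>1_plane: "trace0 (Suc k) (simplex_plane UNIV) \<Omega>1" using \<delta>(4) by (simp add: \<Omega>1_def)
  define R where "R = homotopy_op fall \<Omega>1"
  note R = vertical_primitive[OF \<Omega>1 \<Omega>1_closed \<Omega>1_plane, folded R_def]
  have "ext_d k (pull (sheet i) R) = (\<lambda>x v. c * P i x v + c' * P' x v)" for i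
  proof (intro ext)
    fix x v
    have "trace0 (Suc k) (coord_plane i) (\<lambda>x v. \<Omega>1 x v - (c * ?F i x v + c' * ?F' x v))"
      using trace0_lincomb[OF \<Omega>(3)[of i] \<delta>(3)[of i], of c "-1"] by (simp add: \<Omega>1_def algebra_simps)
    from trace0D[OF this sheet_in_plane[of i x], of "\<lambda>j. sheet i (v j) - sheet i 0"]
    have "pull (sheet i) \<Omega>1 x v = c * pull (sheet i) (?F i) x v + c' * pull (sheet i) ?F' x v"
      using sheet_in_plane[of i] by (simp add: pull_def coord_plane_def)
    moreover have "pull (sheet i) (pull base p) = p" for p :: "'n form"
      by (simp add: pull_pull[OF affine_map_base] base_sheet) (simp add: pull_def)
    ultimately show "ext_d k (pull (sheet i) R) x v = c * P i x v + c' * P' x v"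
      by (simp add: ext_d_pull[OF R(1) affine_map_sheet] R(2))
  qed
  moreover have "Suc k < CARD('n) \<longrightarrow> c = 1 \<and> c' = 0" using c(2) by simp
  ultimately show ?thesis using c(1) R(1,3) by blast
qed

end

section \<open>Test functions and the volume form\<close>

lemma test_function_bounds:
  fixes \<phi> :: "'a::euclidean_space \<Rightarrow> real"
  assumes "\<phi> \<in> test_functions U"
  shows "\<And>x. (\<phi> has_derivative dir_deriv \<phi> x) (at x)"
    and "\<And>u. continuous_on UNIV (\<lambda>x. dir_deriv \<phi> x u)"
    and "\<exists>K. \<forall>x. \<bar>\<phi> x\<bar> \<le> K" and "\<And>u. \<exists>K'. \<forall>x. \<bar>dir_deriv \<phi> x u\<bar> \<le> K'"
proof -
  have "Ck_function (Suc 0) \<phi>" using assms unfolding test_functions_def by blast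
  then obtain \<phi>' where \<phi>': "\<And>x. (\<phi> has_derivative \<phi>' x) (at x)" "\<And>u. continuous_on UNIV (\<lambda>x. \<phi>' x u)"
    by auto
  have eq: "dir_deriv \<phi> x = \<phi>' x" for x using frechet_derivative_at[OF \<phi>'(1)] by simp
  show d: "\<And>x. (\<phi> has_derivative dir_deriv \<phi> x) (at x)" using \<phi>'(1) by (simp add: eq)
  show c: "\<And>u. continuous_on UNIV (\<lambda>x. dir_deriv \<phi> x u)" using \<phi>'(2) by (simp add: eq)
  obtain S where S: "compact S" "\<And>x. x \<notin> S \<Longrightarrow> \<phi> x = 0" using assms unfolding test_functions_def by blast
  have bound: "\<exists>K. \<forall>x. \<bar>f x\<bar> \<le> K"
    if f: "continuous_on UNIV f" "\<And>x. x \<notin> S \<Longrightarrow> f x = 0" for f :: "'a \<Rightarrow> real"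
  proof -
    have "bounded (f ` S)"
      by (intro compact_imp_bounded compact_continuous_image S(1) continuous_on_subset[OF f(1)]) simp
    then obtain K where "\<And>x. x \<in> S \<Longrightarrow> \<bar>f x\<bar> \<le> K" unfolding bounded_iff by auto
    then have "\<bar>f x\<bar> \<le> \<bar>K\<bar>" for x using f(2)[of x] by (cases "x \<in> S") force+
    then show ?thesis by blast
  qed
  show "\<exists>K. \<forall>x. \<bar>\<phi> x\<bar> \<le> K"
    by (rule bound[OF _ S(2)]) (meson continuous_at_imp_continuous_on d has_derivative_continuous)
  have "dir_deriv \<phi> x u = 0" if x: "x \<notin> S" for x u
  proof -
    have "((\<lambda>y. 0) has_derivative (\<lambda>v. 0)) (at x)" by simp
    then have "(\<phi> has_derivative (\<lambda>v. 0)) (at x)"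
      by (rule has_derivative_transform_within_open[where s = "- S"])
        (use S x in \<open>auto simp: compact_imp_closed open_Compl\<close>)
    from dir_deriv_eqI[OF this] show ?thesis by simp
  qed
  then show "\<And>u. \<exists>K'. \<forall>x. \<bar>dir_deriv \<phi> x u\<bar> \<le> K'" by (intro bound[OF c])
qed

lemma std_frame_bij: "bij_betw (std_frame :: nat \<Rightarrow> real ^ 'n::finite) {..<CARD('n)} Basis"
proof -
  have "\<exists>e :: nat \<Rightarrow> real ^ 'n. bij_betw e {..<CARD('n)} Basis"
    using ex_bij_betw_nat_finite[of "Basis :: (real ^ 'n) set"] by (simp add: atLeast0LessThan)
  then show ?thesis unfolding std_frame_def by (rule someI_ex)
qed

lemma ex_volume_form:
  "\<exists>p :: 'n::finite form. form_deg_le 0 CARD('n) p \<and> closed_form CARD('n) p \<and> (\<forall>x. p x std_frame = 1)"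
proof -
  define pos where "pos = (\<lambda>a :: 'n. inv_into {..<CARD('n)} std_frame (axis a (1::real)))"
  have ax: "axis a (1::real) \<in> std_frame ` {..<CARD('n)}" for a :: 'n
    using std_frame_bij[where 'n = 'n] by (auto simp: bij_betw_def Basis_vec_def)
  have pos: "pos a < CARD('n)" "std_frame (pos a) = axis a 1" for a
    using inv_into_into[OF ax[of a]] f_inv_into_f[OF ax[of a]] by (simp_all add: pos_def)
  have pos_inj: "a = b" if "pos a = pos b" for a b
  proof -
    have "axis a (1 :: real) = axis b 1" using pos(2)[of a] pos(2)[of b] unfolding that by (rule trans[OF sym])
    then show ?thesis by (simp add: axis_eq_axis)
  qed
  have pos_surj: "\<exists>a. pos a = i" if "i < CARD('n)" for i
  proof -
    have "std_frame i \<in> (Basis :: (real ^ 'n) set)" using std_frame_bij that by (auto simp: bij_betw_def)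
    then obtain a :: 'n where a: "std_frame i = axis a (1::real)" by (auto simp: Basis_vec_def)
    then have "std_frame (pos a) = (std_frame i :: real ^ 'n)" using pos(2)[of a] by simp
    then show ?thesis
      using std_frame_bij[where 'n = 'n] pos(1)[of a] that by (metis bij_betw_def inj_onD lessThan_iff)
  qed
  define \<alpha> where "\<alpha> = (\<lambda>v :: nat \<Rightarrow> real ^ 'n. det (\<chi> a. v (pos a)))"
  have alt: "alternating CARD('n) \<alpha>"
  proof (rule alternatingI)
    show "\<alpha> v = \<alpha> w" if "\<And>i. i < CARD('n) \<Longrightarrow> v i = w i" for v w
      using that pos(1) by (simp add: \<alpha>_def)
    show "linear (\<lambda>y. \<alpha> (v(i := y)))" if i: "i < CARD('n)" for v i
    proof -
      obtain b where b: "pos b = i" using pos_surj[OF i] by blast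
      have eq: "(\<chi> a. (v(i := y)) (pos a)) = (\<chi> a. if a = b then y else v (pos a))" for y
        using pos_inj b by (auto simp: vec_eq_iff)
      show ?thesis
        unfolding \<alpha>_def eq
      proof (rule linearI)
        fix y z :: "real ^ 'n" and c :: real
        show "det (\<chi> a. if a = b then y + z else v (pos a)) =
            det (\<chi> a. if a = b then y else v (pos a)) + det (\<chi> a. if a = b then z else v (pos a))"
          by (rule det_row_add)
        show "det (\<chi> a. if a = b then c *\<^sub>R y else v (pos a)) =
            c *\<^sub>R det (\<chi> a. if a = b then y else v (pos a))"
          using det_row_mul[of b c "\<lambda>_. y" "\<lambda>a. v (pos a)"] unfolding scalar_mult_eq_scaleR by simp
      qed
    qed
    show "\<alpha> v = 0" if ij: "i < j" "j < CARD('n)" "v i = v j" for v i j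
    proof -
      obtain a b where ab: "pos a = i" "pos b = j" using pos_surj ij by (metis less_trans)
      then have "a \<noteq> b" using ij(1) by auto
      then show ?thesis unfolding \<alpha>_def
        by (rule det_identical_rows) (simp add: row_def ab ij(3))
    qed
  qed
  have "(\<chi> a. std_frame (pos a)) = (mat 1 :: real ^ 'n ^ 'n)"
    by (simp add: pos(2) vec_eq_iff mat_def axis_def)
  then have "\<alpha> std_frame = 1" by (simp add: \<alpha>_def)
  moreover have "form_deg_le 0 CARD('n) (\<lambda>x. \<alpha>)" by (simp add: form_deg_le_def alt deg_le.const)
  moreover have "closed_form CARD('n) (\<lambda>x. \<alpha>)" by (simp add: closed_form_def ext_d_def dir_deriv_const)
  ultimately show ?thesis by (intro exI[of _ "\<lambda>x. \<alpha>"]) simp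
qed


section \<open>Exactness with boundary conditions on the Alfeld split\<close>

theorem theorem3p1:
  fixes V :: "(real ^ 'n::finite) set" and r k :: nat and \<omega> :: "'n form"
  assumes "CARD('n) \<ge> 2"
    and "\<not> affine_dependent V" and "card V = CARD('n) + 1"
    and "1 \<le> k" and "k \<le> CARD('n)"
    and "\<omega> \<in> Vd0_space r k V"
    and "weak_ext_deriv k (convex hull V) \<omega> zero_form"
  shows "\<exists>\<rho> \<in> M0_space (r + 1) (k - 1) V. weak_ext_deriv (k - 1) (convex hull V) \<rho> \<omega>"
proof -
  have "finite V" using assms(3) by (intro card_ge_0_finite) simp
  then obtain \<nu> :: "'n option \<Rightarrow> real ^ 'n" where bij: "bij_betw \<nu> UNIV V"
    using finite_same_card_bij[of "UNIV :: 'n option set" V] assms(3) by auto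
  then have V: "V = range \<nu>" and inj: "inj \<nu>" by (auto simp: bij_betw_def)
  interpret simplex_coords \<nu> using inj assms(2) by unfold_locales (simp_all add: V)
  let ?T = "convex hull (range \<nu>)"
  obtain k' where k: "k = Suc k'" using assms(4) by (cases k) auto
  have weak: "weak_ext_deriv k ?T \<omega> zero_form" using assms(7) by (simp add: V)
  have Vd0: "\<omega> \<in> Vd0_space r k (range \<nu>)" using assms(6) by (simp add: V)
  then have "\<omega> \<in> V_space r k (range \<nu>)" by (auto simp: Vd0_space_def Vd_space_def split: if_splits)
  then have L2: "\<omega> \<in> L2_forms k ?T"
    and pieces: "\<And>i. \<exists>p\<in>poly_forms r k. AE x in lebesgue_on (cell i). \<omega> x = p x"
    by (auto simp: V_space_def alfeld_split_V)
  have meas: "(\<lambda>x. \<omega> x v) \<in> borel_measurable (lebesgue_on ?T)" if "v \<in> {..<k} \<rightarrow> Basis" for v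
    using L2 that by (simp add: L2_forms_def)
  obtain P where P0: "\<And>i. P i \<in> poly_forms r k" and ae: "\<And>i. AE x in lebesgue_on (cell i). \<omega> x = P i x"
    using pieces by metis
  have P: "form_deg_le r k (P i)" for i using P0 by (simp add: poly_forms_iff_form_deg_le)
  have closed: "closed_form k (P i)" for i by (rule pieces_closed[OF weak meas P ae])
  have agree: "trace0 k {x. bary x $ i = bary x $ j} (\<lambda>x v. P i x v - P j x v)" for i j
    by (rule pieces_traces_agree[OF weak meas P ae])
  have face: "trace0 k {x. bary x $ i = 0} (P i)" for i
  proof (cases "k < CARD('n)")
    case True
    let ?F = "convex hull (range \<nu> - {\<nu> i})"
    have "card (range \<nu> - {\<nu> i}) = Suc (CARD('n) - 1)" by (simp add: card_V)
    then have "?F \<in> subsimplices (CARD('n) - 1) (range \<nu>)" unfolding subsimplices_def by blast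
    moreover have "cell i \<in> alfeld_split (range \<nu>)" by (simp add: alfeld_split_V)
    moreover have "?F \<subseteq> cell i" unfolding cell_def by (rule hull_mono) blast
    ultimately have "tr k ?F (P i) = zero_form"
      using Vd0 True P0[of i] ae[of i] unfolding Vd0_space_def by auto
    then show ?thesis by (rule trace0_face_if_tr[OF P assms(1)])
  next
    case False
    then have "k = CARD('n)" using assms(5) by simp
    then show ?thesis using trace0_face_top P by metis
  qed
  \<comment> \<open>In top degree the volume form spans what is not exact.\<close>
  obtain P' :: "'n form" where P': "form_deg_le r k P'" "closed_form k P'" "\<And>i. trace0 k {x. bary x $ i = 0} P'"
    and vol: "k = CARD('n) \<Longrightarrow> P' x std_frame = 1" for x
  proof (cases "k = CARD('n)")
    case True
    obtain p :: "'n form" where p: "form_deg_le 0 CARD('n) p" "closed_form CARD('n) p" "\<And>x. p x std_frame = 1"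
      using ex_volume_form by blast
    show ?thesis
      by (rule that[of p]) (use p True trace0_face_top[OF p(1)] form_deg_le_mono[OF p(1)] in auto)
  next
    case False
    show ?thesis
      by (rule that[of "\<lambda>x v. 0"])
        (use False in \<open>auto simp: form_deg_le_zero closed_form_def ext_d_def dir_deriv_const trace0_def\<close>)
  qed
  obtain c c' R where c: "c \<noteq> 0 \<or> c' \<noteq> 0" "k < CARD('n) \<longrightarrow> c = 1 \<and> c' = 0"
    and R: "form_deg_le (Suc r) k' R" "grounded k' R"
      "\<And>i. ext_d k' (pull (sheet i) R) = (\<lambda>x v. c * P i x v + c' * P' x v)"
    using lifted_primitive[of k' r P P'] assms(5) P closed agree face P' unfolding k by blast
  have "c' = 0"
  proof (cases "k < CARD('n)")
    case False
    then have kn: "k = CARD('n)" using assms(5) by simp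
    have frame: "std_frame \<in> {..<k} \<rightarrow> (Basis :: (real ^ 'n) set)"
      using std_frame_bij[where 'n = 'n] kn by (auto simp: bij_betw_def)
    have int0: "(LINT x|lebesgue_on ?T. \<omega> x std_frame) = 0"
      using Vd0 False by (simp add: Vd0_space_def form_integral_def)
    have fin: "integrable (lebesgue_on ?T) (\<lambda>x. 1 :: real)"
      using integrable_restrict_space[of ?T lebesgue "\<lambda>x. 1 :: real"] lebesgue_cell(2)
        lmeasurable_compact[OF compact_hull] by (simp add: lmeasurable_iff_integrable)
    have int: "integrable (lebesgue_on ?T) (\<lambda>x. \<omega> x std_frame)"
    proof (rule Bochner_Integration.integrable_bound)
      show "integrable (lebesgue_on ?T) (\<lambda>x. 1 + (\<omega> x std_frame)\<^sup>2)"
        using L2 frame fin by (intro Bochner_Integration.integrable_add) (auto simp: L2_forms_def)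
      have "\<bar>t\<bar> \<le> 1 + t\<^sup>2" for t :: real
      proof -
        have "0 \<le> (\<bar>t\<bar> - 1)\<^sup>2" by simp
        then have "2 * \<bar>t\<bar> \<le> 1 + t\<^sup>2" by (simp add: power2_diff)
        then show ?thesis by linarith
      qed
      then show "AE x in lebesgue_on ?T. norm (\<omega> x std_frame) \<le> norm (1 + (\<omega> x std_frame)\<^sup>2)"
        by (intro AE_I2) (simp add: add_nonneg_nonneg)
    qed (rule meas[OF frame])
    have "(LINT x|lebesgue_on ?T. (c * \<omega> x std_frame + c' * P' x std_frame) * 1) =
        - (\<Sum>i\<le>k'. (-1) ^ i * (LINT x|lebesgue_on ?T. graph_pull R x (omit i std_frame) * 0))"
    proof (rule weak_derivative_graph_pull[OF R(1,2), where \<phi> = "\<lambda>x. 1" and \<phi>' = "\<lambda>x v. 0" and K = 1])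
      show "(\<lambda>x. c * \<omega> x std_frame + c' * P' x std_frame) \<in> borel_measurable (lebesgue_on ?T)"
        using meas[OF frame] vol[OF kn] by simp
      show "AE x in lebesgue_on (cell i). c * \<omega> x std_frame + c' * P' x std_frame =
          ext_d k' (pull (sheet i) R) x std_frame" for i
        using ae[of i] by (rule AE_mp) (simp add: R(3))
    qed auto
    then have "(LINT x|lebesgue_on ?T. c * \<omega> x std_frame + c') = 0"
      by (simp add: vol[OF kn])
    then have "c' * (LINT x|lebesgue_on ?T. 1) = 0"
      using Bochner_Integration.integral_add[OF integrable_mult_right[OF int, of c] integrable_mult_right[OF fin, of c']]
      by (auto simp: int0)
    moreover have "(LINT x|lebesgue_on ?T. 1 :: real) \<noteq> 0"
    proof
      assume "(LINT x|lebesgue_on ?T. 1 :: real) = 0"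
      moreover have "(LINT x|lebesgue_on ?T. 1 :: real) = integral\<^sup>L lebesgue (\<lambda>x. indicator ?T x :: real)"
        using integral_restrict_space[of ?T lebesgue "\<lambda>x. 1 :: real"] lebesgue_cell(2) by simp
      moreover have "integral\<^sup>L lebesgue (\<lambda>x. indicator ?T x :: real) \<noteq> 0"
      proof (rule integral_pos_if_pos_on_open[where U = "joint None None"])
        show "integrable lebesgue (\<lambda>x. indicator ?T x :: real)"
          using lmeasurable_compact[OF compact_hull] by (simp add: lmeasurable_iff_integrable)
        show "joint None None \<noteq> {}"
        proof -
          obtain x b where "b > 0" "bary x $ None = b" "\<And>m. m \<noteq> None \<Longrightarrow> b < bary x $ m"
            using ex_min_point[of "{None}"] by auto
          then have "x \<in> joint None None" by (simp add: joint_def)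
          then show ?thesis by blast
        qed
        show "0 < (indicator ?T x :: real)" if "x \<in> joint None None" for x
          using that joint_subset_interior[of None None] interior_subset[of ?T] by (auto simp: indicator_def)
      qed (auto simp: open_joint)
      ultimately show False by simp
    qed
    ultimately show ?thesis by simp
  qed (use c(2) in simp)
  then have "c \<noteq> 0" using c(1) by simp
  define R1 where "R1 = (\<lambda>y w. (1 / c) * R y w)"
  have R1: "form_deg_le (Suc r) k' R1" unfolding R1_def by (rule form_deg_le_cmult[OF R(1)])
  have R1_grounded: "grounded k' R1" using R(2) by (simp add: R1_def grounded_def)
  have dR1: "ext_d k' (pull (sheet i) R1) = P i" for i
  proof -
    have "pull (sheet i) R1 = (\<lambda>x v. (1 / c) * pull (sheet i) R x v + 0 * pull (sheet i) R x v)"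
      by (simp add: R1_def pull_def)
    moreover note ext_d_lincomb[OF form_deg_le_pull[OF R(1) affine_map_sheet] form_deg_le_pull[OF R(1) affine_map_sheet],
        of "1 / c" i 0 i]
    ultimately have "ext_d k' (pull (sheet i) R1) =
        (\<lambda>x v. (1 / c) * ext_d k' (pull (sheet i) R) x v + 0 * ext_d k' (pull (sheet i) R) x v)"
      by (simp only:)
    then show ?thesis using \<open>c \<noteq> 0\<close> \<open>c' = 0\<close> by (simp add: R(3))
  qed
  have "weak_ext_deriv k' ?T (graph_pull R1) \<omega>"
    unfolding weak_ext_deriv_def
  proof (intro ballI)
    fix \<phi> and v :: "nat \<Rightarrow> real ^ 'n"
    assume \<phi>: "\<phi> \<in> test_functions (interior ?T)" and v: "v \<in> {..<Suc k'} \<rightarrow> Basis"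
    note b = test_function_bounds[OF \<phi>]
    obtain K where K: "\<And>x. \<bar>\<phi> x\<bar> \<le> K" using b(3) by blast
    show "(LINT x|lebesgue_on ?T. \<omega> x v * \<phi> x) =
        - (\<Sum>i\<le>k'. (-1) ^ i * (LINT x|lebesgue_on ?T. graph_pull R1 x (omit i v) * dir_deriv \<phi> x (v i)))"
    proof (rule weak_derivative_graph_pull[OF R1 R1_grounded meas _ b(1,2) K b(4)])
      show "AE x in lebesgue_on (cell i). \<omega> x v = ext_d k' (pull (sheet i) R1) x v" for i
        using ae[of i] by (rule AE_mp) (simp add: dR1)
    qed (use v k in simp)
  qed
  moreover have "graph_pull R1 \<in> M0_space (Suc r) k' (range \<nu>)" by (rule graph_pull_M0[OF R1 R1_grounded])
  ultimately show ?thesis by (auto simp: k V)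
qed

end
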